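(* Let $\varepsilon>0$ and let $H(x,y)=\frac{|y|^2}{2}+V_1(x_1)+V_2(x_2)$ on $\mathbb{R}^4$, where $V_1(x_1)=4(x_1^2-\varepsilon x_1^4)$ and $V_2(x_2)=4(x_2^2+\varepsilon x_2^4)$ (the regularized Stark problem), and let $e_*=\varepsilon^{-1}$ be the critical value of $V=V_1+V_2$ at its saddles $v_{1,2}=(\pm(2\varepsilon)^{-1/2},0)$. Then for every $E>e_*$, the energy surface $H^{-1}(E)$ admits a weakly convex foliation on $S_E$ (with $l=2$; $S_E,K_E$ as defined in the context). The binding orbits are the two Lyapunov orbits around $p_1=(v_1,0)$ and $p_2=(v_2,0)$ and an index-$3$ orbit projecting to $K_E$, and the regular leaves project to the gradient flow lines of $H_1(x_1,y_1)=\frac{y_1^2}{2}+V_1(x_1)$.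
   Context: Conventions: coordinates $(x,y)=(x_1,x_2,y_1,y_2)$ on $\mathbb{R}^4$, $\omega_0=dy_1\wedge dx_1+dy_2\wedge dx_2$, Hamiltonian vector field $X_H=(\partial_yH,-\partial_xH)$. Let $H_2(x_2,y_2)=\frac{y_2^2}{2}+V_2(x_2)$. "Project to gradient flow lines of $H_1$" refers to the projection $(x,y)\mapsto(x_1,y_1)$. $K_E$, $S_E$. For $E>e_*$, the Lyapunov orbits around $p_1,p_2$ are the index-$2$ hyperbolic orbits $P^{1}_{2,E},P^2_{2,E}=\{(\pm(2\varepsilon)^{-1/2},0)\}\times\{H_2=E-e_*\}$ (in the $(x_1,y_1)$ and $(x_2,y_2)$ planes). $K_E$ is the disk-like region in the $x$-plane bounded by the projections of the two Lyapunov orbits and arcs of $V^{-1}(E)$, and $S_E$ is the subset of $H^{-1}(E)$ whose projection to the $x$-plane is $K_E$. The boundary of $S_E$ is the union of two two-spheres $\mathcal{S}_1,\mathcal{S}_2$ with $\mathcal{S}_i\supset P^i_{2,E}$. Index. At a regular point of $H$ let $X_0=\nabla H/|\nabla H|$ and $X_i=j_iX_0$, $i=1,2,3$, where $j_1(a_1,a_2,b_1,b_2)=(b_2,-b_1,a_2,-a_1)$, $j_2(a_1,a_2,b_1,b_2)=(a_2,-a_1,-b_2,b_1)$, $j_3(a_1,a_2,b_1,b_2)=(b_1,b_2,-a_1,-a_2)$. Then $X_3$ is parallel to $X_H$ and $\{X_1,X_2\}$ is a symplectic basis of a plane in $TH^{-1}(E)$ transverse to $X_H$. Along a non-constant trajectory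 $w(t)$, a linearized solution $u=\alpha_1X_1+\alpha_2X_2+\alpha_3X_3$ tangent to the energy surface has transverse part $\alpha=\alpha_1+i\alpha_2$, with continuous argument $\theta(t)$ if $\alpha\neq0$. For a periodic orbit $P=(w,T)$ set $I=\{(\theta(T)-\theta(0))/2\pi:\alpha(0)\ne0\}$, a compact interval of length $<1/2$. For $\delta>0$ small let $I_\delta=I-\delta$. The index $\mu(P)$ is $2k+1$ if $I_\delta\subset(k,k+1)$ and $2k$ if $k\in\mathrm{int}(I_\delta)$. Weakly convex foliation. A weakly convex foliation adapted to $S_E$ is a singular foliation of $S_E$ such that: (i) its singular set (the binding) consists of $P^1_{2,E},\dots,P^l_{2,E}$ and an unknotted periodic orbit $P_{3,E}$ of index $3$; (ii) the complement of the binding in $S_E$ is foliated by properly embedded planes and cylinders (regular leaves), namely: (a) $l$ pairs of planes $U^j_{1,E},U^j_{2,E}\subset\mathcal{S}_j$, $j=1,\dots,l$, each pair asymptotic to $P^j_{2,E}$; (b) $l$ cylinders $V^j_E$, each asymptotic to $P_{3,E}$ and to $P^j_{2,E}$; (c) $l$ families of planes $D^j_{\tau,E}$, $\tau\in(0,1)$, all asymptotic to $P_{3,E}$, where $D^j_{\tau,E}$ breaks onto (converges to) the closure of $U^j_{1,E}\cup V^j_E$ as $\tau\to0^+$ and onto the closure of $U^{j+1}_{2,E}\cup V^{j+1}_E$ as $\tau\to1^-$, with the convention $l+1=1$; (iii) all regular leaves are transverse to the flow. Here a leaf is asymptotic to a periodic orbit if the orbit is a boundary component of its closure. *)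

theory Defs
  imports "HOL-Analysis.Analysis"
begin

section \<open>Smooth maps and embedded surfaces\<close>

primrec Ck_on :: "nat \<Rightarrow> 'a::real_normed_vector set \<Rightarrow> ('a \<Rightarrow> 'b::real_normed_vector) \<Rightarrow> bool" where
  "Ck_on 0 U f \<longleftrightarrow> continuous_on U f"
| "Ck_on (Suc k) U f \<longleftrightarrow>
     (\<forall>x\<in>U. f differentiable (at x)) \<and> (\<forall>v. Ck_on k U (\<lambda>x. frechet_derivative f (at x) v))"

text \<open>Only meant for open \<open>U\<close>.\<close>

definition smooth_on :: "'a::real_normed_vector set \<Rightarrow> ('a \<Rightarrow> 'b::real_normed_vector) \<Rightarrow> bool" where
  "smooth_on U f \<longleftrightarrow> (\<forall>k. Ck_on k U f)"

definition smooth_embedding :: "'a::real_normed_vector set \<Rightarrow> ('a \<Rightarrow> 'b::real_normed_vector) \<Rightarrow> bool" where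
  "smooth_embedding U f \<longleftrightarrow>
     open U \<and> smooth_on U f \<and> (\<forall>z\<in>U. inj (frechet_derivative f (at z))) \<and>
     (\<exists>g. homeomorphism U (f ` U) f g)"

text \<open>A submanifold that is closed as a subset of \<open>M\<close> is the same as one whose inclusion
  into \<open>M\<close> is proper.  The type \<open>complex\<close> serves as the real plane; the punctured plane is the
  model of the open cylinder.\<close>

definition proper_plane :: "'a::real_normed_vector set \<Rightarrow> 'a set \<Rightarrow> bool" where
  "proper_plane M L \<longleftrightarrow>
     (\<exists>f. smooth_embedding (UNIV :: complex set) f \<and> L = range f) \<and> closedin (top_of_set M) L"

definition proper_cylinder :: "'a::real_normed_vector set \<Rightarrow> 'a set \<Rightarrow> bool" where
  "proper_cylinder M L \<longleftrightarrow>
     (\<exists>f. smooth_embedding (- {0 :: complex}) f \<and> L = f ` (- {0})) \<and> closedin (top_of_set M) L"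

definition smooth_plane_family :: "(real \<Rightarrow> 'a::real_normed_vector set) \<Rightarrow> bool" where
  "smooth_plane_family D \<longleftrightarrow>
     (\<exists>\<Psi>. smooth_embedding ((UNIV :: complex set) \<times> {0<..<1::real}) \<Psi> \<and>
          (\<forall>\<tau>\<in>{0<..<1}. D \<tau> = range (\<lambda>z. \<Psi> (z, \<tau>))))"

text \<open>Velocities of curves in \<open>L\<close>; for an embedded submanifold this is its tangent space.\<close>

definition tangent_vectors :: "'a::real_normed_vector set \<Rightarrow> 'a \<Rightarrow> 'a set" where
  "tangent_vectors L p =
     {v. \<exists>c :: real \<Rightarrow> 'a. range c \<subseteq> L \<and> c 0 = p \<and> (c has_vector_derivative v) (at 0)}"

definition surface_interior :: "'a::real_normed_vector set \<Rightarrow> 'a set" where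
  "surface_interior S =
     {p \<in> S. \<exists>N. openin (top_of_set S) N \<and> p \<in> N \<and> N homeomorphic (UNIV :: complex set)}"

definition surface_boundary :: "'a::real_normed_vector set \<Rightarrow> 'a set" where
  "surface_boundary S =
     {p \<in> S. \<exists>N h g. openin (top_of_set S) N \<and> p \<in> N \<and>
                homeomorphism N {z :: complex. 0 \<le> Im z} h g \<and> h p = 0}"

definition asymptotic_to :: "'a::real_normed_vector set \<Rightarrow> 'a set \<Rightarrow> bool" where
  "asymptotic_to L P \<longleftrightarrow>
     closure L = surface_interior (closure L) \<union> surface_boundary (closure L) \<and>
     P \<in> components (surface_boundary (closure L))"

text \<open>Convergence in the Hausdorff distance.\<close>

definition hausdorff_converges :: "('i \<Rightarrow> 'a::metric_space set) \<Rightarrow> 'a set \<Rightarrow> 'i filter \<Rightarrow> bool" where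
  "hausdorff_converges D A F \<longleftrightarrow>
     (\<forall>\<eta>>0. \<forall>\<^sub>F \<tau> in F. (\<forall>a\<in>A. \<exists>d\<in>D \<tau>. dist a d < \<eta>) \<and> (\<forall>d\<in>D \<tau>. \<exists>a\<in>A. dist a d < \<eta>))"

definition open_cube :: "(real \<times> real \<times> real) set" where
  "open_cube = {-1<..<1} \<times> {-1<..<1} \<times> {-1<..<1}"

text \<open>A smooth codimension-one foliation chart of the 3-manifold \<open>M\<close> at \<open>p\<close>. The half cube occurs
  at boundary points, where the foliation is tangent to the boundary; smoothness on the half cube
  means that the parametrization extends smoothly to the cube.\<close>

definition foliated_at :: "'a::real_normed_vector set \<Rightarrow> 'a set set \<Rightarrow> 'a \<Rightarrow> bool" where
  "foliated_at M \<L> p \<longleftrightarrow>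
     (\<exists>N \<Phi> W. open N \<and> p \<in> N \<and> smooth_embedding open_cube \<Phi> \<and>
        (W = open_cube \<or> W = {(a, b, c) \<in> open_cube. 0 \<le> c}) \<and>
        \<Phi> ` W = M \<inter> N \<and>
        (\<forall>c. \<exists>L\<in>\<L>. \<Phi> ` {q \<in> W. snd (snd q) = c} \<subseteq> L))"

definition unknotted_in :: "'a::real_normed_vector set \<Rightarrow> 'a set \<Rightarrow> bool" where
  "unknotted_in S P \<longleftrightarrow>
     (\<exists>U (f :: complex \<Rightarrow> 'a). open U \<and> cball 0 1 \<subseteq> U \<and> smooth_on U f \<and>
        (\<forall>z\<in>cball 0 1. inj (frechet_derivative f (at z))) \<and> inj_on f (cball 0 1) \<and>
        f ` cball 0 1 \<subseteq> S \<and> f ` sphere 0 1 = P)"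

section \<open>Hamiltonian dynamics in dimension four\<close>

text \<open>Coordinates are ordered \<open>(x\<^sub>1, x\<^sub>2, y\<^sub>1, y\<^sub>2)\<close>.\<close>

type_synonym R4 = "real \<times> real \<times> real \<times> real"

definition gradient :: "('a::euclidean_space \<Rightarrow> real) \<Rightarrow> 'a \<Rightarrow> 'a" where
  "gradient f p = (\<Sum>b\<in>Basis. frechet_derivative f (at p) b *\<^sub>R b)"

definition ham_vf :: "(R4 \<Rightarrow> real) \<Rightarrow> R4 \<Rightarrow> R4" where
  "ham_vf H p = (case gradient H p of (a1, a2, b1, b2) \<Rightarrow> (b1, b2, - a1, - a2))"

text \<open>A periodic orbit is a pair of a trajectory and its period, here always the least one.\<close>

type_synonym orbit = "(real \<Rightarrow> R4) \<times> real"

definition periodic_orbit :: "(R4 \<Rightarrow> real) \<Rightarrow> orbit \<Rightarrow> bool" where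
  "periodic_orbit H P \<longleftrightarrow> (case P of (w, T) \<Rightarrow>
     (\<forall>t. (w has_vector_derivative ham_vf H (w t)) (at t)) \<and> \<not> w constant_on UNIV \<and>
     0 < T \<and> (\<forall>t. w (t + T) = w t) \<and> (\<forall>S. 0 < S \<and> S < T \<longrightarrow> \<not> (\<forall>t. w (t + S) = w t)))"

definition orbit_set :: "orbit \<Rightarrow> R4 set" where
  "orbit_set P = range (fst P)"

definition j1 :: "R4 \<Rightarrow> R4" where "j1 = (\<lambda>(a1, a2, b1, b2). (b2, - b1, a2, - a1))"
definition j2 :: "R4 \<Rightarrow> R4" where "j2 = (\<lambda>(a1, a2, b1, b2). (a2, - a1, - b2, b1))"
definition j3 :: "R4 \<Rightarrow> R4" where "j3 = (\<lambda>(a1, a2, b1, b2). (b1, b2, - a1, - a2))"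

definition X0 :: "(R4 \<Rightarrow> real) \<Rightarrow> R4 \<Rightarrow> R4" where
  "X0 H p = gradient H p /\<^sub>R norm (gradient H p)"

definition linearized_solution :: "(R4 \<Rightarrow> real) \<Rightarrow> (real \<Rightarrow> R4) \<Rightarrow> (real \<Rightarrow> R4) \<Rightarrow> bool" where
  "linearized_solution H w u \<longleftrightarrow>
     (\<forall>t. (u has_vector_derivative frechet_derivative (ham_vf H) (at (w t)) (u t)) (at t))"

text \<open>\<open>\<alpha>\<close> is the transverse part \<open>\<alpha>\<^sub>1 + i \<alpha>\<^sub>2\<close> of a linearized solution along \<open>w\<close>.  The absence of
  a component along \<open>X\<^sub>0\<close> says that the solution is tangent to the energy surface.\<close>

definition transverse_solution :: "(R4 \<Rightarrow> real) \<Rightarrow> (real \<Rightarrow> R4) \<Rightarrow> (real \<Rightarrow> complex) \<Rightarrow> bool" where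
  "transverse_solution H w \<alpha> \<longleftrightarrow>
     (\<exists>u \<alpha>3. linearized_solution H w u \<and>
        (\<forall>t. u t = Re (\<alpha> t) *\<^sub>R j1 (X0 H (w t)) + Im (\<alpha> t) *\<^sub>R j2 (X0 H (w t))
                   + \<alpha>3 t *\<^sub>R j3 (X0 H (w t))))"

definition rotation_interval :: "(R4 \<Rightarrow> real) \<Rightarrow> orbit \<Rightarrow> real set" where
  "rotation_interval H P = (case P of (w, T) \<Rightarrow>
     {(\<theta> T - \<theta> 0) / (2 * pi) | \<theta> \<alpha>. transverse_solution H w \<alpha> \<and> \<alpha> 0 \<noteq> 0 \<and>
        continuous_on UNIV \<theta> \<and> (\<forall>t. \<alpha> t = of_real (cmod (\<alpha> t)) * cis (\<theta> t))})"

definition orbit_index :: "(R4 \<Rightarrow> real) \<Rightarrow> orbit \<Rightarrow> int" where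
  "orbit_index H P = (THE m.
     \<forall>\<^sub>F \<delta> in at_right 0. let I = (\<lambda>r. r - \<delta>) ` rotation_interval H P in
       \<exists>k :: int. (m = 2 * k + 1 \<and> I \<subseteq> {of_int k <..< of_int (k + 1)}) \<or>
                  (m = 2 * k \<and> of_int k \<in> interior I))"

text \<open>The Floquet multipliers transverse to the flow inside the energy surface are
  \<open>m\<close> and \<open>1 / m\<close> with \<open>m\<close> real and \<open>\<bar>m\<bar> > 1\<close>.\<close>

definition hyperbolic_orbit :: "(R4 \<Rightarrow> real) \<Rightarrow> orbit \<Rightarrow> bool" where
  "hyperbolic_orbit H P \<longleftrightarrow> (case P of (w, T) \<Rightarrow>
     (\<exists>m::real. 1 < \<bar>m\<bar> \<and>
       (\<forall>\<kappa>\<in>{m, 1 / m}. \<exists>\<alpha>. transverse_solution H w \<alpha> \<and> \<alpha> 0 \<noteq> 0 \<and> \<alpha> T = of_real \<kappa> * \<alpha> 0)))"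

section \<open>Weakly convex foliations\<close>

datatype leaf_label = LU1 nat | LU2 nat | LV nat | LD nat real

definition leaf_labels :: "nat \<Rightarrow> leaf_label set" where
  "leaf_labels l = LU1 ` {1..l} \<union> LU2 ` {1..l} \<union> LV ` {1..l} \<union> {LD j \<tau> | j \<tau>. j \<in> {1..l} \<and> \<tau> \<in> {0<..<1}}"

primrec leaf :: "(nat \<Rightarrow> R4 set) \<Rightarrow> (nat \<Rightarrow> R4 set) \<Rightarrow> (nat \<Rightarrow> R4 set) \<Rightarrow> (nat \<Rightarrow> real \<Rightarrow> R4 set)
    \<Rightarrow> leaf_label \<Rightarrow> R4 set" where
  "leaf U1 U2 V D (LU1 j) = U1 j"
| "leaf U1 U2 V D (LU2 j) = U2 j"
| "leaf U1 U2 V D (LV j) = V j"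
| "leaf U1 U2 V D (LD j \<tau>) = D j \<tau>"

text \<open>The component, containing \<open>P\<close>, of the boundary of \<open>S\<close> as a subset of the energy surface.\<close>

definition boundary_sphere :: "(R4 \<Rightarrow> real) \<Rightarrow> real \<Rightarrow> R4 set \<Rightarrow> R4 set \<Rightarrow> R4 set" where
  "boundary_sphere H E S P = \<Union>{C \<in> components (top_of_set (H -` {E}) frontier_of S). P \<subseteq> C}"

definition cyclic_next :: "nat \<Rightarrow> nat \<Rightarrow> nat" where
  "cyclic_next l j = (if j = l then 1 else j + 1)"

definition binding :: "nat \<Rightarrow> (nat \<Rightarrow> orbit) \<Rightarrow> orbit \<Rightarrow> R4 set" where
  "binding l P2 P3 = (\<Union>j\<in>{1..l}. orbit_set (P2 j)) \<union> orbit_set P3"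

definition weakly_convex_foliation ::
  "(R4 \<Rightarrow> real) \<Rightarrow> real \<Rightarrow> R4 set \<Rightarrow> nat \<Rightarrow> (nat \<Rightarrow> orbit) \<Rightarrow> orbit \<Rightarrow>
   (nat \<Rightarrow> R4 set) \<Rightarrow> (nat \<Rightarrow> R4 set) \<Rightarrow> (nat \<Rightarrow> R4 set) \<Rightarrow> (nat \<Rightarrow> real \<Rightarrow> R4 set) \<Rightarrow> bool" where
  "weakly_convex_foliation H E S l P2 P3 U1 U2 V D \<longleftrightarrow>
     (let B = binding l P2 P3; M = S - B; Lf = leaf U1 U2 V D; \<Lambda> = leaf_labels l in
       S \<subseteq> H -` {E} \<and>
       \<comment> \<open>binding\<close>
       B \<subseteq> S \<and>
       (\<forall>j\<in>{1..l}. periodic_orbit H (P2 j) \<and> orbit_index H (P2 j) = 2 \<and> hyperbolic_orbit H (P2 j) \<and>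
                   orbit_set (P2 j) \<inter> orbit_set P3 = {}) \<and>
       disjoint_family_on (\<lambda>j. orbit_set (P2 j)) {1..l} \<and>
       periodic_orbit H P3 \<and> orbit_index H P3 = 3 \<and> unknotted_in S (orbit_set P3) \<and>
       \<comment> \<open>the leaves form a smooth foliation of the complement of the binding\<close>
       disjoint_family_on Lf \<Lambda> \<and> (\<Union>i\<in>\<Lambda>. Lf i) = M \<and> (\<forall>p\<in>M. foliated_at M (Lf ` \<Lambda>) p) \<and>
       (\<forall>j\<in>{1..l}.
          \<comment> \<open>pairs of planes in the boundary spheres\<close>
          (\<forall>U\<in>{U1 j, U2 j}. proper_plane M U \<and> U \<subseteq> boundary_sphere H E S (orbit_set (P2 j)) \<and>
                            asymptotic_to U (orbit_set (P2 j))) \<and>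
          \<comment> \<open>cylinders\<close>
          proper_cylinder M (V j) \<and>
          asymptotic_to (V j) (orbit_set P3) \<and> asymptotic_to (V j) (orbit_set (P2 j)) \<and>
          \<comment> \<open>families of planes\<close>
          smooth_plane_family (D j) \<and>
          (\<forall>\<tau>\<in>{0<..<1}. proper_plane M (D j \<tau>) \<and> asymptotic_to (D j \<tau>) (orbit_set P3)) \<and>
          hausdorff_converges (D j) (closure (U1 j \<union> V j)) (at_right 0) \<and>
          hausdorff_converges (D j) (closure (U2 (cyclic_next l j) \<union> V (cyclic_next l j))) (at_left 1)) \<and>
       \<comment> \<open>transversality to the flow\<close>
       (\<forall>i\<in>\<Lambda>. \<forall>p\<in>Lf i. ham_vf H p \<notin> tangent_vectors (Lf i) p))"

section \<open>The regularized Stark problem\<close>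

definition V1 :: "real \<Rightarrow> real \<Rightarrow> real" where "V1 \<epsilon> x = 4 * (x ^ 2 - \<epsilon> * x ^ 4)"
definition V2 :: "real \<Rightarrow> real \<Rightarrow> real" where "V2 \<epsilon> x = 4 * (x ^ 2 + \<epsilon> * x ^ 4)"

definition H1 :: "real \<Rightarrow> real \<times> real \<Rightarrow> real" where
  "H1 \<epsilon> = (\<lambda>(x1, y1). y1 ^ 2 / 2 + V1 \<epsilon> x1)"
definition H2 :: "real \<Rightarrow> real \<times> real \<Rightarrow> real" where
  "H2 \<epsilon> = (\<lambda>(x2, y2). y2 ^ 2 / 2 + V2 \<epsilon> x2)"

definition stark_H :: "real \<Rightarrow> R4 \<Rightarrow> real" where
  "stark_H \<epsilon> = (\<lambda>(x1, x2, y1, y2). (y1 ^ 2 + y2 ^ 2) / 2 + V1 \<epsilon> x1 + V2 \<epsilon> x2)"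

definition e_star :: "real \<Rightarrow> real" where "e_star \<epsilon> = 1 / \<epsilon>"

text \<open>First coordinate of the saddle \<open>v\<^sub>j\<close>; the second one is \<open>0\<close>.\<close>

definition saddle_x1 :: "real \<Rightarrow> nat \<Rightarrow> real" where
  "saddle_x1 \<epsilon> j = (if j = 1 then 1 else - 1) * (1 / sqrt (2 * \<epsilon>))"

definition lyapunov_set :: "real \<Rightarrow> real \<Rightarrow> nat \<Rightarrow> R4 set" where
  "lyapunov_set \<epsilon> E j =
     {(x1, x2, y1, y2). x1 = saddle_x1 \<epsilon> j \<and> y1 = 0 \<and> H2 \<epsilon> (x2, y2) = E - e_star \<epsilon>}"

definition x_proj :: "R4 \<Rightarrow> real \<times> real" where "x_proj = (\<lambda>(x1, x2, y1, y2). (x1, x2))"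
definition proj1 :: "R4 \<Rightarrow> real \<times> real" where "proj1 = (\<lambda>(x1, x2, y1, y2). (x1, y1))"

text \<open>The Jordan curve made of the segments covered by the two Lyapunov orbits and of the two
  arcs of \<open>V = E\<close> that join their end points.  These arcs are the part of \<open>V = E\<close>
  between the lines through the saddles.\<close>

definition K_curve :: "real \<Rightarrow> real \<Rightarrow> (real \<times> real) set" where
  "K_curve \<epsilon> E =
     x_proj ` lyapunov_set \<epsilon> E 1 \<union> x_proj ` lyapunov_set \<epsilon> E 2 \<union>
     {(x1, x2). V1 \<epsilon> x1 + V2 \<epsilon> x2 = E \<and> x1 \<in> {saddle_x1 \<epsilon> 2 .. saddle_x1 \<epsilon> 1}}"

definition K_set :: "real \<Rightarrow> real \<Rightarrow> (real \<times> real) set" where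
  "K_set \<epsilon> E = K_curve \<epsilon> E \<union> inside (K_curve \<epsilon> E)"

definition S_set :: "real \<Rightarrow> real \<Rightarrow> R4 set" where
  "S_set \<epsilon> E = {p. stark_H \<epsilon> p = E \<and> x_proj p \<in> K_set \<epsilon> E}"

definition gradient_trajectory :: "('a::euclidean_space \<Rightarrow> real) \<Rightarrow> (real \<Rightarrow> 'a) \<Rightarrow> bool" where
  "gradient_trajectory G \<gamma> \<longleftrightarrow>
     (\<forall>t. (\<gamma> has_vector_derivative gradient G (\<gamma> t)) (at t)) \<and> \<not> \<gamma> constant_on UNIV"

end

theory Submission
  imports Defs
begin

text \<open>
  The system is the sum of two systems with one degree of freedom, and the foliation is the preimage
  of the gradient lines of \<open>H\<^sub>1\<close> under the projection to the \<open>(x\<^sub>1, y\<^sub>1)\<close> plane.  This projection maps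
  the flow to the Hamiltonian flow of \<open>H\<^sub>1\<close>, which is perpendicular to the gradient lines; so the
  preimages are transverse to the flow except over the critical points of \<open>H\<^sub>1\<close>, and over these lie the
  binding orbits.  The fibre over a point with \<open>H\<^sub>1 < E\<close> is a circle, a level set of \<open>H\<^sub>2\<close>, and over a
  point with \<open>H\<^sub>1 = E\<close> it is a point.  A gradient line that runs from the origin to \<open>H\<^sub>1 = E\<close> therefore
  lifts to a plane asymptotic to the orbit over the origin, a line that leaves a saddle lifts to a
  hemisphere of a boundary sphere, and a segment between the origin and a saddle lifts to a cylinder.

  All of this is explicit.  Put \<open>a = (2 \<epsilon>)\<^sup>-\<^sup>1\<^sup>/\<^sup>2\<close>.  A diffeomorphism \<open>Q\<close> of the line with \<open>Q\<^sup>2 / 2 = V\<^sub>2\<close>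
  turns \<open>H\<^sub>2\<close> into \<open>|\<zeta>|\<^sup>2 / 2\<close>, where \<open>\<zeta> = Q(x\<^sub>2) + i y\<^sub>2\<close>, and the energy surface into
  \<open>|\<zeta>|\<^sup>2 + y\<^sub>1\<^sup>2 = R(x\<^sub>1)\<^sup>2\<close> with \<open>R\<close> positive, a bundle of two-spheres over the \<open>x\<^sub>1\<close> axis; \<open>S\<^sub>E\<close> is the part
  with \<open>|x\<^sub>1| \<le> a\<close>.  Between the saddles the gradient lines are the curves \<open>G(x\<^sub>1) = C y\<^sub>1\<^sup>8\<close> on either side
  of \<open>y\<^sub>1 = 0\<close>, where \<open>G(x) = x (1 - x\<^sup>2 / a\<^sup>2)\<^sup>-\<^sup>1\<^sup>/\<^sup>2\<close>.  On the sphere bundle such a leaf is a graph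
  \<open>x\<^sub>1 = f(\<mu>)\<close> over an open hemisphere of the fibre sphere, where \<open>\<mu>\<close> is the height
  \<open>|y\<^sub>1| / R(x\<^sub>1)\<close>; the only functions
  that are not elementary are inverses of monotone functions of one variable.  Every chart and
  embedding has an explicit differentiable left inverse (\<open>smooth_embeddingI\<close>), the closures are images of
  a closed disc or annulus (\<open>asymptotic_to_disc\<close>, \<open>asymptotic_to_annulus\<close>), and \<open>C \<rightarrow> \<plusminus>\<infinity>\<close> gives the
  breaking of the planes (\<open>hausdorff_converges_leafD\<close>).

  For the indices, the transverse frame along a binding orbit makes exactly one positive turn in a period,
  because it follows the gradient of \<open>H\<^sub>2\<close> along a closed level curve (\<open>e_turns_once\<close>).  From it one subtracts the
  rotation of the linearization of \<open>H\<^sub>1\<close> (\<open>rotation_interval_iff\<close>).  At a saddle this is a hyperbolic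
  flow, which turns some vectors forwards and some backwards, by less than half a turn; this gives index 2.
  At the origin it is an oscillator that turns clockwise with period \<open>2 \<pi> / \<surd>8\<close>.  Since \<open>V\<^sub>2\<close> is
  stiffer than the quadratic potential \<open>4 x\<^sup>2\<close>, the period of the orbit is not longer than this, so the
  oscillator makes a positive fraction of a turn that does not exceed 1; this gives index 3.
\<close>

section \<open>Smooth maps\<close>

lemma Ck_on_cong:
  assumes "open U" "\<And>x. x \<in> U \<Longrightarrow> f x = g x"
  shows "Ck_on k U f \<longleftrightarrow> Ck_on k U g"
  using assms(2)
proof (induction k arbitrary: f g)
  case 0
  then show ?case by (simp cong: continuous_on_cong)
next
  case (Suc k)
  have hd: "(f has_derivative D) (at x) \<longleftrightarrow> (g has_derivative D) (at x)" if "x \<in> U" for x D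
    using has_derivative_transform_within_open[OF _ assms(1) that, of f D UNIV g]
      has_derivative_transform_within_open[OF _ assms(1) that, of g D UNIV f] Suc.prems by auto
  then have "frechet_derivative f (at x) = frechet_derivative g (at x)"
    and "f differentiable (at x) \<longleftrightarrow> g differentiable (at x)" if "x \<in> U" for x
    using that unfolding frechet_derivative_def differentiable_def by auto
  then show ?case using Suc.IH[of "\<lambda>x. frechet_derivative f (at x) _" "\<lambda>x. frechet_derivative g (at x) _"]
    by auto
qed

lemma Ck_on_SucI:
  assumes "open U" "\<And>x. x \<in> U \<Longrightarrow> (f has_derivative f' x) (at x)"
    and "\<And>v. Ck_on k U (\<lambda>x. f' x v)"
  shows "Ck_on (Suc k) U f"
proof -
  have "Ck_on k U (\<lambda>x. frechet_derivative f (at x) v)" for v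
    using assms(3)[of v] Ck_on_cong[OF assms(1), of "\<lambda>x. f' x v" "\<lambda>x. frechet_derivative f (at x) v"]
      frechet_derivative_at[OF assms(2)] by auto
  then show ?thesis using assms(2) by (auto simp: differentiable_def)
qed

lemma Ck_on_SucD:
  assumes "Ck_on (Suc k) U f"
  shows "Ck_on k U f"
  using assms
proof (induction k arbitrary: f)
  case 0
  then show ?case
    by (auto intro!: continuous_at_imp_continuous_on differentiable_imp_continuous_within)
next
  case (Suc k)
  have "Ck_on k U (\<lambda>x. frechet_derivative f (at x) v)" for v
    by (rule Suc.IH) (use Suc.prems in simp)
  then show ?case using Suc.prems by simp
qed

lemma Ck_on_has_derivative:
  assumes "Ck_on (Suc k) U f" "x \<in> U"
  shows "(f has_derivative frechet_derivative f (at x)) (at x)"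
  using assms by (simp add: frechet_derivative_works)

lemma Ck_on_frechet_derivative:
  "Ck_on (Suc k) U f \<Longrightarrow> Ck_on k U (\<lambda>x. frechet_derivative f (at x) v)"
  by simp

lemma smooth_on_Ck: "smooth_on U f \<Longrightarrow> Ck_on k U f"
  by (simp add: smooth_on_def)

lemma smooth_on_imp_differentiable: "smooth_on U f \<Longrightarrow> x \<in> U \<Longrightarrow> f differentiable (at x)"
  using smooth_on_Ck[of U f "Suc 0"] by simp

lemma smooth_on_imp_continuous: "smooth_on U f \<Longrightarrow> continuous_on U f"
  using smooth_on_Ck[of U f 0] by simp

lemma Ck_on_const: "Ck_on k U (\<lambda>x. c)"
  by (induction k arbitrary: c) auto

lemma Ck_on_bounded_linear:
  assumes "bounded_linear f" "open U" shows "Ck_on k U f"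
proof (cases k)
  case 0
  then show ?thesis using assms by (simp add: linear_continuous_on)
next
  case (Suc m)
  show ?thesis unfolding Suc
    by (rule Ck_on_SucI[where f'="\<lambda>_. f"])
       (auto intro: bounded_linear_imp_has_derivative assms Ck_on_const)
qed

lemma Ck_on_add:
  assumes "open U" "Ck_on k U f" "Ck_on k U g"
  shows "Ck_on k U (\<lambda>x. f x + g x)"
  using assms(2,3)
proof (induction k arbitrary: f g)
  case 0
  then show ?case by (auto intro: continuous_intros)
next
  case (Suc k)
  show ?case
    by (rule Ck_on_SucI[OF assms(1) has_derivative_add[OF Ck_on_has_derivative[OF Suc.prems(1)]
          Ck_on_has_derivative[OF Suc.prems(2)]]])
       (use Suc in auto)
qed

lemma Ck_on_sum:
  assumes "open U" "finite B" "\<And>b. b \<in> B \<Longrightarrow> Ck_on k U (f b)"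
  shows "Ck_on k U (\<lambda>x. \<Sum>b\<in>B. f b x)"
  using assms(2,3) by (induction B rule: finite_induct) (auto intro: Ck_on_const Ck_on_add assms(1))

lemma Ck_on_bilinear:
  assumes "bounded_bilinear h" "open U" "Ck_on k U f" "Ck_on k U g"
  shows "Ck_on k U (\<lambda>x. h (f x) (g x))"
  using assms(3,4)
proof (induction k arbitrary: f g)
  case 0
  then show ?case by (auto intro: bounded_bilinear.continuous_on[OF assms(1)])
next
  case (Suc k)
  show ?case
    by (rule Ck_on_SucI[OF assms(2) bounded_bilinear.FDERIV[OF assms(1)
          Ck_on_has_derivative[OF Suc.prems(1)] Ck_on_has_derivative[OF Suc.prems(2)]]])
       (use Suc.prems in \<open>auto simp del: Ck_on.simps(2) intro!: Ck_on_add assms(2)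
          Suc.IH Ck_on_SucD[OF Suc.prems(1)] Ck_on_SucD[OF Suc.prems(2)] Ck_on_frechet_derivative\<close>)
qed

text \<open>The chain rule writes a directional derivative of \<open>g \<circ> f\<close> as a finite sum of products of
  coordinates of a derivative of \<open>f\<close> with directional derivatives of \<open>g\<close> along a basis; each
  factor is one order less smooth, so induction on the order applies.\<close>

lemma Ck_on_compose:
  fixes f :: "'a::real_normed_vector \<Rightarrow> 'b::euclidean_space"
    and g :: "'b \<Rightarrow> 'c::real_normed_vector"
  assumes "open U" "open V" "\<And>x. x \<in> U \<Longrightarrow> f x \<in> V" "Ck_on k U f" "Ck_on k V g"
  shows "Ck_on k U (\<lambda>x. g (f x))"
  using assms(4,5)
proof (induction k arbitrary: g)
  case 0
  have "f ` U \<subseteq> V" using assms(3) by blast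
  then show ?case using continuous_on_compose2[of V g U f] 0 by simp
next
  case (Suc k)
  have fk: "Ck_on k U f" using Ck_on_SucD[OF Suc.prems(1)] .
  let ?D = "\<lambda>x. frechet_derivative g (at (f x))"
  have der: "((\<lambda>x. g (f x)) has_derivative (\<lambda>v. ?D x (frechet_derivative f (at x) v))) (at x)"
    if "x \<in> U" for x
    using diff_chain_at[OF Ck_on_has_derivative[OF Suc.prems(1) that]
        Ck_on_has_derivative[OF Suc.prems(2) assms(3)[OF that]]] by (simp add: o_def)
  have exp: "(\<Sum>b\<in>Basis. (frechet_derivative f (at x) v \<bullet> b) *\<^sub>R ?D x b)
      = ?D x (frechet_derivative f (at x) v)" if "x \<in> U" for x v
  proof -
    have "linear (?D x)"
      using Ck_on_has_derivative[OF Suc.prems(2) assms(3)[OF that]] has_derivative_linear by blast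
    then have "?D x (\<Sum>b\<in>Basis. (frechet_derivative f (at x) v \<bullet> b) *\<^sub>R b)
        = (\<Sum>b\<in>Basis. (frechet_derivative f (at x) v \<bullet> b) *\<^sub>R ?D x b)"
      by (simp add: linear_sum linear_scale)
    then show ?thesis by (simp add: euclidean_representation)
  qed
  have "Ck_on k U (\<lambda>x. \<Sum>b\<in>Basis. (frechet_derivative f (at x) v \<bullet> b) *\<^sub>R ?D x b)" for v
  proof (rule Ck_on_sum[OF assms(1) finite_Basis])
    fix b :: 'b
    have "Ck_on k U (\<lambda>x. frechet_derivative f (at x) v \<bullet> b)"
      using Ck_on_bilinear[OF bounded_bilinear_inner assms(1), of k
          "\<lambda>x. frechet_derivative f (at x) v" "\<lambda>_. b"] Suc.prems(1) by (auto intro: Ck_on_const)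
    moreover have "Ck_on k U (\<lambda>x. ?D x b)"
      by (rule Suc.IH[OF fk]) (use Suc.prems(2) in simp)
    ultimately show "Ck_on k U (\<lambda>x. (frechet_derivative f (at x) v \<bullet> b) *\<^sub>R ?D x b)"
      by (rule Ck_on_bilinear[OF bounded_bilinear_scaleR assms(1)])
  qed
  then have "Ck_on k U (\<lambda>x. ?D x (frechet_derivative f (at x) v))" for v
    using Ck_on_cong[OF assms(1), of "\<lambda>x. \<Sum>b\<in>Basis. (frechet_derivative f (at x) v \<bullet> b) *\<^sub>R ?D x b"
        "\<lambda>x. ?D x (frechet_derivative f (at x) v)" k] exp by simp
  then show ?case
    using Ck_on_SucI[OF assms(1), of "\<lambda>x. g (f x)" "\<lambda>x v. ?D x (frechet_derivative f (at x) v)" k]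
      der by blast
qed

lemma smooth_on_compose:
  fixes f :: "'a::real_normed_vector \<Rightarrow> 'b::euclidean_space"
  assumes "smooth_on V g" "smooth_on U f" "open U" "open V" "\<And>x. x \<in> U \<Longrightarrow> f x \<in> V"
  shows "smooth_on U (\<lambda>x. g (f x))"
  unfolding smooth_on_def
proof
  fix k
  show "Ck_on k U (\<lambda>x. g (f x))"
    using Ck_on_compose[of U V f k g] assms by (simp add: smooth_on_def)
qed

named_theorems smooth_intros

lemma smooth_on_const [smooth_intros]: "smooth_on U (\<lambda>x. c)"
  by (simp add: smooth_on_def Ck_on_const)

lemma smooth_on_linear: "bounded_linear f \<Longrightarrow> open U \<Longrightarrow> smooth_on U f"
  by (simp add: smooth_on_def Ck_on_bounded_linear)

lemma smooth_on_id [smooth_intros]: "open U \<Longrightarrow> smooth_on U (\<lambda>x. x)"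
  by (rule smooth_on_linear) (rule bounded_linear_ident)

lemma smooth_on_linear_compose:
  fixes f :: "'a::real_normed_vector \<Rightarrow> 'b::euclidean_space"
  assumes "bounded_linear l" "smooth_on U f" "open U"
  shows "smooth_on U (\<lambda>x. l (f x))"
  by (rule smooth_on_compose[OF smooth_on_linear[OF assms(1) open_UNIV] assms(2,3)]) auto

lemma smooth_on_add [smooth_intros]:
  "smooth_on U f \<Longrightarrow> smooth_on U g \<Longrightarrow> open U \<Longrightarrow> smooth_on U (\<lambda>x. f x + g x)"
  by (simp add: smooth_on_def Ck_on_add)

lemma smooth_on_bilinear:
  assumes "bounded_bilinear h" "smooth_on U f" "smooth_on U g" "open U"
  shows "smooth_on U (\<lambda>x. h (f x) (g x))"
  using assms by (simp add: smooth_on_def Ck_on_bilinear)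

lemma smooth_on_mult [smooth_intros]:
  fixes f g :: "'a::real_normed_vector \<Rightarrow> 'b::real_normed_algebra"
  shows "smooth_on U f \<Longrightarrow> smooth_on U g \<Longrightarrow> open U \<Longrightarrow> smooth_on U (\<lambda>x. f x * g x)"
  by (rule smooth_on_bilinear[OF bounded_bilinear_mult])

lemma smooth_on_scaleR [smooth_intros]:
  "smooth_on U f \<Longrightarrow> smooth_on U g \<Longrightarrow> open U \<Longrightarrow> smooth_on U (\<lambda>x. f x *\<^sub>R g x)"
  by (rule smooth_on_bilinear[OF bounded_bilinear_scaleR])

lemma smooth_on_minus [smooth_intros]:
  fixes f :: "'a::real_normed_vector \<Rightarrow> 'b::real_normed_vector"
  assumes "smooth_on U f" "open U" shows "smooth_on U (\<lambda>x. - f x)"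
  using smooth_on_scaleR[OF smooth_on_const[of U "-1"] assms] by simp

lemma smooth_on_diff [smooth_intros]:
  fixes f g :: "'a::real_normed_vector \<Rightarrow> 'b::real_normed_vector"
  assumes "smooth_on U f" "smooth_on U g" "open U" shows "smooth_on U (\<lambda>x. f x - g x)"
  using smooth_on_add[OF assms(1) smooth_on_minus[OF assms(2,3)] assms(3)] by simp

lemma smooth_on_power [smooth_intros]:
  fixes f :: "'a::real_normed_vector \<Rightarrow> real"
  shows "smooth_on U f \<Longrightarrow> open U \<Longrightarrow> smooth_on U (\<lambda>x. f x ^ n)"
  by (induction n) (auto intro: smooth_intros)

lemma smooth_on_fst [smooth_intros]:
  fixes f :: "'a::real_normed_vector \<Rightarrow> 'b::euclidean_space \<times> 'c::euclidean_space"
  shows "smooth_on U f \<Longrightarrow> open U \<Longrightarrow> smooth_on U (\<lambda>x. fst (f x))"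
  by (rule smooth_on_linear_compose[OF bounded_linear_fst])

lemma smooth_on_snd [smooth_intros]:
  fixes f :: "'a::real_normed_vector \<Rightarrow> 'b::euclidean_space \<times> 'c::euclidean_space"
  shows "smooth_on U f \<Longrightarrow> open U \<Longrightarrow> smooth_on U (\<lambda>x. snd (f x))"
  by (rule smooth_on_linear_compose[OF bounded_linear_snd])

lemma smooth_on_Re [smooth_intros]: "smooth_on U f \<Longrightarrow> open U \<Longrightarrow> smooth_on U (\<lambda>x. Re (f x))"
  by (rule smooth_on_linear_compose[OF bounded_linear_Re])

lemma smooth_on_Im [smooth_intros]: "smooth_on U f \<Longrightarrow> open U \<Longrightarrow> smooth_on U (\<lambda>x. Im (f x))"
  by (rule smooth_on_linear_compose[OF bounded_linear_Im])

lemma smooth_on_Pair [smooth_intros]: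
  fixes f :: "'a::real_normed_vector \<Rightarrow> 'b::euclidean_space"
    and g :: "'a \<Rightarrow> 'c::euclidean_space"
  assumes "smooth_on U f" "smooth_on U g" "open U"
  shows "smooth_on U (\<lambda>x. (f x, g x))"
proof -
  have "smooth_on U (\<lambda>x. (f x, 0) + (0, g x))"
    by (intro smooth_on_add smooth_on_linear_compose[OF _ assms(1)]
        smooth_on_linear_compose[OF _ assms(2)] bounded_linear_Pair
        bounded_linear_ident bounded_linear_zero assms(3))
  then show ?thesis by simp
qed

lemma smooth_on_Complex [smooth_intros]:
  assumes "smooth_on U f" "smooth_on U g" "open U"
  shows "smooth_on U (\<lambda>x. Complex (f x) (g x))"
proof -
  have "smooth_on U (\<lambda>x. f x *\<^sub>R 1 + g x *\<^sub>R \<i>)"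
    by (intro smooth_intros assms)
  then show ?thesis by (simp add: scaleR_conv_of_real Complex_eq mult.commute)
qed

text \<open>A solution of an autonomous scalar equation with smooth right-hand side is smooth.  This
  covers inverse functions, since the inverse of \<open>u\<close> solves \<open>g' = 1 / u' (g)\<close>.\<close>

lemma smooth_on_ode:
  fixes g :: "real \<Rightarrow> real"
  assumes "open U" "open V" "smooth_on V \<phi>" "\<And>x. x \<in> U \<Longrightarrow> g x \<in> V"
    and "\<And>x. x \<in> U \<Longrightarrow> (g has_real_derivative \<phi> (g x)) (at x)"
  shows "smooth_on U g"
proof -
  have der: "(g has_derivative (\<lambda>v. \<phi> (g x) * v)) (at x)" if "x \<in> U" for x
    using assms(5)[OF that] by (simp add: has_field_derivative_def)
  have "Ck_on k U g" for k
  proof (induction k)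
    case 0
    show ?case using der
      by (auto intro!: continuous_at_imp_continuous_on has_derivative_continuous)
  next
    case (Suc k)
    have "Ck_on k U (\<lambda>x. \<phi> (g x))"
      by (rule Ck_on_compose[OF assms(1,2,4) Suc smooth_on_Ck[OF assms(3)]])
    then have "Ck_on k U (\<lambda>x. \<phi> (g x) * v)" for v
      by (intro Ck_on_bilinear[OF bounded_bilinear_mult assms(1)] Ck_on_const)
    then show ?case
      using Ck_on_SucI[OF assms(1), of g "\<lambda>x v. \<phi> (g x) * v" k] der by blast
  qed
  then show ?thesis by (simp add: smooth_on_def)
qed

lemma smooth_on_inverse [smooth_intros]:
  fixes f :: "'a::real_normed_vector \<Rightarrow> real"
  assumes "smooth_on U f" "open U" "\<And>x. x \<in> U \<Longrightarrow> f x \<noteq> 0"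
  shows "smooth_on U (\<lambda>x. inverse (f x))"
proof -
  have "smooth_on (- {0::real}) inverse"
    by (rule smooth_on_ode[where V=UNIV and \<phi>="\<lambda>y. - (y ^ 2)"])
       (auto intro!: smooth_intros derivative_eq_intros simp: power2_eq_square)
  then show ?thesis by (rule smooth_on_compose[OF _ assms(1,2)]) (use assms(3) in auto)
qed

lemma smooth_on_divide [smooth_intros]:
  fixes f g :: "'a::real_normed_vector \<Rightarrow> real"
  assumes "smooth_on U f" "smooth_on U g" "open U" "\<And>x. x \<in> U \<Longrightarrow> g x \<noteq> 0"
  shows "smooth_on U (\<lambda>x. f x / g x)"
  using assms by (auto simp: divide_inverse intro!: smooth_intros)

lemma smooth_on_sqrt [smooth_intros]:
  fixes f :: "'a::real_normed_vector \<Rightarrow> real"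
  assumes "smooth_on U f" "open U" "\<And>x. x \<in> U \<Longrightarrow> 0 < f x"
  shows "smooth_on U (\<lambda>x. sqrt (f x))"
proof -
  have "smooth_on {0<..} sqrt"
    by (rule smooth_on_ode[where V="{0<..}" and \<phi>="\<lambda>y. inverse (2 * y)"])
       (auto intro!: smooth_intros derivative_eq_intros simp: divide_simps)
  then show ?thesis by (rule smooth_on_compose[OF _ assms(1,2)]) (use assms(3) in auto)
qed

lemma smooth_on_norm_square [smooth_intros]:
  fixes f :: "'a::real_normed_vector \<Rightarrow> 'b::real_inner"
  assumes "smooth_on U f" "open U"
  shows "smooth_on U (\<lambda>x. (norm (f x))\<^sup>2)"
  using smooth_on_bilinear[OF bounded_bilinear_inner assms(1,1,2)] by (simp add: power2_norm_eq_inner)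

lemma smooth_on_subset: "smooth_on U f \<Longrightarrow> V \<subseteq> U \<Longrightarrow> smooth_on V f"
proof -
  have "Ck_on k U f \<Longrightarrow> V \<subseteq> U \<Longrightarrow> Ck_on k V f" for k
    by (induction k arbitrary: f) (auto intro: continuous_on_subset)
  then show "smooth_on U f \<Longrightarrow> V \<subseteq> U \<Longrightarrow> smooth_on V f" by (auto simp: smooth_on_def)
qed

text \<open>A left inverse that is differentiable along the image makes a smooth map an embedding: it
  inverts the derivatives from the left and is a continuous inverse on the image.\<close>

lemma smooth_embeddingI:
  fixes f :: "'a::real_normed_vector \<Rightarrow> 'b::real_normed_vector"
  assumes "open U" "smooth_on U f" "\<And>z. z \<in> U \<Longrightarrow> g (f z) = z"
    and "\<And>z. z \<in> U \<Longrightarrow> g differentiable (at (f z))"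
  shows "smooth_embedding U f"
proof -
  have "inj (frechet_derivative f (at z))" if z: "z \<in> U" for z
  proof -
    have df: "(f has_derivative frechet_derivative f (at z)) (at z)"
      using smooth_on_imp_differentiable[OF assms(2) z] by (simp add: frechet_derivative_works)
    obtain g' where dg: "(g has_derivative g') (at (f z))"
      using assms(4)[OF z] by (auto simp: differentiable_def)
    have "((\<lambda>x. g (f x)) has_derivative (\<lambda>v. g' (frechet_derivative f (at z) v))) (at z)"
      using diff_chain_at[OF df dg] by (simp add: o_def)
    then have "((\<lambda>x. x) has_derivative (\<lambda>v. g' (frechet_derivative f (at z) v))) (at z)"
      using has_derivative_transform_within_open[OF _ assms(1) z, of "\<lambda>x. g (f x)" _ UNIV "\<lambda>x. x"]
        assms(3) by auto
    then have "g' (frechet_derivative f (at z) v) = v" for v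
      using fun_cong[OF has_derivative_unique[OF _ has_derivative_ident], of _ z v] by blast
    then show ?thesis by (rule inj_on_inverseI)
  qed
  moreover have "homeomorphism U (f ` U) f g"
  proof (rule homeomorphismI)
    show "continuous_on (f ` U) g"
      using assms(4) by (auto intro!: continuous_at_imp_continuous_on differentiable_imp_continuous_within)
  qed (use assms(3) smooth_on_imp_continuous[OF assms(2)] in auto)
  ultimately show ?thesis using assms(1,2) unfolding smooth_embedding_def by blast
qed

section \<open>Surfaces with boundary\<close>

lemma surface_boundary_image_subset:
  assumes "homeomorphism A S \<phi> \<psi>"
  shows "\<phi> ` surface_boundary A \<subseteq> surface_boundary S"
proof
  fix y assume "y \<in> \<phi> ` surface_boundary A"
  then obtain p N h g where p: "y = \<phi> p" "p \<in> A" "openin (top_of_set A) N" "p \<in> N"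
    "homeomorphism N {z :: complex. 0 \<le> Im z} h g" "h p = 0"
    unfolding surface_boundary_def by blast
  have "N \<subseteq> A" using p(3) openin_imp_subset by blast
  then have hN: "homeomorphism (\<phi> ` N) N \<psi> \<phi>"
    using homeomorphism_of_subsets[OF assms, of N "\<phi> ` N"] homeomorphism_image1[OF assms]
    by (auto simp: homeomorphism_symD image_mono)
  have "homeomorphism (\<phi> ` N) {z. 0 \<le> Im z} (h \<circ> \<psi>) (\<phi> \<circ> g)"
    using homeomorphism_compose[OF hN p(5)] .
  moreover have "openin (top_of_set S) (\<phi> ` N)"
    using homeomorphism_imp_open_map[OF assms p(3)] .
  moreover have "\<psi> (\<phi> p) = p" using assms p(2) by (simp add: homeomorphism_apply1)
  ultimately show "y \<in> surface_boundary S"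
    unfolding surface_boundary_def using p homeomorphism_image1[OF assms]
    by (auto intro!: exI[of _ "\<phi> ` N"] exI[of _ "h \<circ> \<psi>"] exI[of _ "\<phi> \<circ> g"])
qed

lemma surface_boundary_homeomorphism:
  assumes "homeomorphism A S \<phi> \<psi>"
  shows "surface_boundary S = \<phi> ` surface_boundary A"
proof
  show "\<phi> ` surface_boundary A \<subseteq> surface_boundary S"
    using surface_boundary_image_subset[OF assms] .
  show "surface_boundary S \<subseteq> \<phi> ` surface_boundary A"
  proof
    fix y assume y: "y \<in> surface_boundary S"
    then have "\<phi> (\<psi> y) = y" using assms by (simp add: surface_boundary_def homeomorphism_apply2)
    moreover have "\<psi> y \<in> surface_boundary A"
      using surface_boundary_image_subset[OF homeomorphism_symD[OF assms]] y by blast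
    ultimately show "y \<in> \<phi> ` surface_boundary A" by (metis imageI)
  qed
qed

lemma surface_interior_image_subset:
  assumes "homeomorphism A S \<phi> \<psi>"
  shows "\<phi> ` surface_interior A \<subseteq> surface_interior S"
proof
  fix y assume "y \<in> \<phi> ` surface_interior A"
  then obtain p N where p: "y = \<phi> p" "p \<in> A" "openin (top_of_set A) N" "p \<in> N"
    "N homeomorphic (UNIV :: complex set)"
    unfolding surface_interior_def by blast
  have "N \<subseteq> A" using p(3) openin_imp_subset by blast
  then have "homeomorphism (\<phi> ` N) N \<psi> \<phi>"
    using homeomorphism_of_subsets[OF assms, of N "\<phi> ` N"] homeomorphism_image1[OF assms]
    by (auto simp: homeomorphism_symD image_mono)
  then have "\<phi> ` N homeomorphic (UNIV :: complex set)"
    using homeomorphic_trans[OF _ p(5)] unfolding homeomorphic_def by blast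
  moreover have "openin (top_of_set S) (\<phi> ` N)"
    using homeomorphism_imp_open_map[OF assms p(3)] .
  ultimately show "y \<in> surface_interior S"
    unfolding surface_interior_def using p homeomorphism_image1[OF assms] by blast
qed

lemma surface_interior_plane_region:
  fixes A :: "complex set"
  assumes "p \<in> interior A" shows "p \<in> surface_interior A"
proof -
  obtain e where e: "0 < e" "ball p e \<subseteq> A"
    using assms by (auto simp: mem_interior)
  have "openin (top_of_set A) (ball p e)"
    using e(2) by (simp add: openin_open_eq open_subset)
  then show ?thesis using e homeomorphic_ball_UNIV[OF e(1), of p]
    unfolding surface_interior_def by (auto intro!: exI[of _ "ball p e"])
qed

text \<open>By invariance of domain a half-disc chart centred at an interior point would map a
  neighbourhood of it onto an open subset of the plane, which cannot lie in the half plane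
  and contain the origin.\<close>

lemma surface_boundary_plane_region:
  fixes A :: "complex set"
  shows "surface_boundary A \<subseteq> A - interior A"
proof
  fix p assume "p \<in> surface_boundary A"
  then obtain N h g where N: "p \<in> A" "openin (top_of_set A) N" "p \<in> N"
    "homeomorphism N {z :: complex. 0 \<le> Im z} h g" "h p = 0"
    unfolding surface_boundary_def by blast
  have "p \<notin> interior A"
  proof
    assume p: "p \<in> interior A"
    obtain N' where N': "open N'" "N = A \<inter> N'" using N(2) by (auto simp: openin_open)
    define B where "B = interior A \<inter> N'"
    have B: "open B" "B \<subseteq> N" "p \<in> B"
      using N' interior_subset N(3) p by (auto simp: B_def)
    have "inj_on h N" using N(4) by (metis homeomorphism_apply1 inj_on_inverseI)
    then have "open (h ` B)"
      using invariance_of_domain[of B h] B N(4) by (meson homeomorphism_cont1 continuous_on_subset inj_on_subset)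
    moreover have "0 \<in> h ` B" using N(5) B(3) by force
    ultimately obtain e where e: "0 < e" "ball 0 e \<subseteq> h ` B" by (meson open_contains_ball)
    have "Complex 0 (- e / 2) \<in> ball 0 e" using e(1) by (simp add: complex_norm)
    then have "Complex 0 (- e / 2) \<in> h ` N" using e(2) B(2) by blast
    then show False using homeomorphism_image1[OF N(4)] e(1) by auto
  qed
  then show "p \<in> A - interior A" using N(1) by blast
qed

lemma exp_inverse_near_0:
  assumes "norm w < pi"
  shows "Ln (exp w) = w" "exp w \<notin> \<real>\<^sub>\<le>\<^sub>0"
proof -
  have im: "\<bar>Im w\<bar> < pi" using abs_Im_le_cmod[of w] assms by linarith
  then show *: "Ln (exp w) = w" by (intro Ln_exp) auto
  show "exp w \<notin> \<real>\<^sub>\<le>\<^sub>0"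
    using im * Im_Ln_eq_pi[of "exp w"] by (auto simp: complex_nonpos_Reals_iff Re_exp Im_exp sin_zero_pi_iff)
qed

text \<open>In logarithmic coordinates centred at a point of a circle around the origin, one side of
  the circle is a half plane; \<open>c\<close> selects the side.\<close>

lemma surface_boundary_circleI:
  fixes A :: "complex set"
  assumes "p \<noteq> 0" "norm c = 1" "0 < r" "r \<le> pi"
    and side: "\<And>w. norm w < r \<Longrightarrow> p * exp (w / c) \<in> A \<longleftrightarrow> 0 \<le> Im w"
  shows "p \<in> surface_boundary A"
proof -
  define k where "k = (\<lambda>w. p * exp (w / c))"
  define l where "l = (\<lambda>z. c * Ln (z / p))"
  have c0: "c \<noteq> 0" using assms(2) by auto
  have small: "norm (w / c) < pi" if "norm w < r" for w
    using that assms by (simp add: norm_divide)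
  have lk: "l (k w) = w" if "norm w < r" for w
    using exp_inverse_near_0(1)[OF small[OF that]] c0 assms(1) by (simp add: l_def k_def)
  have inj: "inj_on k (ball 0 r)" using lk by (intro inj_on_inverseI[where g=l]) auto
  have "continuous_on (ball 0 r) k"
    unfolding k_def using c0 by (intro continuous_intros) auto
  then have op: "open (k ` ball 0 r)" using invariance_of_domain inj by blast
  define N where "N = A \<inter> k ` ball 0 r"
  have N: "N = k ` {w \<in> ball 0 r. 0 \<le> Im w}"
    unfolding N_def using side by (auto simp: k_def)
  have opN: "openin (top_of_set A) N" using op by (auto simp: N_def openin_open)
  define g where "g = (\<lambda>v :: complex. k ((r / (1 + norm v)) *\<^sub>R v))"
  define h where "h = (\<lambda>z. (1 / (r - norm (l z))) *\<^sub>R l z)"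
  have inball: "norm ((r / (1 + norm v)) *\<^sub>R v) < r" for v :: complex
  proof -
    have "1 + norm v > 0" by (simp add: add_pos_nonneg)
    then show ?thesis using assms(3) by (simp add: divide_simps)
  qed
  have "homeomorphism {z :: complex. 0 \<le> Im z} N g h"
  proof (rule homeomorphismI)
    have *: "1 + norm v \<noteq> 0" for v :: complex
      using norm_ge_zero[of v] by linarith
    show "continuous_on {z :: complex. 0 \<le> Im z} g"
      unfolding g_def k_def using c0 * by (intro continuous_intros) auto
    have "z / p \<notin> \<real>\<^sub>\<le>\<^sub>0" if "z \<in> N" for z
      using that exp_inverse_near_0(2)[OF small] assms(1) by (auto simp: N k_def)
    then have "continuous_on N l" unfolding l_def
      using assms(1) by (intro continuous_intros) auto
    moreover have "norm (l z) < r" if "z \<in> N" for z using that lk by (auto simp: N)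
    ultimately show "continuous_on N h" unfolding h_def
      by (intro continuous_intros) (auto simp: less_imp_neq)
    show "g ` {z. 0 \<le> Im z} \<subseteq> N"
    proof (rule image_subsetI)
      fix v :: complex assume v: "v \<in> {z. 0 \<le> Im z}"
      have "0 \<le> Im ((r / (1 + norm v)) *\<^sub>R v)" using v assms(3) by (simp add: add_nonneg_nonneg)
      then show "g v \<in> N" unfolding g_def N using inball[of v] by (intro imageI) simp
    qed
    show "h ` N \<subseteq> {z. 0 \<le> Im z}"
      by (auto simp: N h_def lk less_imp_le)
    show "h (g v) = v" if "v \<in> {z :: complex. 0 \<le> Im z}" for v
    proof -
      have pos: "1 + norm v > 0" by (simp add: add_pos_nonneg)
      have "l (g v) = (r / (1 + norm v)) *\<^sub>R v" unfolding g_def using lk inball by blast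
      moreover have "r - norm ((r / (1 + norm v)) *\<^sub>R v) = r / (1 + norm v)"
        using pos assms(3) by (simp add: field_simps)
      ultimately show ?thesis using pos assms(3) by (simp add: h_def)
    qed
    show "g (h z) = z" if z: "z \<in> N" for z
    proof -
      obtain w where w: "z = k w" "norm w < r" using z by (auto simp: N)
      have hz: "h z = (1 / (r - norm w)) *\<^sub>R w" by (simp add: h_def w lk)
      have "1 + norm (h z) = r / (r - norm w)" using w(2) by (simp add: hz field_simps)
      then have "(r / (1 + norm (h z))) *\<^sub>R h z = w" using w(2) assms(3) by (simp add: hz)
      then show ?thesis by (simp add: g_def w)
    qed
  qed
  then have "homeomorphism N {z. 0 \<le> Im z} h g" by (rule homeomorphism_symD)
  moreover have "p \<in> N"
    using assms(3) by (auto simp: N k_def intro!: image_eqI[of _ _ 0])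
  moreover have "h p = 0" using assms(1) by (simp add: h_def l_def)
  ultimately show ?thesis unfolding surface_boundary_def using opN openin_imp_subset by blast
qed

lemma outer_circle_surface_boundary:
  fixes A :: "complex set"
  assumes "0 < \<rho>" "0 < r" "r \<le> pi" "norm p = \<rho>"
    and "\<And>z. \<rho> * exp (- r) < norm z \<Longrightarrow> norm z < \<rho> * exp r \<Longrightarrow> z \<in> A \<longleftrightarrow> norm z \<le> \<rho>"
  shows "p \<in> surface_boundary A"
proof (rule surface_boundary_circleI[of p "-\<i>" r])
  show "p \<noteq> 0" using assms by auto
  fix w :: complex assume w: "norm w < r"
  have n: "norm (p * exp (w / - \<i>)) = \<rho> * exp (- Im w)"
    using assms(4) by (simp add: norm_mult)
  have "\<bar>Im w\<bar> < r" using abs_Im_le_cmod[of w] w by linarith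
  then show "p * exp (w / - \<i>) \<in> A \<longleftrightarrow> 0 \<le> Im w"
    using assms(1) n by (subst assms(5)) (auto simp del: divide_i divide_minus_right)
qed (use assms in auto)

lemma inner_circle_surface_boundary:
  fixes A :: "complex set"
  assumes "0 < \<rho>" "0 < r" "r \<le> pi" "norm p = \<rho>"
    and "\<And>z. \<rho> * exp (- r) < norm z \<Longrightarrow> norm z < \<rho> * exp r \<Longrightarrow> z \<in> A \<longleftrightarrow> \<rho> \<le> norm z"
  shows "p \<in> surface_boundary A"
proof (rule surface_boundary_circleI[of p "\<i>" r])
  show "p \<noteq> 0" using assms by auto
  fix w :: complex assume w: "norm w < r"
  have n: "norm (p * exp (w / \<i>)) = \<rho> * exp (Im w)"
    using assms(4) by (simp add: norm_mult)
  have "\<bar>Im w\<bar> < r" using abs_Im_le_cmod[of w] w by linarith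
  then show "p * exp (w / \<i>) \<in> A \<longleftrightarrow> 0 \<le> Im w"
    using assms(1) n by (subst assms(5)) (auto simp del: divide_i divide_minus_right)
qed (use assms in auto)

lemma surface_boundary_disc: "surface_boundary (cball 0 1 :: complex set) = sphere 0 1"
proof
  show "surface_boundary (cball 0 1 :: complex set) \<subseteq> sphere 0 1"
    using surface_boundary_plane_region[of "cball 0 1 :: complex set"] by auto
  show "sphere 0 1 \<subseteq> surface_boundary (cball 0 1 :: complex set)"
    using outer_circle_surface_boundary[of 1 1 _ "cball 0 1"] pi_gt3 by auto
qed

definition annulus :: "complex set" where "annulus = {z. 1 \<le> norm z \<and> norm z \<le> 2}"
definition open_annulus :: "complex set" where "open_annulus = {z. 1 < norm z \<and> norm z < 2}"

lemma exp_half_bounds: "exp (1/2 :: real) < 2" "1 / 2 < exp (- (1/2) :: real)"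
proof -
  have e: "exp (1/2 :: real) ^ 2 = exp 1" by (simp add: power2_eq_square flip: exp_add)
  have "exp 1 < (4::real)" using exp_le by linarith
  then have "exp (1/2 :: real) ^ 2 < 2 ^ 2" using e by simp
  then show 1: "exp (1/2 :: real) < 2" using power_less_imp_less_base by fastforce
  show "1 / 2 < exp (- (1/2) :: real)"
    unfolding exp_minus using 1 by (simp add: divide_simps)
qed

lemma open_annulus_interior: "open_annulus \<subseteq> interior annulus"
proof (rule interior_maximal)
  show "open open_annulus" unfolding open_annulus_def
    by (intro open_Collect_conj open_Collect_less continuous_intros)
qed (auto simp: open_annulus_def annulus_def)

lemma surface_boundary_annulus: "surface_boundary annulus = sphere 0 1 \<union> sphere 0 2"
proof
  show "surface_boundary annulus \<subseteq> sphere 0 1 \<union> sphere 0 2"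
    using surface_boundary_plane_region[of annulus] open_annulus_interior
    by (force simp: annulus_def open_annulus_def)
  have "p \<in> surface_boundary annulus" if "norm p = 1" for p
    using exp_half_bounds pi_gt3 that
    by (intro inner_circle_surface_boundary[of 1 "1/2"]) (auto simp: annulus_def)
  moreover have "p \<in> surface_boundary annulus" if "norm p = 2" for p
    using exp_half_bounds pi_gt3 that
    by (intro outer_circle_surface_boundary[of 2 "1/2"]) (auto simp: annulus_def)
  ultimately show "sphere 0 1 \<union> sphere 0 2 \<subseteq> surface_boundary annulus" by auto
qed

lemma closure_open_annulus: "annulus \<subseteq> closure open_annulus"
proof
  fix z assume z: "z \<in> annulus"
  define f where "f = (\<lambda>t::real. ((1 - t) + t * (3/2) / norm z) *\<^sub>R z)"
  have z0: "norm z > 0" using z by (auto simp: annulus_def)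
  have "f t \<in> open_annulus" if t: "0 < t" "t < 1" for t
  proof -
    have "norm (f t) = \<bar>(1 - t) + t * (3/2) / norm z\<bar> * norm z" by (simp add: f_def)
    also have "\<bar>(1 - t) + t * (3/2) / norm z\<bar> = (1 - t) + t * (3/2) / norm z"
      using t z0 by (intro abs_of_nonneg) (simp add: add_nonneg_nonneg)
    also have "\<dots> * norm z = (1 - t) * norm z + t * (3/2)" using z0 by (simp add: field_simps)
    finally have n: "norm (f t) = (1 - t) * norm z + t * (3/2)" .
    have "(1 - t) * 1 \<le> (1 - t) * norm z" "(1 - t) * norm z \<le> (1 - t) * 2"
      using t z by (intro mult_left_mono; simp add: annulus_def)+
    moreover have "(1 - t) * norm z = norm z - t * norm z" by (simp add: algebra_simps)
    ultimately show ?thesis using t by (simp add: open_annulus_def n)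
  qed
  then have "\<forall>\<^sub>F t in at_right 0. f t \<in> closure open_annulus"
    unfolding eventually_at_right_field using closure_subset by (auto intro!: exI[of _ 1])
  moreover have "(f \<longlongrightarrow> f 0) (at_right 0)"
    unfolding f_def using z0 by (intro tendsto_intros) auto
  ultimately have "f 0 \<in> closure open_annulus"
    by (intro Lim_in_closed_set[OF closed_closure]) auto
  then show "z \<in> closure open_annulus" by (simp add: f_def)
qed

lemma closure_continuous_image:
  fixes \<phi> :: "'a::t2_space \<Rightarrow> 'b::t2_space"
  assumes "compact K" "continuous_on K \<phi>" "A \<subseteq> K" "K \<subseteq> closure A"
  shows "closure (\<phi> ` A) = \<phi> ` K"
proof
  show "closure (\<phi> ` A) \<subseteq> \<phi> ` K"
    using closure_minimal[OF image_mono[OF assms(3)]]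
      compact_imp_closed[OF compact_continuous_image[OF assms(2,1)]] by blast
  have "closure A \<subseteq> K" using assms by (simp add: closure_minimal compact_imp_closed)
  then have eq: "closure A = K" using assms(4) by blast
  show "\<phi> ` K \<subseteq> closure (\<phi> ` A)"
    unfolding eq[symmetric]
    by (rule image_closure_subset) (use assms eq in \<open>auto intro: closure_subset[THEN subsetD]\<close>)
qed

lemma surface_with_boundary_image:
  fixes K :: "complex set" and \<phi> :: "complex \<Rightarrow> 'a::real_normed_vector"
  assumes "compact K" "continuous_on K \<phi>" "inj_on \<phi> K"
  shows "surface_boundary (\<phi> ` K) = \<phi> ` surface_boundary K"
    and "\<phi> ` interior K \<subseteq> surface_interior (\<phi> ` K)"
proof -
  obtain \<psi> where h: "homeomorphism K (\<phi> ` K) \<phi> \<psi>"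
    using homeomorphism_compact[OF assms(1,2) refl assms(3)] by blast
  show "surface_boundary (\<phi> ` K) = \<phi> ` surface_boundary K"
    by (rule surface_boundary_homeomorphism[OF h])
  show "\<phi> ` interior K \<subseteq> surface_interior (\<phi> ` K)"
    using surface_interior_image_subset[OF h] surface_interior_plane_region by blast
qed

lemma surface_interior_boundary_eqI:
  assumes "S \<subseteq> surface_interior S \<union> surface_boundary S"
  shows "S = surface_interior S \<union> surface_boundary S"
  using assms by (auto simp: surface_interior_def surface_boundary_def)

lemma closure_disc_image:
  fixes \<phi> :: "complex \<Rightarrow> 'a::real_normed_vector"
  assumes "continuous_on (cball 0 1) \<phi>"
  shows "closure (\<phi> ` ball 0 1) = \<phi> ` cball 0 1"
  by (rule closure_continuous_image) (use assms in \<open>auto simp: closure_ball\<close>)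

text \<open>The interior of the disc gives interior points and the unit circle gives all boundary points, a
  connected set and hence a single component.\<close>

lemma asymptotic_to_disc:
  fixes \<phi> :: "complex \<Rightarrow> 'a::real_normed_vector"
  assumes "continuous_on (cball 0 1) \<phi>" "inj_on \<phi> (cball 0 1)"
  shows "asymptotic_to (\<phi> ` ball 0 1) (\<phi> ` sphere 0 1)"
proof -
  let ?S = "\<phi> ` cball 0 1"
  have b: "surface_boundary ?S = \<phi> ` sphere 0 1"
    using surface_with_boundary_image(1)[OF compact_cball assms] by (simp add: surface_boundary_disc)
  have "\<phi> ` ball 0 1 \<subseteq> surface_interior ?S"
    using surface_with_boundary_image(2)[OF compact_cball assms] by simp
  moreover have "cball 0 1 = ball 0 1 \<union> sphere 0 (1::real)" for x :: complex by auto
  ultimately have "?S = surface_interior ?S \<union> surface_boundary ?S"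
    by (intro surface_interior_boundary_eqI) (auto simp: b)
  moreover have "connected (\<phi> ` sphere 0 1)"
    by (intro connected_continuous_image connected_sphere continuous_on_subset[OF assms(1)]) auto
  ultimately show ?thesis
    unfolding asymptotic_to_def closure_disc_image[OF assms(1)] b
    by (simp add: components_eq_sing_iff[THEN iffD2])
qed

lemma component_of_disjoint_closed_union:
  assumes "connected A" "closed A" "closed B" "A \<inter> B = {}" "A \<noteq> {}"
  shows "A \<in> components (A \<union> B)"
proof -
  obtain a where a: "a \<in> A" using assms(5) by blast
  define C where "C = connected_component_set (A \<union> B) a"
  have C: "connected C" "C \<subseteq> A \<union> B" "A \<subseteq> C"
    unfolding C_def using a assms(1) connected_component_maximal[of a A "A \<union> B"]
      connected_component_subset[of "A \<union> B" a] by simp_all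
  have "B \<inter> C = {}"
    using connected_closedD[OF C(1), of A B] assms(2-4) a C(2,3) by blast
  then have "C = A" using C by blast
  moreover have "C \<in> components (A \<union> B)" unfolding C_def using a by (simp add: componentsI)
  ultimately show ?thesis by simp
qed

lemma compact_annulus: "compact annulus"
proof -
  have "annulus = cball 0 2 - ball 0 1" by (auto simp: annulus_def)
  moreover have "compact (cball 0 2 - ball 0 1 :: complex set)"
    by (intro compact_diff compact_cball open_ball)
  ultimately show ?thesis by simp
qed

lemma closure_annulus_image:
  fixes \<phi> :: "complex \<Rightarrow> 'a::real_normed_vector"
  assumes "continuous_on annulus \<phi>"
  shows "closure (\<phi> ` open_annulus) = \<phi> ` annulus"
  by (rule closure_continuous_image[OF compact_annulus])
    (use assms closure_open_annulus in \<open>auto simp: annulus_def open_annulus_def\<close>)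

lemma asymptotic_to_annulus:
  fixes \<phi> :: "complex \<Rightarrow> 'a::real_normed_vector"
  assumes "continuous_on annulus \<phi>" "inj_on \<phi> annulus"
  shows "asymptotic_to (\<phi> ` open_annulus) (\<phi> ` sphere 0 1)"
    and "asymptotic_to (\<phi> ` open_annulus) (\<phi> ` sphere 0 2)"
proof -
  let ?S = "\<phi> ` annulus"
  have b: "surface_boundary ?S = \<phi> ` sphere 0 1 \<union> \<phi> ` sphere 0 2"
    using surface_with_boundary_image(1)[OF compact_annulus assms]
    by (simp add: surface_boundary_annulus image_Un)
  have "\<phi> ` open_annulus \<subseteq> surface_interior ?S"
    using surface_with_boundary_image(2)[OF compact_annulus assms] open_annulus_interior by blast
  moreover have "annulus \<subseteq> open_annulus \<union> sphere 0 1 \<union> sphere 0 2"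
    by (auto simp: annulus_def open_annulus_def)
  ultimately have S: "?S = surface_interior ?S \<union> surface_boundary ?S"
    by (intro surface_interior_boundary_eqI) (use b in blast)
  have sub: "sphere 0 1 \<subseteq> annulus" "sphere 0 2 \<subseteq> annulus" by (auto simp: annulus_def)
  have c: "compact (\<phi> ` sphere 0 r)" "connected (\<phi> ` sphere 0 r)" "\<phi> ` sphere 0 r \<noteq> {}" if "r = 1 \<or> r = 2" for r
    using that sub by (auto intro!: compact_continuous_image connected_continuous_image
        connected_sphere continuous_on_subset[OF assms(1)])
  have d: "\<phi> ` sphere 0 1 \<inter> \<phi> ` sphere 0 2 = {}"
  proof -
    have "\<phi> ` sphere 0 1 \<inter> \<phi> ` sphere 0 2 = \<phi> ` (sphere 0 1 \<inter> sphere 0 2)"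
      using inj_on_image_Int[OF assms(2) sub] by simp
    then show ?thesis by auto
  qed
  have "\<phi> ` sphere 0 1 \<in> components (\<phi> ` sphere 0 1 \<union> \<phi> ` sphere 0 2)"
    using c d by (intro component_of_disjoint_closed_union compact_imp_closed) auto
  then show "asymptotic_to (\<phi> ` open_annulus) (\<phi> ` sphere 0 1)"
    unfolding asymptotic_to_def closure_annulus_image[OF assms(1)] using S b by simp
  have "\<phi> ` sphere 0 2 \<in> components (\<phi> ` sphere 0 2 \<union> \<phi> ` sphere 0 1)"
    using c d by (intro component_of_disjoint_closed_union compact_imp_closed) auto
  then show "asymptotic_to (\<phi> ` open_annulus) (\<phi> ` sphere 0 2)"
    unfolding asymptotic_to_def closure_annulus_image[OF assms(1)] using S b by (simp add: Un_commute)
qed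

section \<open>Foliation charts\<close>

text \<open>A chart need not be defined on a cube: a chart on an arbitrary open set can be shrunk to a
  small cube by an affine map.  For a boundary chart the cube is centred on the boundary, which
  is the condition \<open>c\<^sub>0 = 0\<close>.\<close>

lemma foliated_atI:
  fixes \<Phi> :: "complex \<times> real \<Rightarrow> 'a::real_normed_vector"
  assumes "open V" "smooth_on V \<Phi>"
    and left_inv: "\<And>q. q \<in> V \<Longrightarrow> g (\<Phi> q) = q" "\<And>q. q \<in> V \<Longrightarrow> g differentiable (at (\<Phi> q))"
    and base: "(z\<^sub>0, c\<^sub>0) \<in> V" "\<Phi> (z\<^sub>0, c\<^sub>0) = p" "half \<Longrightarrow> c\<^sub>0 = 0"
    and image: "open N" "M \<inter> N = \<Phi> ` {q \<in> V. half \<longrightarrow> 0 \<le> snd q}"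
    and slices: "\<And>c. (half \<Longrightarrow> 0 \<le> c) \<Longrightarrow> \<exists>L\<in>\<L>. \<forall>z. (z, c) \<in> V \<longrightarrow> \<Phi> (z, c) \<in> L"
    and "\<L> \<noteq> {}"
  shows "foliated_at M \<L> p"
proof -
  obtain e where e: "0 < e" "ball (z\<^sub>0, c\<^sub>0) e \<subseteq> V" using assms(1) base(1) open_contains_ball by blast
  \<comment> \<open>The three coordinates of a point of the cube of half side \<open>r\<close> contribute at most \<open>3 r\<close>.\<close>
  define r where "r = e / 4"
  have r: "0 < r" "3 * r < e" using e by (auto simp: r_def)
  define \<iota> where "\<iota> = (\<lambda>(a, b, c). (z\<^sub>0 + r *\<^sub>R Complex a b, c\<^sub>0 + r * c))"
  define \<kappa> where "\<kappa> = (\<lambda>(z, c). (Re (z - z\<^sub>0) / r, Im (z - z\<^sub>0) / r, (c - c\<^sub>0) / r))"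
  have \<kappa>\<iota>: "\<kappa> (\<iota> q) = q" for q using r by (auto simp: \<iota>_def \<kappa>_def split: prod.splits)
  have \<iota>\<kappa>: "\<iota> (\<kappa> q) = q" for q
    using r by (auto simp: \<iota>_def \<kappa>_def complex_eq_iff split: prod.splits)
  have \<iota>V: "\<iota> q \<in> V" if "q \<in> open_cube" for q
  proof -
    obtain a b c where q: "q = (a, b, c)" using prod_cases3 by blast
    have abc: "\<bar>a\<bar> < 1" "\<bar>b\<bar> < 1" "\<bar>c\<bar> < 1" using that by (auto simp: q open_cube_def)
    have "dist (z\<^sub>0, c\<^sub>0) (\<iota> q) \<le> norm (r *\<^sub>R Complex a b) + norm (r * c)"
      using norm_Pair_le[of "- (r *\<^sub>R Complex a b)" "- (r * c)"] by (simp add: q \<iota>_def dist_norm)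
    also have "\<dots> = r * (cmod (Complex a b) + \<bar>c\<bar>)" using r by (simp add: abs_mult algebra_simps)
    also have "\<dots> \<le> r * 3"
      using cmod_le[of "Complex a b"] abc r by (intro mult_left_mono) auto
    finally have "\<iota> q \<in> ball (z\<^sub>0, c\<^sub>0) e" using r(2) by simp
    then show ?thesis using e(2) by blast
  qed
  have oc: "open open_cube" by (simp add: open_cube_def open_Times)
  have emb: "smooth_embedding open_cube (\<lambda>q. \<Phi> (\<iota> q))"
  proof (rule smooth_embeddingI[where g="\<lambda>x. \<kappa> (g x)", OF oc])
    have "smooth_on open_cube \<iota>"
      unfolding \<iota>_def case_prod_unfold by (intro smooth_intros oc)
    then show "smooth_on open_cube (\<lambda>q. \<Phi> (\<iota> q))"
      by (rule smooth_on_compose[OF assms(2) _ oc assms(1) \<iota>V])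
    show "\<kappa> (g (\<Phi> (\<iota> q))) = q" if "q \<in> open_cube" for q
      using left_inv(1)[OF \<iota>V[OF that]] \<kappa>\<iota> by simp
    fix q assume q: "q \<in> open_cube"
    have "smooth_on UNIV \<kappa>"
      unfolding \<kappa>_def case_prod_unfold by (intro smooth_intros) (use r in auto)
    then have "\<kappa> differentiable (at y)" for y
      using smooth_on_imp_differentiable by blast
    then show "(\<lambda>x. \<kappa> (g x)) differentiable (at (\<Phi> (\<iota> q)))"
      using left_inv(2)[OF \<iota>V[OF q]] differentiable_chain_at[of g "\<Phi> (\<iota> q)" \<kappa>]
      by (simp add: o_def)
  qed
  define W where "W = {q \<in> open_cube. half \<longrightarrow> 0 \<le> snd (snd q)}"
  have W: "W = open_cube \<or> W = {(a, b, c) \<in> open_cube. 0 \<le> c}" by (auto simp: W_def)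
  have \<iota>W: "\<iota> q \<in> {q \<in> V. half \<longrightarrow> 0 \<le> snd q}" if "q \<in> W" for q
    using that \<iota>V base(3) r by (auto simp: W_def \<iota>_def split: prod.splits)
  have "continuous_on UNIV \<kappa>"
    unfolding \<kappa>_def case_prod_unfold using r by (intro continuous_intros) auto
  then have oimg: "open (\<kappa> -` open_cube)" using oc open_vimage by blast
  have "continuous_on (\<Phi> ` V) g"
    using left_inv(2) by (auto intro!: continuous_at_imp_continuous_on differentiable_imp_continuous_within)
  then obtain N' where N': "open N'" "N' \<inter> \<Phi> ` V = g -` (\<kappa> -` open_cube) \<inter> \<Phi> ` V"
    using oimg unfolding continuous_on_open_invariant by blast
  have img: "(\<lambda>q. \<Phi> (\<iota> q)) ` W = M \<inter> (N \<inter> N')"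
  proof
    show "(\<lambda>q. \<Phi> (\<iota> q)) ` W \<subseteq> M \<inter> (N \<inter> N')"
    proof (rule image_subsetI)
      fix q assume q: "q \<in> W"
      have "\<Phi> (\<iota> q) \<in> M \<inter> N" unfolding image(2) using \<iota>W[OF q] by blast
      moreover have "g (\<Phi> (\<iota> q)) = \<iota> q" "\<iota> q \<in> V" using q \<iota>V left_inv by (auto simp: W_def)
      then have "\<Phi> (\<iota> q) \<in> g -` (\<kappa> -` open_cube) \<inter> \<Phi> ` V"
        using q \<kappa>\<iota>[of q] by (simp add: W_def)
      then have "\<Phi> (\<iota> q) \<in> N'"
        using N'(2) q \<kappa>\<iota>[of q] unfolding W_def by blast
      ultimately show "\<Phi> (\<iota> q) \<in> M \<inter> (N \<inter> N')" by blast
    qed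
    show "M \<inter> (N \<inter> N') \<subseteq> (\<lambda>q. \<Phi> (\<iota> q)) ` W"
    proof
      fix x assume x: "x \<in> M \<inter> (N \<inter> N')"
      then obtain q where q: "x = \<Phi> q" "q \<in> V" "half \<longrightarrow> 0 \<le> snd q" using image(2) by blast
      have "x \<in> g -` (\<kappa> -` open_cube)" using N'(2) x q(1,2) by blast
      then have "\<kappa> q \<in> open_cube" using q(1) left_inv(1)[OF q(2)] by simp
      moreover have "half \<longrightarrow> 0 \<le> snd (snd (\<kappa> q))"
        using q(3) base(3) r by (auto simp: \<kappa>_def split: prod.splits)
      ultimately have "\<kappa> q \<in> W" by (simp add: W_def)
      then show "x \<in> (\<lambda>q. \<Phi> (\<iota> q)) ` W" using q(1) \<iota>\<kappa>[of q] by (metis image_eqI)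
    qed
  qed
  have slice: "\<exists>L\<in>\<L>. (\<lambda>q. \<Phi> (\<iota> q)) ` {q \<in> W. snd (snd q) = c} \<subseteq> L" for c
  proof (cases "half \<and> c < 0")
    case True
    then have "{q \<in> W. snd (snd q) = c} = {}" by (auto simp: W_def)
    then show ?thesis using assms(11) by (metis (no_types, lifting) empty_subsetI ex_in_conv image_empty)
  next
    case False
    obtain L where L: "L \<in> \<L>" "\<And>z. (z, c\<^sub>0 + r * c) \<in> V \<Longrightarrow> \<Phi> (z, c\<^sub>0 + r * c) \<in> L"
      using slices[of "c\<^sub>0 + r * c"] False base(3) r by auto
    have "\<Phi> (\<iota> q) \<in> L" if "q \<in> W" "snd (snd q) = c" for q
    proof -
      have "\<iota> q = (fst (\<iota> q), c\<^sub>0 + r * c)" using that(2) by (auto simp: \<iota>_def split: prod.splits)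
      then show ?thesis using L(2)[of "fst (\<iota> q)"] \<iota>W[OF that(1)] by auto
    qed
    then show ?thesis using L(1) by blast
  qed
  have "open (N \<inter> N')" using image(1) N'(1) by blast
  moreover have "p \<in> N \<inter> N'"
  proof -
    have "(0, 0, 0) \<in> W" by (simp add: W_def open_cube_def)
    moreover have "\<iota> (0, 0, 0) = (z\<^sub>0, c\<^sub>0)" by (simp add: \<iota>_def Complex_eq_0)
    ultimately show ?thesis using img base(2) by (metis IntD2 image_eqI)
  qed
  ultimately show ?thesis
    unfolding foliated_at_def using emb W img slice by blast
qed

section \<open>Rotation of planar curves\<close>

definition angle_lift :: "(real \<Rightarrow> complex) \<Rightarrow> (real \<Rightarrow> real) \<Rightarrow> bool" where
  "angle_lift z \<psi> \<longleftrightarrow> continuous_on UNIV \<psi> \<and> (\<forall>t. z t = of_real (cmod (z t)) * cis (\<psi> t))"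

lemma angle_lift_sgn: "angle_lift z \<psi> \<Longrightarrow> z t \<noteq> 0 \<Longrightarrow> sgn (z t) = cis (\<psi> t)"
  unfolding angle_lift_def
  by (metis (no_types, lifting) mult_cancel_left norm_eq_zero of_real_eq_0_iff sgn_eq
      nonzero_mult_div_cancel_left)

lemma angle_lift_exists:
  assumes "continuous_on UNIV z" "\<And>t. z t \<noteq> 0"
  obtains \<psi> where "angle_lift z \<psi>"
proof -
  obtain g where g: "continuous_on UNIV g" "\<And>t. z t = exp (g t)"
    using continuous_logarithm_on_contractible[OF assms(1) contractible_UNIV] assms(2) by auto
  have "z t = of_real (cmod (z t)) * cis (Im (g t))" for t
    by (simp add: g(2) exp_eq_polar norm_mult)
  then have "angle_lift z (\<lambda>t. Im (g t))"
    unfolding angle_lift_def using g(1) by (auto intro: continuous_intros)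
  then show thesis using that by blast
qed

lemma integer_valued_continuous_constant:
  fixes f :: "real \<Rightarrow> real"
  assumes "continuous_on UNIV f" "\<And>t. f t \<in> \<int>"
  shows "f s = f t"
proof -
  have "f constant_on UNIV"
  proof (rule continuous_discrete_range_constant[OF connected_UNIV assms(1)])
    fix x :: real
    have "1 \<le> norm (f y - f x)" if "f y \<noteq> f x" for y
    proof -
      obtain m n :: int where "f y = m" "f x = n" using assms(2) by (metis Ints_cases)
      then show ?thesis using that by (simp flip: of_int_diff of_int_abs)
    qed
    then show "\<exists>e>0. \<forall>y. y \<in> UNIV \<and> f y \<noteq> f x \<longrightarrow> e \<le> norm (f y - f x)"
      by (intro exI[of _ 1]) auto
  qed
  then show ?thesis by (auto simp: constant_on_def)
qed

text \<open>Two lifts differ by a continuous function with values in \<open>2 \<pi> \<int>\<close>.\<close>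

lemma angle_lift_change_unique:
  assumes "angle_lift z \<psi>" "angle_lift z \<phi>" "\<And>t. z t \<noteq> 0"
  shows "\<psi> s - \<psi> t = \<phi> s - \<phi> t"
proof -
  have "(\<psi> t - \<phi> t) / (2 * pi) \<in> \<int>" for t
  proof -
    have "cis (\<psi> t) = cis (\<phi> t)" using angle_lift_sgn assms by metis
    then have "sin (\<psi> t) = sin (\<phi> t) \<and> cos (\<psi> t) = cos (\<phi> t)" by (simp add: complex_eq_iff)
    then obtain n :: int where "\<psi> t = \<phi> t + 2 * pi * n" by (auto simp: sin_cos_eq_iff)
    then show ?thesis by simp
  qed
  moreover have "continuous_on UNIV (\<lambda>t. (\<psi> t - \<phi> t) / (2 * pi))"
    using assms(1,2) by (auto simp: angle_lift_def intro!: continuous_intros)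
  ultimately have "(\<psi> s - \<phi> s) / (2 * pi) = (\<psi> t - \<phi> t) / (2 * pi)"
    using integer_valued_continuous_constant[of "\<lambda>t. (\<psi> t - \<phi> t) / (2 * pi)" s t] by blast
  then show ?thesis by simp
qed

lemma angle_lift_Ln:
  assumes "continuous_on UNIV z" "\<And>t. z t \<notin> \<real>\<^sub>\<le>\<^sub>0"
  shows "angle_lift z (\<lambda>t. Im (Ln (z t)))"
proof -
  have "z t \<noteq> 0" for t using assms(2)[of t] by auto
  then have "z t = of_real (cmod (z t)) * cis (Im (Ln (z t)))" for t
    by (metis exp_Ln exp_eq_polar norm_exp_eq_Re)
  then show ?thesis using assms by (auto simp: angle_lift_def intro!: continuous_intros)
qed

lemma angle_lift_mult:
  assumes "angle_lift z \<psi>" "angle_lift w \<phi>"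
  shows "angle_lift (\<lambda>t. z t * w t) (\<lambda>t. \<psi> t + \<phi> t)"
proof -
  have "z t * w t = of_real (cmod (z t * w t)) * cis (\<psi> t + \<phi> t)" for t
  proof -
    have "z t * w t = (of_real (cmod (z t)) * cis (\<psi> t)) * (of_real (cmod (w t)) * cis (\<phi> t))"
      using assms by (simp add: angle_lift_def)
    then show ?thesis by (simp add: norm_mult cis_mult[symmetric] ac_simps)
  qed
  then show ?thesis using assms by (auto simp: angle_lift_def intro!: continuous_intros)
qed

lemma angle_lift_cnj:
  assumes "angle_lift z \<psi>"
  shows "angle_lift (\<lambda>t. cnj (z t)) (\<lambda>t. - \<psi> t)"
proof -
  have "cnj (z t) = of_real (cmod (z t)) * cis (- \<psi> t)" for t
  proof -
    have "cnj (z t) = cnj (of_real (cmod (z t)) * cis (\<psi> t))"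
      using assms by (simp add: angle_lift_def)
    then show ?thesis by (simp add: cis_cnj)
  qed
  moreover have "continuous_on UNIV (\<lambda>t. - \<psi> t)"
    using assms by (auto simp: angle_lift_def intro!: continuous_intros)
  ultimately show ?thesis unfolding angle_lift_def complex_mod_cnj by blast
qed

lemma angle_lift_const: "\<exists>\<phi>. angle_lift (\<lambda>_. w) (\<lambda>_. \<phi>)"
proof (intro exI)
  show "angle_lift (\<lambda>_. w) (\<lambda>_. Arg w)"
    unfolding angle_lift_def by (metis continuous_on_const rcis_cmod_Arg rcis_def)
qed

text \<open>Two curves that never point in opposite directions have angles that differ by the principal
  argument of their quotient.\<close>

lemma angle_lift_compare:
  assumes "angle_lift w \<phi>" "angle_lift z \<psi>" "continuous_on UNIV w" "continuous_on UNIV z"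
    and "\<And>t. z t / w t \<notin> \<real>\<^sub>\<le>\<^sub>0"
  shows "\<psi> s - \<psi> t = (\<phi> s - \<phi> t) + (Im (Ln (z s / w s)) - Im (Ln (z t / w t)))"
proof -
  have nz: "z t \<noteq> 0" "w t \<noteq> 0" for t using assms(5)[of t] by auto
  have "angle_lift (\<lambda>t. z t / w t) (\<lambda>t. Im (Ln (z t / w t)))"
    by (rule angle_lift_Ln) (use assms nz in \<open>auto intro!: continuous_intros\<close>)
  from angle_lift_mult[OF assms(1) this]
  have "angle_lift z (\<lambda>t. \<phi> t + Im (Ln (z t / w t)))" using nz by simp
  from angle_lift_change_unique[OF assms(2) this nz(1), of s t] show ?thesis by simp
qed

text \<open>Near \<open>t\<close> the lift is \<open>\<psi> t\<close> plus the principal argument of \<open>z s / z t\<close>.\<close>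

lemma angle_lift_has_derivative:
  assumes "angle_lift z \<psi>" "z t \<noteq> 0" "(z has_vector_derivative z') (at t)"
  shows "(\<psi> has_real_derivative Im (z' / z t)) (at t)"
proof -
  have "((\<lambda>s. z s / z t) has_vector_derivative z' / z t) (at t)"
    using has_vector_derivative_divide[OF assms(3), of "z t"] by simp
  moreover have "(Ln has_field_derivative 1) (at (z t / z t))"
    using assms(2) has_field_derivative_Ln[of 1] by simp
  ultimately have "((\<lambda>s. Ln (z s / z t)) has_vector_derivative z' / z t) (at t)"
    using field_vector_diff_chain_at[of "\<lambda>s. z s / z t" "z' / z t" t Ln 1] by (simp add: o_def)
  from bounded_linear.has_vector_derivative[OF bounded_linear_Im this]
  have der: "((\<lambda>s. \<psi> t + Im (Ln (z s / z t))) has_real_derivative Im (z' / z t)) (at t)"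
    by (auto simp: has_real_derivative_iff_has_vector_derivative intro!: derivative_eq_intros)
  have "isCont z t" using assms(3) has_vector_derivative_continuous by blast
  then have ev1: "\<forall>\<^sub>F s in nhds t. z s \<noteq> 0"
    using assms(2) by (simp add: isCont_def tendsto_imp_eventually_ne eventually_nhds_conv_at)
  have "isCont \<psi> t" using assms(1) by (simp add: angle_lift_def continuous_on_eq_continuous_at)
  then have "\<forall>\<^sub>F s in nhds t. dist (\<psi> s) (\<psi> t) < pi"
    by (auto simp: isCont_def eventually_nhds_conv_at intro: tendstoD)
  with ev1 have "\<forall>\<^sub>F s in nhds t. \<psi> t + Im (Ln (z s / z t)) = \<psi> s"
  proof eventually_elim
    case (elim s)
    have "z s / z t = (of_real (cmod (z s)) * cis (\<psi> s)) / (of_real (cmod (z t)) * cis (\<psi> t))"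
      using assms(1) by (simp add: angle_lift_def)
    also have "\<dots> = of_real (cmod (z s) / cmod (z t)) * cis (\<psi> s - \<psi> t)"
      by (simp add: cis_divide[symmetric])
    also have "\<dots> = of_real (cmod (z s) / cmod (z t)) * exp (\<i> * of_real (\<psi> s - \<psi> t))"
      by (simp add: cis_conv_exp)
    finally have q: "z s / z t = of_real (cmod (z s) / cmod (z t)) * exp (\<i> * of_real (\<psi> s - \<psi> t))" .
    have "0 < cmod (z s) / cmod (z t)" using elim assms(2) by simp
    moreover have "Ln (exp (\<i> * of_real (\<psi> s - \<psi> t))) = \<i> * of_real (\<psi> s - \<psi> t)"
      using elim by (intro Ln_exp) (auto simp: dist_real_def)
    ultimately have "Ln (z s / z t) = of_real (ln (cmod (z s) / cmod (z t))) + \<i> * of_real (\<psi> s - \<psi> t)"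
      unfolding q using Ln_times_of_real[of "cmod (z s) / cmod (z t)" "exp (\<i> * of_real (\<psi> s - \<psi> t))"]
        Ln_of_real[of "cmod (z s) / cmod (z t)"] by (metis exp_not_eq_zero)
    then show ?case by simp
  qed
  from has_field_derivative_cong_ev[THEN iffD1, OF refl _ refl refl _ der, of \<psi>] this show ?thesis
    by (auto simp: eventually_nhds_conv_at assms(2) dest: eventually_nhds_x_imp_x)
qed

section \<open>The linearized oscillator and repeller\<close>

text \<open>Linearization of \<open>x' = y\<close>, \<open>y' = - W'(x)\<close> at an equilibrium with \<open>W'' = \<mu>\<close>.\<close>

definition lin_solution :: "real \<Rightarrow> (real \<Rightarrow> real) \<Rightarrow> (real \<Rightarrow> real) \<Rightarrow> bool" where
  "lin_solution \<mu> \<xi> \<eta> \<longleftrightarrow>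
     (\<forall>t. (\<xi> has_real_derivative \<eta> t) (at t) \<and> (\<eta> has_real_derivative - \<mu> * \<xi> t) (at t))"

lemma lin_solution_Complex_derivative:
  assumes "lin_solution \<mu> \<xi> \<eta>"
  shows "((\<lambda>t. Complex (\<xi> t) (\<eta> t)) has_vector_derivative Complex (\<eta> t) (- \<mu> * \<xi> t)) (at t)"
  using assms by (simp add: lin_solution_def has_vector_derivative_complex_iff
      flip: has_real_derivative_iff_has_vector_derivative)

lemma lin_solution_continuous:
  assumes "lin_solution \<mu> \<xi> \<eta>"
  shows "continuous_on UNIV (\<lambda>t. Complex (\<xi> t) (\<eta> t))"
  using lin_solution_Complex_derivative[OF assms]
  by (auto intro!: continuous_at_imp_continuous_on has_vector_derivative_continuous)

lemma oscillator_rotates: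
  assumes "lin_solution (\<omega>\<^sup>2) \<xi> \<eta>" "0 < \<omega>"
  shows "Complex (\<omega> * \<xi> t) (\<eta> t) = Complex (\<omega> * \<xi> 0) (\<eta> 0) * cis (- \<omega> * t)"
proof -
  define f where "f = (\<lambda>t. Complex (\<omega> * \<xi> t) (\<eta> t) * cis (\<omega> * t))"
  have "(Re \<circ> f has_real_derivative 0) (at t)" "(Im \<circ> f has_real_derivative 0) (at t)" for t
    using assms(1) unfolding f_def o_def lin_solution_def
    by (auto intro!: derivative_eq_intros simp: algebra_simps power2_eq_square)
  then have "(Re \<circ> f) t = (Re \<circ> f) 0" "(Im \<circ> f) t = (Im \<circ> f) 0"
    using DERIV_isconst_all by blast+
  then have "f t = f 0" by (simp add: complex_eq_iff)
  then have "Complex (\<omega> * \<xi> t) (\<eta> t) * (cis (\<omega> * t) * cis (- \<omega> * t))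
      = Complex (\<omega> * \<xi> 0) (\<eta> 0) * cis (- \<omega> * t)"
    by (simp add: f_def mult.assoc)
  then show ?thesis by (simp add: cis_mult)
qed

lemma oscillator_nonzero:
  assumes "lin_solution (\<omega>\<^sup>2) \<xi> \<eta>" "0 < \<omega>" "Complex (\<xi> 0) (\<eta> 0) \<noteq> 0"
  shows "Complex (\<xi> t) (\<eta> t) \<noteq> 0"
proof
  assume "Complex (\<xi> t) (\<eta> t) = 0"
  then have "Complex (\<omega> * \<xi> t) (\<eta> t) = 0" by (simp add: Complex_eq_0)
  then have "Complex (\<omega> * \<xi> 0) (\<eta> 0) = 0" using oscillator_rotates[OF assms(1,2), of t] by simp
  then show False using assms(2,3) by (simp add: Complex_eq_0)
qed

text \<open>In the coordinate \<open>\<omega> \<xi> + i \<eta>\<close> the motion is a uniform rotation.  For \<open>\<omega> \<ge> 1\<close> the angle of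
  \<open>\<xi> + i \<eta>\<close> decreases with a speed of at least 1.  The two vectors never point in opposite directions,
  so both lose exactly one turn in the common period \<open>2 \<pi> / \<omega>\<close>.\<close>

lemma oscillator_angle:
  assumes sol: "lin_solution (\<omega>\<^sup>2) \<xi> \<eta>" and \<omega>: "1 \<le> \<omega>" and nz: "Complex (\<xi> 0) (\<eta> 0) \<noteq> 0"
    and lift: "angle_lift (\<lambda>t. Complex (\<xi> t) (\<eta> t)) \<psi>"
    and T: "0 < T" "\<omega> * T \<le> 2 * pi"
  shows "T \<le> \<psi> 0 - \<psi> T" "\<psi> 0 - \<psi> T \<le> 2 * pi"
proof -
  define z where "z = (\<lambda>t. Complex (\<xi> t) (\<eta> t))"
  have \<omega>0: "0 < \<omega>" using \<omega> by simp
  have znz: "z t \<noteq> 0" for t unfolding z_def using oscillator_nonzero[OF sol \<omega>0 nz] .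
  have zd: "(z has_vector_derivative Complex (\<eta> t) (- (\<omega>\<^sup>2) * \<xi> t)) (at t)" for t
    unfolding z_def using lin_solution_Complex_derivative[OF sol] .
  have lz: "angle_lift z \<psi>" using lift by (simp add: z_def)
  have d: "(\<psi> has_real_derivative Im (Complex (\<eta> t) (- (\<omega>\<^sup>2) * \<xi> t) / z t)) (at t)" for t
    by (rule angle_lift_has_derivative[OF lz znz zd])
  have speed: "Im (Complex (\<eta> t) (- (\<omega>\<^sup>2) * \<xi> t) / z t) \<le> - 1" for t
  proof -
    have pos: "(\<xi> t)\<^sup>2 + (\<eta> t)\<^sup>2 > 0"
      using znz[of t] by (simp add: z_def Complex_eq_0 sum_power2_gt_zero_iff)
    have "Im (Complex (\<eta> t) (- (\<omega>\<^sup>2) * \<xi> t) / z t) = - (\<omega>\<^sup>2 * (\<xi> t)\<^sup>2 + (\<eta> t)\<^sup>2) / ((\<xi> t)\<^sup>2 + (\<eta> t)\<^sup>2)"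
      by (simp add: z_def Im_divide power2_eq_square algebra_simps)
    also have "1 * (\<xi> t)\<^sup>2 \<le> \<omega>\<^sup>2 * (\<xi> t)\<^sup>2"
      using \<omega> by (intro mult_right_mono) (auto simp: one_le_power)
    then have "- (\<omega>\<^sup>2 * (\<xi> t)\<^sup>2 + (\<eta> t)\<^sup>2) / ((\<xi> t)\<^sup>2 + (\<eta> t)\<^sup>2) \<le> - 1"
      using pos by (simp add: divide_simps)
    finally show ?thesis .
  qed
  have dec: "\<psi> t - \<psi> s \<le> - (t - s)" if "s < t" for s t
  proof -
    obtain r where "\<psi> t - \<psi> s = (t - s) * Im (Complex (\<eta> r) (- (\<omega>\<^sup>2) * \<xi> r) / z r)"
      using MVT2[OF \<open>s < t\<close>, of \<psi> "\<lambda>r. Im (Complex (\<eta> r) (- (\<omega>\<^sup>2) * \<xi> r) / z r)"] d by blast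
    then show ?thesis using mult_left_mono[OF speed[of r], of "t - s"] that by simp
  qed
  show "T \<le> \<psi> 0 - \<psi> T" using dec[OF T(1)] by simp
  define \<tau> where "\<tau> = 2 * pi / \<omega>"
  have \<tau>: "T \<le> \<tau>" using T(2) \<omega>0 by (simp add: \<tau>_def field_simps)
  define w where "w = (\<lambda>t. Complex (\<omega> * \<xi> t) (\<eta> t))"
  have w: "w t = w 0 * cis (- \<omega> * t)" for t
    unfolding w_def by (rule oscillator_rotates[OF sol \<omega>0])
  obtain \<phi>0 where "angle_lift (\<lambda>_. w 0) (\<lambda>_. \<phi>0)" using angle_lift_const by blast
  moreover have "angle_lift (\<lambda>t. cis (- \<omega> * t)) (\<lambda>t. - \<omega> * t)"
    by (auto simp: angle_lift_def intro!: continuous_intros)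
  ultimately have "angle_lift (\<lambda>t. w 0 * cis (- \<omega> * t)) (\<lambda>t. \<phi>0 + - \<omega> * t)"
    by (rule angle_lift_mult)
  moreover have weq: "w = (\<lambda>t. w 0 * cis (- \<omega> * t))" using w by blast
  ultimately have lw: "angle_lift w (\<lambda>t. \<phi>0 + - \<omega> * t)" by argo
  have "cis (- \<omega> * \<tau>) = 1" using \<omega>0 by (simp add: \<tau>_def complex_eq_iff)
  then have "w \<tau> = w 0" using w[of \<tau>] by simp
  then have per: "z \<tau> = z 0" using \<omega>0 by (simp add: w_def z_def)
  have "z t / w t \<notin> \<real>\<^sub>\<le>\<^sub>0" for t
  proof -
    have "0 < \<omega> * (\<xi> t)\<^sup>2 + (\<eta> t)\<^sup>2"
      using znz[of t] \<omega>0 by (cases "\<xi> t = 0") (auto simp: z_def Complex_eq_0 add_pos_nonneg)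
    moreover have "(\<omega> * \<xi> t)\<^sup>2 + (\<eta> t)\<^sup>2 > 0"
      using znz[of t] \<omega>0 by (simp add: z_def Complex_eq_0 sum_power2_gt_zero_iff)
    ultimately have "Re (z t / w t) > 0"
      by (simp add: z_def w_def Re_divide power2_eq_square algebra_simps)
    then show ?thesis by (auto simp: complex_nonpos_Reals_iff)
  qed
  moreover have "continuous_on UNIV w" by (subst weq) (intro continuous_intros)
  moreover have "continuous_on UNIV z"
    unfolding z_def by (rule lin_solution_continuous[OF sol])
  ultimately have "\<psi> \<tau> - \<psi> 0 = - \<omega> * \<tau>"
    using angle_lift_compare[OF lw lz, of \<tau> 0] per \<open>w \<tau> = w 0\<close> by simp
  then have "\<psi> 0 - \<psi> \<tau> = 2 * pi" using \<omega>0 by (simp add: \<tau>_def)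
  moreover have "\<psi> \<tau> \<le> \<psi> T" using dec[of T \<tau>] \<tau> by (cases "T = \<tau>") auto
  ultimately show "\<psi> 0 - \<psi> T \<le> 2 * pi" by simp
qed

lemma repeller_invariants:
  assumes "lin_solution (- \<kappa>\<^sup>2) \<xi> \<eta>"
  shows "\<kappa> * \<xi> t + \<eta> t = (\<kappa> * \<xi> 0 + \<eta> 0) * exp (\<kappa> * t)"
    and "\<kappa> * \<xi> t - \<eta> t = (\<kappa> * \<xi> 0 - \<eta> 0) * exp (- \<kappa> * t)"
proof -
  have "((\<lambda>t. (\<kappa> * \<xi> t + \<eta> t) * exp (- \<kappa> * t)) has_real_derivative 0) (at t)"
    "((\<lambda>t. (\<kappa> * \<xi> t - \<eta> t) * exp (\<kappa> * t)) has_real_derivative 0) (at t)" for t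
    using assms unfolding lin_solution_def
    by (auto intro!: derivative_eq_intros simp: algebra_simps power2_eq_square)
  then have *: "(\<kappa> * \<xi> t + \<eta> t) * exp (- \<kappa> * t) = \<kappa> * \<xi> 0 + \<eta> 0"
     "(\<kappa> * \<xi> t - \<eta> t) * exp (\<kappa> * t) = \<kappa> * \<xi> 0 - \<eta> 0"
    using DERIV_isconst_all[of "\<lambda>t. (\<kappa> * \<xi> t + \<eta> t) * exp (- \<kappa> * t)" t 0]
      DERIV_isconst_all[of "\<lambda>t. (\<kappa> * \<xi> t - \<eta> t) * exp (\<kappa> * t)" t 0] by auto
  show "\<kappa> * \<xi> t + \<eta> t = (\<kappa> * \<xi> 0 + \<eta> 0) * exp (\<kappa> * t)"
    "\<kappa> * \<xi> t - \<eta> t = (\<kappa> * \<xi> 0 - \<eta> 0) * exp (- \<kappa> * t)"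
    unfolding *[symmetric] by (simp_all add: mult.assoc flip: exp_add)
qed

text \<open>A solution that is not on the unstable line never crosses it, hence turns by less than
  half a turn; a solution on that line does not turn.\<close>

lemma repeller_angle:
  assumes sol: "lin_solution (- \<kappa>\<^sup>2) \<xi> \<eta>" and \<kappa>: "0 < \<kappa>" and nz: "Complex (\<xi> 0) (\<eta> 0) \<noteq> 0"
    and lift: "angle_lift (\<lambda>t. Complex (\<xi> t) (\<eta> t)) \<psi>"
  shows "\<bar>\<psi> s - \<psi> t\<bar> < pi"
proof -
  define z where "z = (\<lambda>t. Complex (\<xi> t) (\<eta> t))"
  have lz: "angle_lift z \<psi>" using lift by (simp add: z_def)
  have cz: "continuous_on UNIV z" unfolding z_def by (rule lin_solution_continuous[OF sol])
  define A B where "A = \<kappa> * \<xi> 0 + \<eta> 0" and "B = \<kappa> * \<xi> 0 - \<eta> 0"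
  have inv: "\<kappa> * \<xi> t + \<eta> t = A * exp (\<kappa> * t)" "\<kappa> * \<xi> t - \<eta> t = B * exp (- \<kappa> * t)" for t
    unfolding A_def B_def by (fact repeller_invariants[OF sol])+
  \<comment> \<open>A direction from which the solution is never at the angle \<open>\<pi>\<close>: the solution itself if it
    lies on the unstable line, and the unstable direction otherwise.\<close>
  define w where "w = (if B = 0 then of_real A * Complex 1 \<kappa> else Complex 1 \<kappa>)"
  obtain \<phi>0 where lw: "angle_lift (\<lambda>_. w) (\<lambda>_. \<phi>0)" using angle_lift_const by blast
  have compare: "\<psi> s - \<psi> t = Im (Ln (z s / w)) - Im (Ln (z t / w))" if "\<And>t. z t / w \<notin> \<real>\<^sub>\<le>\<^sub>0"
    using angle_lift_compare[OF lw lz _ cz, of s t] that by simp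
  show ?thesis
  proof (cases "B = 0")
    case True
    have "A \<noteq> 0"
    proof
      assume "A = 0"
      then have "\<eta> 0 = 0" "\<kappa> * \<xi> 0 = 0" using True unfolding A_def B_def by linarith+
      then show False using nz \<kappa> by (simp add: Complex_eq_0)
    qed
    have "z t = of_real (exp (\<kappa> * t) / (2 * \<kappa>)) * w" for t
    proof -
      have "\<eta> t = \<kappa> * \<xi> t" using inv(2)[of t] True by simp
      moreover have "\<xi> t = A * exp (\<kappa> * t) / (2 * \<kappa>)"
        using inv(1)[of t] \<kappa> unfolding calculation by (simp add: field_simps)
      ultimately show ?thesis using True by (simp add: z_def w_def complex_eq_iff)
    qed
    moreover have "w \<noteq> 0" using \<open>A \<noteq> 0\<close> by (simp add: w_def True Complex_eq_0)
    ultimately have q: "z t / w = of_real (exp (\<kappa> * t) / (2 * \<kappa>))" for t by simp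
    have "z t / w \<notin> \<real>\<^sub>\<le>\<^sub>0" for t
      unfolding q using \<kappa> by (simp only: complex_nonpos_Reals_iff) (simp add: not_le)
    from compare[OF this] show ?thesis
      unfolding q using \<kappa> by (subst (asm) (1 2) Ln_of_real) auto
  next
    case False
    have im: "Im (z t / w) = - B * exp (- \<kappa> * t) / (1 + \<kappa>\<^sup>2)" for t
      using inv(2)[of t] False by (simp add: z_def w_def Im_divide power2_eq_square field_simps)
    have "1 + \<kappa>\<^sup>2 > 0" by (simp add: add_pos_nonneg)
    then have im0: "Im (z t / w) \<noteq> 0" for t unfolding im using False by simp
    then have "z t / w \<notin> \<real>\<^sub>\<le>\<^sub>0" for t by (auto simp: complex_nonpos_Reals_iff)
    note change = compare[OF this]
    have "(0 < Im (z t / w)) = (B < 0)" "(Im (z t / w) < 0) = (0 < B)" for t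
      unfolding im using \<open>1 + \<kappa>\<^sup>2 > 0\<close> by (auto simp: divide_simps mult_less_0_iff zero_less_mult_iff)
    then have "(\<forall>t. 0 < Im (z t / w)) \<or> (\<forall>t. Im (z t / w) < 0)" using False by force
    then show ?thesis
    proof
      assume p: "\<forall>t. 0 < Im (z t / w)"
      have "0 < Im (Ln (z t / w)) \<and> Im (Ln (z t / w)) < pi" for t
        using p im0[of t] by (metis Im_Ln_pos_lt_imp Im_Ln_pos_lt zero_complex.simps(2))
      then show ?thesis unfolding change abs_less_iff by (smt (verit))
    next
      assume p: "\<forall>t. Im (z t / w) < 0"
      have "- pi < Im (Ln (z t / w)) \<and> Im (Ln (z t / w)) < 0" for t
      proof -
        have "z t / w \<noteq> 0" using im0[of t] by auto
        then show ?thesis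
          using p[rule_format, of t] mpi_less_Im_Ln[of "z t / w"] Im_Ln_pos_le[of "z t / w"]
            Im_Ln_le_pi[of "z t / w"] by linarith
      qed
      then show ?thesis unfolding change abs_less_iff by (smt (verit))
    qed
  qed
qed

text \<open>The solutions starting on the segment between the unstable direction \<open>(1, \<kappa>)\<close> and
  \<open>(0, 2 \<kappa>)\<close> turn towards the unstable line by every amount in some interval \<open>[0, c]\<close>.\<close>

lemma repeller_angle_interval:
  assumes \<kappa>: "0 < \<kappa>" and T: "0 < T"
  obtains c where "0 < c" and
    "\<And>d. 0 \<le> d \<Longrightarrow> d \<le> c \<Longrightarrow> \<exists>\<xi> \<eta> \<psi>. lin_solution (- \<kappa>\<^sup>2) \<xi> \<eta> \<and> Complex (\<xi> 0) (\<eta> 0) \<noteq> 0 \<and>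
       angle_lift (\<lambda>t. Complex (\<xi> t) (\<eta> t)) \<psi> \<and> \<psi> 0 - \<psi> T = d"
proof -
  define \<xi> where "\<xi> = (\<lambda>B t. exp (\<kappa> * t) + B * exp (- \<kappa> * t))"
  define \<eta> where "\<eta> = (\<lambda>B t. \<kappa> * (exp (\<kappa> * t) - B * exp (- \<kappa> * t)))"
  define z where "z = (\<lambda>B t. Complex (\<xi> B t) (\<eta> B t))"
  define D where "D = (\<lambda>B. Im (Ln (z B 0)) - Im (Ln (z B T)))"
  have sol: "lin_solution (- \<kappa>\<^sup>2) (\<xi> B) (\<eta> B)" for B
    unfolding lin_solution_def \<xi>_def \<eta>_def
    by (auto intro!: derivative_eq_intros simp: algebra_simps power2_eq_square)
  have pos: "0 < \<eta> B t" if "B \<in> {-1..0}" for B t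
  proof -
    have "B * exp (- \<kappa> * t) \<le> 0" using that by (simp add: mult_nonpos_nonneg)
    moreover have "0 < exp (\<kappa> * t)" by simp
    ultimately show ?thesis using \<kappa> unfolding \<eta>_def by (intro mult_pos_pos) linarith+
  qed
  then have np: "z B t \<notin> \<real>\<^sub>\<le>\<^sub>0" if "B \<in> {-1..0}" for B t
    using pos[OF that, of t] by (auto simp: z_def complex_nonpos_Reals_iff)
  have cz: "continuous_on S (\<lambda>B. z B t)" for S t
    unfolding z_def \<xi>_def \<eta>_def Complex_eq by (intro continuous_intros)
  have contD: "continuous_on {-1..0} D"
    unfolding D_def using np by (intro continuous_intros cz) auto
  have D0: "D 0 = 0"
  proof -
    have "z 0 t = of_real (exp (\<kappa> * t)) * Complex 1 \<kappa>" for t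
      by (simp add: z_def \<xi>_def \<eta>_def complex_eq_iff)
    then show ?thesis by (simp add: D_def Ln_times_of_real Complex_eq_0)
  qed
  have "0 < D (-1)"
  proof -
    have "z (-1) 0 = of_real (2 * \<kappa>) * \<i>" by (simp add: z_def \<xi>_def \<eta>_def complex_eq_iff)
    then have "Im (Ln (z (-1) 0)) = pi / 2" 
      using \<kappa> Ln_times_of_real[of "2 * \<kappa>" \<i>] Ln_of_real[of "2 * \<kappa>"] by simp
    moreover have "0 < Re (z (-1) T)" using \<kappa> T by (simp add: z_def \<xi>_def)
    then have "\<bar>Im (Ln (z (-1) T))\<bar> < pi / 2" using Re_Ln_pos_lt_imp by (metis Re_Ln_pos_lt zero_complex.simps(1) less_irrefl)
    ultimately show ?thesis unfolding D_def by linarith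
  qed
  moreover have "\<exists>\<xi> \<eta> \<psi>. lin_solution (- \<kappa>\<^sup>2) \<xi> \<eta> \<and> Complex (\<xi> 0) (\<eta> 0) \<noteq> 0 \<and>
       angle_lift (\<lambda>t. Complex (\<xi> t) (\<eta> t)) \<psi> \<and> \<psi> 0 - \<psi> T = d" if d: "0 \<le> d" "d \<le> D (-1)" for d
  proof -
    obtain B where B: "-1 \<le> B" "B \<le> 0" "D B = d"
      using IVT2'[of D 0 d "-1"] contD d D0 by auto
    have "angle_lift (z B) (\<lambda>t. Im (Ln (z B t)))"
      using angle_lift_Ln[of "z B"] np B lin_solution_continuous[OF sol[of B]] by (auto simp: z_def)
    moreover have "z B 0 \<noteq> 0" using np[of B 0] B by auto
    ultimately show ?thesis using sol[of B] B(3) unfolding z_def D_def by blast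
  qed
  ultimately show thesis using that by blast
qed

section \<open>The index of a periodic orbit from its rotation interval\<close>

text \<open>The hypothesis says, for all small shifts at once, that \<open>m\<close> is the only number that fits the
  shifted interval, which makes the definite description in the definition of the index meaningful.\<close>

lemma orbit_index_eqI:
  assumes "\<forall>\<^sub>F \<delta> in at_right 0. \<forall>k::int. (m = 2 * k + 1 \<longleftrightarrow> (\<lambda>r. r - \<delta>) ` rotation_interval H P \<subseteq> {of_int k <..< of_int (k + 1)}) \<and>
      (m = 2 * k \<longleftrightarrow> of_int k \<in> interior ((\<lambda>r. r - \<delta>) ` rotation_interval H P))"
  shows "orbit_index H P = m"
  unfolding orbit_index_def
proof (rule the_equality)
  show "\<forall>\<^sub>F \<delta> in at_right 0. let I = (\<lambda>r. r - \<delta>) ` rotation_interval H P in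
       \<exists>k :: int. (m = 2 * k + 1 \<and> I \<subseteq> {of_int k <..< of_int (k + 1)}) \<or>
                  (m = 2 * k \<and> of_int k \<in> interior I)"
    using assms
  proof eventually_elim
    case (elim \<delta>)
    have "m = 2 * (m div 2) + 1 \<or> m = 2 * (m div 2)" by presburger
    then show ?case using elim unfolding Let_def by blast
  qed
  fix m' :: int
  assume "\<forall>\<^sub>F \<delta> in at_right 0. let I = (\<lambda>r. r - \<delta>) ` rotation_interval H P in
       \<exists>k :: int. (m' = 2 * k + 1 \<and> I \<subseteq> {of_int k <..< of_int (k + 1)}) \<or>
                  (m' = 2 * k \<and> of_int k \<in> interior I)"
  with assms have "\<forall>\<^sub>F \<delta> in at_right (0::real). m' = m"
    by eventually_elim (auto simp: Let_def)
  then show "m' = m" by simp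
qed

text \<open>A shift to the left by less than \<open>l - 1\<close> moves \<open>[l, 2]\<close> into the open interval \<open>(1, 2)\<close>.\<close>

lemma orbit_index_3I:
  assumes "rotation_interval H P \<noteq> {}" "rotation_interval H P \<subseteq> {l..2}" "1 < l"
  shows "orbit_index H P = 3"
proof (rule orbit_index_eqI)
  have "\<forall>\<^sub>F \<delta> in at_right 0. \<delta> \<in> {0<..<l - 1}"
    using assms(3) by (intro eventually_at_right_real) simp
  then show "\<forall>\<^sub>F \<delta> in at_right 0. \<forall>k::int. (3 = 2 * k + 1 \<longleftrightarrow> (\<lambda>r. r - \<delta>) ` rotation_interval H P \<subseteq> {of_int k <..< of_int (k + 1)}) \<and>
      (3 = 2 * k \<longleftrightarrow> of_int k \<in> interior ((\<lambda>r. r - \<delta>) ` rotation_interval H P))"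
  proof eventually_elim
    case (elim \<delta>)
    let ?I = "(\<lambda>r. r - \<delta>) ` rotation_interval H P"
    have sub: "?I \<subseteq> {1<..<2}" using assms(2) elim by force
    obtain r where r: "r \<in> ?I" using assms(1) by blast
    show ?case
    proof (intro allI conjI)
      fix k :: int
      show "3 = 2 * k + 1 \<longleftrightarrow> ?I \<subseteq> {of_int k <..< of_int (k + 1)}"
      proof
        assume "3 = 2 * k + 1"
        then have "k = 1" by simp
        then show "?I \<subseteq> {of_int k <..< of_int (k + 1)}" using sub by simp
      next
        assume "?I \<subseteq> {of_int k <..< of_int (k + 1)}"
        then have "of_int k < r" "r < of_int (k + 1)" "1 < r" "r < 2" using r sub by auto
        then have "of_int k < (2::real)" "1 < (of_int (k + 1) :: real)" by linarith+
        then have "k < 2" "1 < k + 1" by linarith+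
        then show "3 = 2 * k + 1" by simp
      qed
      have "of_int k \<notin> interior ?I"
      proof
        assume "of_int k \<in> interior ?I"
        then have "of_int k \<in> {1<..<2::real}" using sub interior_subset by blast
        then have "1 < k" "k < 2" by auto
        then show False by simp
      qed
      then show "3 = 2 * k \<longleftrightarrow> of_int k \<in> interior ?I" by presburger
    qed
  qed
qed

text \<open>The rotation number 1 may be an end point of the interval; a shift to the left makes it an interior
  point.\<close>

lemma orbit_index_2I:
  assumes "rotation_interval H P \<subseteq> {1/2<..<3/2}" "{1..1 + c} \<subseteq> rotation_interval H P" "0 < c"
  shows "orbit_index H P = 2"
proof (rule orbit_index_eqI)
  have "\<forall>\<^sub>F \<delta> in at_right 0. \<delta> \<in> {0<..<min c (1/2)}"
    using assms(3) by (intro eventually_at_right_real) simp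
  then show "\<forall>\<^sub>F \<delta> in at_right 0. \<forall>k::int. (2 = 2 * k + 1 \<longleftrightarrow> (\<lambda>r. r - \<delta>) ` rotation_interval H P \<subseteq> {of_int k <..< of_int (k + 1)}) \<and>
      (2 = 2 * k \<longleftrightarrow> of_int k \<in> interior ((\<lambda>r. r - \<delta>) ` rotation_interval H P))"
  proof eventually_elim
    case (elim \<delta>)
    let ?I = "(\<lambda>r. r - \<delta>) ` rotation_interval H P"
    have sub: "?I \<subseteq> {0<..<3/2}" using assms(1) elim by force
    have "{1 - \<delta><..<1 + c - \<delta>} \<subseteq> ?I"
    proof
      fix x assume "x \<in> {1 - \<delta><..<1 + c - \<delta>}"
      then have "x + \<delta> \<in> rotation_interval H P" using assms(2) by auto
      then show "x \<in> ?I" by (metis add_diff_cancel_right' imageI)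
    qed
    then have "{1 - \<delta><..<1 + c - \<delta>} \<subseteq> interior ?I" by (simp add: interior_maximal)
    then have one: "1 \<in> interior ?I" using elim by auto
    show ?case
    proof (intro allI conjI)
      fix k :: int
      have "\<not> ?I \<subseteq> {of_int k <..< of_int (k + 1)}"
      proof
        assume "?I \<subseteq> {of_int k <..< of_int (k + 1)}"
        then have "1 \<in> {of_int k <..< (of_int (k + 1) :: real)}" using one interior_subset by blast
        then have "k < 1" "1 < k + 1" by auto
        then show False by simp
      qed
      then show "2 = 2 * k + 1 \<longleftrightarrow> ?I \<subseteq> {of_int k <..< of_int (k + 1)}" by presburger
      show "2 = 2 * k \<longleftrightarrow> of_int k \<in> interior ?I"
      proof
        assume "2 = 2 * k"
        then have "k = 1" by simp
        then show "of_int k \<in> interior ?I" using one by simp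
      next
        assume "of_int k \<in> interior ?I"
        then have "of_int k \<in> {0<..<3/2::real}" using sub interior_subset by blast
        then have "0 < k" "of_int k < (2::real)" by auto
        then show "2 = 2 * k" by simp
      qed
    qed
  qed
qed

section \<open>Inverse functions of one variable\<close>

lemma inverse_function_derivative:
  fixes u u' g :: "real \<Rightarrow> real"
  assumes "open V" "\<And>x. x \<in> V \<Longrightarrow> (u has_real_derivative u' x) (at x)" "\<And>x. x \<in> V \<Longrightarrow> u' x \<noteq> 0"
    and "\<And>x. x \<in> V \<Longrightarrow> g (u x) = x" "\<And>c. g c \<in> V" "\<And>c. u (g c) = c"
  shows "(g has_real_derivative inverse (u' (g c))) (at c)"
proof -
  have "continuous_on V u"
    using assms(2) by (auto intro!: continuous_at_imp_continuous_on DERIV_isCont)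
  moreover have "(u has_derivative (\<lambda>h. u' (g c) * h)) (at (g c))"
    using assms(2)[OF assms(5)] by (simp add: has_field_derivative_def)
  moreover have "(\<lambda>h. u' (g c) * h) \<circ> (\<lambda>h. inverse (u' (g c)) * h) = id"
    using assms(3)[OF assms(5)[of c]] by (auto simp: o_def)
  ultimately have "(g has_derivative (\<lambda>h. inverse (u' (g c)) * h)) (at (u (g c)))"
    using has_derivative_inverse_strong[OF assms(1) assms(5)[of c], of u g
        "\<lambda>h. u' (g c) * h" "\<lambda>h. inverse (u' (g c)) * h"] assms(4) by blast
  then show ?thesis by (simp add: assms(6) has_field_derivative_def)
qed

lemma smooth_on_inverse_function:
  fixes u u' g :: "real \<Rightarrow> real"
  assumes "open V" "\<And>x. x \<in> V \<Longrightarrow> (u has_real_derivative u' x) (at x)" "\<And>x. x \<in> V \<Longrightarrow> u' x \<noteq> 0"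
    and "smooth_on V u'" "\<And>x. x \<in> V \<Longrightarrow> g (u x) = x" "\<And>c. g c \<in> V" "\<And>c. u (g c) = c"
  shows "smooth_on UNIV g"
proof (rule smooth_on_ode[OF open_UNIV assms(1)])
  show "smooth_on V (\<lambda>x. inverse (u' x))"
    using assms by (intro smooth_intros) auto
  show "g c \<in> V" for c by (rule assms(6))
  show "(g has_real_derivative inverse (u' (g c))) (at c)" for c
    by (rule inverse_function_derivative[OF assms(1-3,5-7)])
qed

section \<open>The energy surface as a sphere bundle over a line\<close>

locale stark =
  fixes \<epsilon> E :: real
  assumes eps: "0 < \<epsilon>" and energy: "1 / \<epsilon> < E"
begin

abbreviation H :: "R4 \<Rightarrow> real" where "H \<equiv> stark_H \<epsilon>"

text \<open>The maxima of \<open>V\<^sub>1\<close>, over which the saddles lie, are at \<open>a\<close> and \<open>- a\<close>.\<close>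

definition a :: real where "a = 1 / sqrt (2 * \<epsilon>)"

definition R2 :: "real \<Rightarrow> real" where "R2 x = 2 * (E - V1 \<epsilon> x)"
definition R :: "real \<Rightarrow> real" where "R x = sqrt (R2 x)"

text \<open>\<open>Q\<close> is the increasing function with \<open>Q\<^sup>2 = 2 V\<^sub>2\<close>, and \<open>X\<close> is its inverse.\<close>

definition Q :: "real \<Rightarrow> real" where "Q x = x * sqrt (8 * (1 + \<epsilon> * x\<^sup>2))"
definition X :: "real \<Rightarrow> real" where "X q = q / (2 * sqrt (1 + sqrt (1 + \<epsilon> * q\<^sup>2 / 2)))"

lemma a_pos: "0 < a" using eps by (simp add: a_def)

lemma a_square: "a\<^sup>2 = 1 / (2 * \<epsilon>)" using eps by (simp add: a_def power_divide)

lemma abs_less_a_iff: "\<bar>x\<bar> < a \<longleftrightarrow> 2 * \<epsilon> * x\<^sup>2 < 1"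
proof -
  have "\<bar>x\<bar> < a \<longleftrightarrow> x\<^sup>2 < a\<^sup>2" using a_pos abs_le_square_iff[of a x] by linarith
  then show ?thesis unfolding a_square using eps by (simp add: field_simps)
qed

text \<open>Completing the square gives \<open>V\<^sub>1(x) = 1 / \<epsilon> - 4 \<epsilon> (x\<^sup>2 - a\<^sup>2)\<^sup>2\<close>.\<close>

lemma R2_eq: "R2 x = 2 * (E - 1 / \<epsilon>) + 8 * \<epsilon> * (x\<^sup>2 - a\<^sup>2)\<^sup>2"
  unfolding R2_def V1_def a_square using eps by (simp add: field_simps power2_eq_square power4_eq_xxxx)

lemma R2_lower: "2 * (E - 1 / \<epsilon>) \<le> R2 x" "0 < R2 x"
proof -
  show "2 * (E - 1 / \<epsilon>) \<le> R2 x" unfolding R2_eq using eps by simp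
  then show "0 < R2 x" using energy by simp
qed

lemma R_pos: "0 < R x" using R2_lower by (simp add: R_def)

lemma R_square: "(R x)\<^sup>2 = R2 x" using R2_lower[of x] by (simp add: R_def)

lemma R2_even: "R2 (- x) = R2 x" by (simp add: R2_def V1_def)

lemma R_even: "R (- x) = R x" by (simp add: R_def R2_even)

lemma R2_derivative: "(R2 has_real_derivative 32 * \<epsilon> * x * (x\<^sup>2 - a\<^sup>2)) (at x)"
  unfolding R2_eq[abs_def]
  by (auto intro!: derivative_eq_intros simp: field_simps power2_eq_square)

lemma one_plus_pos: "0 < 1 + \<epsilon> * x\<^sup>2"
  using eps by (simp add: add_pos_nonneg)

lemma one_plus_sqrt_pos: "0 < 1 + sqrt (1 + \<epsilon> * x\<^sup>2 / 2)"
  using eps by (simp add: add_pos_nonneg)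

lemma smooth_R2 [smooth_intros]: "smooth_on U f \<Longrightarrow> open U \<Longrightarrow> smooth_on U (\<lambda>x. R2 (f x))"
  unfolding R2_def V1_def by (intro smooth_intros)

lemma smooth_R [smooth_intros]: "smooth_on U f \<Longrightarrow> open U \<Longrightarrow> smooth_on U (\<lambda>x. R (f x))"
  unfolding R_def by (intro smooth_intros) (auto simp: R2_lower)

lemma smooth_Q [smooth_intros]: "smooth_on U f \<Longrightarrow> open U \<Longrightarrow> smooth_on U (\<lambda>x. Q (f x))"
  unfolding Q_def by (intro smooth_intros) (simp_all add: one_plus_pos del: distrib_left_numeral)

lemma smooth_X [smooth_intros]: "smooth_on U f \<Longrightarrow> open U \<Longrightarrow> smooth_on U (\<lambda>x. X (f x))"
proof -
  have "0 < 1 + \<epsilon> * (f x)\<^sup>2 / 2" for x using eps by (simp add: add_pos_nonneg)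
  moreover have "2 * sqrt (1 + sqrt (1 + \<epsilon> * (f x)\<^sup>2 / 2)) \<noteq> 0" for x
    using one_plus_sqrt_pos[of "f x"] by simp
  ultimately show "smooth_on U f \<Longrightarrow> open U \<Longrightarrow> smooth_on U (\<lambda>x. X (f x))"
    unfolding X_def using one_plus_sqrt_pos by (intro smooth_intros) auto
qed

lemma Q_square: "(Q x)\<^sup>2 / 2 = V2 \<epsilon> x"
proof -
  have "(Q x)\<^sup>2 = x\<^sup>2 * (8 * (1 + \<epsilon> * x\<^sup>2))"
    using one_plus_pos[of x] by (simp add: Q_def power_mult_distrib)
  then show ?thesis by (simp add: V2_def algebra_simps power2_eq_square power4_eq_xxxx)
qed

lemma X_Q: "X (Q x) = x"
proof -
  have "1 + \<epsilon> * (Q x)\<^sup>2 / 2 = 1 + \<epsilon> * V2 \<epsilon> x" using Q_square[of x] by simp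
  also have "\<dots> = (1 + 2 * \<epsilon> * x\<^sup>2)\<^sup>2"
    by (simp add: V2_def algebra_simps power2_eq_square power4_eq_xxxx)
  finally have "sqrt (1 + \<epsilon> * (Q x)\<^sup>2 / 2) = 1 + 2 * \<epsilon> * x\<^sup>2" using eps by (simp add: add_nonneg_nonneg)
  then have "X (Q x) = Q x / (2 * sqrt (2 * (1 + \<epsilon> * x\<^sup>2)))" by (simp add: X_def algebra_simps)
  moreover have "sqrt (8 * (1 + \<epsilon> * x\<^sup>2)) = 2 * sqrt (2 * (1 + \<epsilon> * x\<^sup>2))"
    using real_sqrt_mult[of 4 "2 * (1 + \<epsilon> * x\<^sup>2)"] by simp
  ultimately show ?thesis using one_plus_pos[of x] by (simp add: Q_def)
qed

lemma Q_X: "Q (X q) = q"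
proof -
  define s where "s = sqrt (1 + \<epsilon> * q\<^sup>2 / 2)"
  have s: "s\<^sup>2 = 1 + \<epsilon> * q\<^sup>2 / 2" "0 \<le> s" using eps by (simp_all add: s_def add_nonneg_nonneg)
  have "(X q)\<^sup>2 = q\<^sup>2 / (4 * (1 + s))"
    using s(2) by (simp add: X_def power_divide power_mult_distrib flip: s_def)
  then have "\<epsilon> * (X q)\<^sup>2 = (\<epsilon> * q\<^sup>2) / (4 * (1 + s))" by simp
  also have "\<epsilon> * q\<^sup>2 = 2 * ((s - 1) * (s + 1))" using s(1) by (simp add: algebra_simps power2_eq_square)
  also have "\<dots> / (4 * (1 + s)) = (s - 1) / 2" using s(2) by (simp add: field_simps)
  finally have "8 * (1 + \<epsilon> * (X q)\<^sup>2) = 2\<^sup>2 * (1 + s)" by simp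
  then have "sqrt (8 * (1 + \<epsilon> * (X q)\<^sup>2)) = 2 * sqrt (1 + s)"
    by (simp only: real_sqrt_mult real_sqrt_abs)
  then show ?thesis using s(2) by (simp add: Q_def) (simp add: X_def flip: s_def)
qed

text \<open>The complex coordinate \<open>\<zeta> = Q(x\<^sub>2) + i y\<^sub>2\<close> turns \<open>H\<^sub>2\<close> into \<open>|\<zeta>|\<^sup>2 / 2\<close>, so that the energy
  surface becomes \<open>|\<zeta>|\<^sup>2 + y\<^sub>1\<^sup>2 = R(x\<^sub>1)\<^sup>2\<close>, where \<open>R\<close> has no zero because \<open>E\<close> is above the
  saddle.  \<open>pt x \<zeta> m\<close> is the point over \<open>x\<close> with coordinates \<open>(\<zeta>, m)\<close> on the unit sphere.\<close>

definition pt :: "real \<Rightarrow> complex \<Rightarrow> real \<Rightarrow> R4" where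
  "pt x \<zeta> m = (x, X (R x * Re \<zeta>), R x * m, R x * Im \<zeta>)"

definition zeta :: "R4 \<Rightarrow> complex" where
  "zeta p = Complex (Q (fst (snd p))) (snd (snd (snd p)))"

abbreviation x1 :: "R4 \<Rightarrow> real" where "x1 p \<equiv> fst p"
abbreviation y1 :: "R4 \<Rightarrow> real" where "y1 p \<equiv> fst (snd (snd p))"

lemma energy_iff: "H p = E \<longleftrightarrow> (cmod (zeta p))\<^sup>2 + (y1 p)\<^sup>2 = R2 (x1 p)"
proof -
  obtain b c d e where p: "p = (b, c, d, e)" by (metis prod.exhaust)
  show ?thesis
    using Q_square[of c] unfolding p stark_H_def zeta_def R2_def by (auto simp: cmod_power2 field_simps)
qed

lemma pt_coords [simp]: "x1 (pt x \<zeta> m) = x" "y1 (pt x \<zeta> m) = R x * m" "zeta (pt x \<zeta> m) = R x *\<^sub>R \<zeta>"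
  by (auto simp: pt_def zeta_def Q_X complex_eq_iff)

lemma energy_pt: "(cmod \<zeta>)\<^sup>2 + m\<^sup>2 = 1 \<Longrightarrow> H (pt x \<zeta> m) = E"
  by (simp add: energy_iff power_mult_distrib R_square flip: distrib_left)

lemma pt_eqI:
  assumes "x1 p = x" "zeta p = R x *\<^sub>R \<zeta>" "y1 p = R x * m"
  shows "p = pt x \<zeta> m"
proof -
  obtain b c d e where p: "p = (b, c, d, e)" by (metis prod.exhaust)
  have "Q c = R x * Re \<zeta>" using assms(2) by (simp add: p zeta_def complex_eq_iff)
  then have "c = X (R x * Re \<zeta>)" using X_Q[of c] by simp
  then show ?thesis using assms by (simp add: p pt_def zeta_def complex_eq_iff)
qed

lemma pt_surj:
  assumes "H p = E"
  obtains \<zeta> m where "p = pt (x1 p) \<zeta> m" "(cmod \<zeta>)\<^sup>2 + m\<^sup>2 = 1"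
    "\<zeta> = zeta p /\<^sub>R R (x1 p)" "m = y1 p / R (x1 p)"
proof -
  let ?r = "R (x1 p)"
  have r: "?r > 0" "?r\<^sup>2 = R2 (x1 p)" "R2 (x1 p) > 0" using R_pos R_square R2_lower by auto
  have "(cmod (zeta p /\<^sub>R ?r))\<^sup>2 + (y1 p / ?r)\<^sup>2 = ((cmod (zeta p))\<^sup>2 + (y1 p)\<^sup>2) / ?r\<^sup>2"
    using r by (simp add: power_divide power_mult_distrib divide_inverse algebra_simps power_inverse)
  also have "\<dots> = 1" using assms r by (simp add: energy_iff)
  finally show thesis
    using that[of "zeta p /\<^sub>R ?r" "y1 p / ?r"] pt_eqI[of p "x1 p" "zeta p /\<^sub>R ?r" "y1 p / ?r"] r by simp
qed

lemma smooth_pt [smooth_intros]: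
  assumes "smooth_on U f" "smooth_on U \<zeta>" "smooth_on U m" "open U"
  shows "smooth_on U (\<lambda>q. pt (f q) (\<zeta> q) (m q))"
  unfolding pt_def by (intro smooth_intros assms)

lemma smooth_zeta [smooth_intros]: "open U \<Longrightarrow> smooth_on U zeta"
  unfolding zeta_def by (intro smooth_intros)

lemma smooth_x1 [smooth_intros]: "open U \<Longrightarrow> smooth_on U (fst :: R4 \<Rightarrow> real)"
  using smooth_on_fst[OF smooth_on_id] .

text \<open>Central projection of an open hemisphere of the fibre sphere (the one of the sign \<open>s\<close> of
  \<open>y\<^sub>1\<close>) to the plane.  Its inverse is the quotient of coordinates \<open>s \<zeta> / y\<^sub>1\<close>.\<close>

definition gno :: "real \<Rightarrow> real \<Rightarrow> complex \<Rightarrow> R4" where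
  "gno s x z = pt x (z /\<^sub>R sqrt (1 + (cmod z)\<^sup>2)) (s / sqrt (1 + (cmod z)\<^sup>2))"

definition gno_inv :: "real \<Rightarrow> R4 \<Rightarrow> complex" where
  "gno_inv s p = (s / y1 p) *\<^sub>R zeta p"

lemma one_plus_norm_pos: "0 < 1 + (cmod z)\<^sup>2" "0 < sqrt (1 + (cmod z)\<^sup>2)"
  by (simp_all add: add_pos_nonneg)

lemma smooth_gno [smooth_intros]:
  assumes "smooth_on U f" "smooth_on U z" "open U"
  shows "smooth_on U (\<lambda>q. gno s (f q) (z q))"
  unfolding gno_def using one_plus_norm_pos(2)
  by (intro smooth_intros assms) (auto simp: one_plus_norm_pos less_imp_neq[symmetric])

lemma open_y1: "open {p :: R4. y1 p \<noteq> 0}"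
  by (intro open_Collect_neq continuous_intros)

lemma smooth_gno_inv [smooth_intros]:
  assumes "open U" "U \<subseteq> {p. y1 p \<noteq> 0}"
  shows "smooth_on U (gno_inv s)"
  unfolding gno_inv_def using assms by (intro smooth_intros) auto

lemma gno_coords:
  assumes "s\<^sup>2 = 1"
  shows "H (gno s x z) = E" "x1 (gno s x z) = x" "0 < s * y1 (gno s x z)"
    "(y1 (gno s x z))\<^sup>2 = R2 x / (1 + (cmod z)\<^sup>2)" "gno_inv s (gno s x z) = z"
proof -
  note [simp] = one_plus_norm_pos[of z, THEN less_imp_neq, symmetric]
  show "H (gno s x z) = E"
    unfolding gno_def using assms one_plus_norm_pos[of z]
    by (intro energy_pt) (simp add: power_mult_distrib power_divide power_inverse add_divide_distrib[symmetric] field_simps)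
  show "x1 (gno s x z) = x" by (simp add: gno_def)
  have "s * y1 (gno s x z) = s\<^sup>2 * R x / sqrt (1 + (cmod z)\<^sup>2)" by (simp add: gno_def power2_eq_square)
  then show "0 < s * y1 (gno s x z)" using assms R_pos one_plus_norm_pos[of z] by simp
  show "(y1 (gno s x z))\<^sup>2 = R2 x / (1 + (cmod z)\<^sup>2)"
    using assms one_plus_norm_pos[of z] by (simp add: gno_def power_mult_distrib power_divide R_square)
  show "gno_inv s (gno s x z) = z"
    using assms one_plus_norm_pos[of z] R_pos[of x] by (auto simp: gno_inv_def gno_def divide_simps power2_eq_square)
qed

lemma gno_surj:
  assumes "s\<^sup>2 = 1" "H p = E" "0 < s * y1 p"
  shows "p = gno s (x1 p) (gno_inv s p)"
proof -
  have y: "y1 p \<noteq> 0" using assms(3) by auto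
  have "1 + (cmod (gno_inv s p))\<^sup>2 = ((cmod (zeta p))\<^sup>2 + (y1 p)\<^sup>2) / (y1 p)\<^sup>2"
    using assms(1) y by (simp add: gno_inv_def power_mult_distrib power_divide field_simps)
  also have "\<dots> = R2 (x1 p) / (s * y1 p)\<^sup>2"
    using assms(1,2) by (simp add: energy_iff power_mult_distrib)
  finally have q: "sqrt (1 + (cmod (gno_inv s p))\<^sup>2) = R (x1 p) / (s * y1 p)"
    using assms(3) by (simp add: R_def real_sqrt_divide)
  have "s * s = 1" using assms(1) by (simp add: power2_eq_square)
  then show ?thesis
    unfolding gno_def q using R_pos[of "x1 p"] y assms(3)
    by (intro pt_eqI) (auto simp: gno_inv_def)
qed

section \<open>Gradient lines and leaf coordinates\<close>

text \<open>The function \<open>s G(x\<^sub>1) / y\<^sub>1\<^sup>8\<close> is constant on the gradient lines of \<open>H\<^sub>1\<close> in the strip between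
  the saddles, where \<open>G' (x) V\<^sub>1'(x) = 8 G(x)\<close>.  The functions \<open>u\<close> and \<open>v = u\<^sup>-\<^sup>2\<close> express the same
  invariant in terms of \<open>x\<^sub>1\<close> and the position on the fibre sphere.\<close>

definition G :: "real \<Rightarrow> real" where "G x = x / sqrt (1 - 2 * \<epsilon> * x\<^sup>2)"
definition Ginv :: "real \<Rightarrow> real" where "Ginv c = c / sqrt (1 + 2 * \<epsilon> * c\<^sup>2)"
definition u :: "real \<Rightarrow> real" where "u x = G x / R2 x ^ 4"
definition v :: "real \<Rightarrow> real" where "v x = (1 / x\<^sup>2 - 2 * \<epsilon>) * R2 x ^ 8"

lemma strip_pos: "\<bar>x\<bar> < a \<Longrightarrow> 0 < 1 - 2 * \<epsilon> * x\<^sup>2"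
  by (simp add: abs_less_a_iff)

lemma Ginv_bound: "\<bar>Ginv c\<bar> < a"
proof -
  have p: "0 < 1 + 2 * \<epsilon> * c\<^sup>2" using eps by (simp add: add_pos_nonneg)
  have "2 * \<epsilon> * (Ginv c)\<^sup>2 = 2 * \<epsilon> * c\<^sup>2 / (1 + 2 * \<epsilon> * c\<^sup>2)"
    using p by (simp add: Ginv_def power_divide)
  also have "\<dots> < 1" using p by (simp add: divide_simps)
  finally show ?thesis by (simp add: abs_less_a_iff)
qed

lemma G_Ginv: "G (Ginv c) = c"
proof -
  have p: "0 < 1 + 2 * \<epsilon> * c\<^sup>2" using eps by (simp add: add_pos_nonneg)
  have "1 - 2 * \<epsilon> * (Ginv c)\<^sup>2 = 1 / (1 + 2 * \<epsilon> * c\<^sup>2)"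
    using p by (simp add: Ginv_def power_divide divide_simps)
  then show ?thesis using p by (simp add: G_def real_sqrt_divide) (simp add: Ginv_def)
qed

lemma Ginv_G: "\<bar>x\<bar> < a \<Longrightarrow> Ginv (G x) = x"
proof -
  assume "\<bar>x\<bar> < a"
  then have p: "0 < 1 - 2 * \<epsilon> * x\<^sup>2" by (rule strip_pos)
  have "1 + 2 * \<epsilon> * (G x)\<^sup>2 = 1 / (1 - 2 * \<epsilon> * x\<^sup>2)"
    using p by (simp add: G_def power_divide divide_simps)
  then show ?thesis using p by (simp add: Ginv_def real_sqrt_divide) (simp add: G_def)
qed

lemma G_odd: "G (- x) = - G x" by (simp add: G_def)

lemma G_pos_iff: "\<bar>x\<bar> < a \<Longrightarrow> 0 < G x \<longleftrightarrow> 0 < x"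
  using strip_pos[of x] by (simp add: G_def zero_less_divide_iff)

lemma G_square: "\<bar>x\<bar> < a \<Longrightarrow> (G x)\<^sup>2 * (1 - 2 * \<epsilon> * x\<^sup>2) = x\<^sup>2"
  using strip_pos[of x] by (simp add: G_def power_divide)

lemma G_derivative:
  assumes "\<bar>x\<bar> < a"
  shows "(G has_real_derivative 1 / sqrt (1 - 2 * \<epsilon> * x\<^sup>2) ^ 3) (at x)"
proof -
  define r where "r = sqrt (1 - 2 * \<epsilon> * x\<^sup>2)"
  have r: "0 < r" "r\<^sup>2 = 1 - 2 * \<epsilon> * x\<^sup>2" "0 < 1 - 2 * \<epsilon> * x\<^sup>2"
    using strip_pos[OF assms] by (auto simp: r_def)
  have "((\<lambda>x. sqrt (1 - 2 * \<epsilon> * x\<^sup>2)) has_real_derivative - (2 * \<epsilon> * x) / r) (at x)"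
    using r by (auto intro!: derivative_eq_intros simp: r_def field_simps)
  then have "(G has_real_derivative (1 * r - x * (- (2 * \<epsilon> * x) / r)) / (r * r)) (at x)"
    using DERIV_divide[OF DERIV_ident, of "\<lambda>x. sqrt (1 - 2 * \<epsilon> * x\<^sup>2)" "- (2 * \<epsilon> * x) / r" x UNIV] r(1)
    unfolding G_def[abs_def] r_def by simp
  moreover have "(1 * r - x * (- (2 * \<epsilon> * x) / r)) / (r * r) = (r\<^sup>2 + 2 * \<epsilon> * x\<^sup>2) / r ^ 3"
    using r(1) by (simp add: field_simps power2_eq_square power3_eq_cube)
  ultimately show ?thesis using r by (simp flip: r_def)
qed

lemma smooth_G [smooth_intros]:
  assumes "smooth_on U f" "open U" "\<And>q. q \<in> U \<Longrightarrow> \<bar>f q\<bar> < a"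
  shows "smooth_on U (\<lambda>q. G (f q))"
  unfolding G_def using strip_pos[OF assms(3)] by (intro smooth_intros assms) fastforce+

definition u' :: "real \<Rightarrow> real" where
  "u' x = 1 / sqrt (1 - 2 * \<epsilon> * x\<^sup>2) ^ 3 / R2 x ^ 4 - G x * (4 * (32 * \<epsilon> * x * (x\<^sup>2 - a\<^sup>2))) / R2 x ^ 5"

text \<open>On the strip \<open>G\<close> is increasing and \<open>R\<^sup>2\<close> decreases with \<open>|x|\<close>, so \<open>|u|\<close> is a product of
  two increasing functions of \<open>|x|\<close>.\<close>

lemma u_derivative:
  assumes "\<bar>x\<bar> < a" shows "(u has_real_derivative u' x) (at x)" "0 < u' x"
proof -
  have R2: "R2 x \<noteq> 0" "0 < R2 x" using R2_lower[of x] by auto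
  have "((\<lambda>x. R2 x ^ 4) has_real_derivative 4 * R2 x ^ 3 * (32 * \<epsilon> * x * (x\<^sup>2 - a\<^sup>2))) (at x)"
    using DERIV_power[OF R2_derivative[of x], of 4] by (simp add: algebra_simps)
  note DERIV_divide[OF G_derivative[OF assms] this]
  then have "(u has_real_derivative (1 / sqrt (1 - 2 * \<epsilon> * x\<^sup>2) ^ 3 * R2 x ^ 4 -
      G x * (4 * R2 x ^ 3 * (32 * \<epsilon> * x * (x\<^sup>2 - a\<^sup>2)))) / (R2 x ^ 4 * R2 x ^ 4)) (at x)"
    unfolding u_def[abs_def] using R2 by simp
  moreover have "(A * r ^ 4 - q * (4 * r ^ 3 * d)) / (r ^ 4 * r ^ 4) = A / r ^ 4 - q * (4 * d) / r ^ 5"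
    if "r \<noteq> 0" for A q d r :: real
    using that by (simp add: field_simps eval_nat_numeral)
  ultimately show "(u has_real_derivative u' x) (at x)" using R2(1) unfolding u'_def by metis
  have x2: "x\<^sup>2 - a\<^sup>2 \<le> 0" using assms a_pos abs_le_square_iff[of x a] by simp
  have "0 \<le> G x * x" using strip_pos[OF assms] by (simp add: G_def)
  then have "G x * x * (x\<^sup>2 - a\<^sup>2) \<le> 0" using x2 by (rule mult_nonneg_nonpos)
  then have "(128 * \<epsilon>) * (G x * x * (x\<^sup>2 - a\<^sup>2)) \<le> 0" using eps by (intro mult_nonneg_nonpos[of "128 * \<epsilon>"]) simp
  then have "G x * (4 * (32 * \<epsilon> * x * (x\<^sup>2 - a\<^sup>2))) \<le> 0" by (simp add: algebra_simps)
  then have "G x * (4 * (32 * \<epsilon> * x * (x\<^sup>2 - a\<^sup>2))) / R2 x ^ 5 \<le> 0"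
    using R2(2) by (simp add: divide_nonpos_pos)
  moreover have "0 < 1 / sqrt (1 - 2 * \<epsilon> * x\<^sup>2) ^ 3 / R2 x ^ 4"
    using strip_pos[OF assms] R2(2) by simp
  ultimately show "0 < u' x" unfolding u'_def by linarith
qed

lemma u_strict_mono:
  assumes "\<bar>x\<bar> < a" "\<bar>y\<bar> < a" "x < y" shows "u x < u y"
proof (rule DERIV_pos_imp_increasing[OF assms(3)])
  fix r assume "x \<le> r" "r \<le> y"
  then have "\<bar>r\<bar> < a" using assms by linarith
  then show "\<exists>d. (u has_real_derivative d) (at r) \<and> 0 < d" using u_derivative by blast
qed

lemma u_inj: "inj_on u {-a<..<a}"
proof (rule inj_onI)
  fix x y assume "x \<in> {-a<..<a}" "y \<in> {-a<..<a}" "u x = u y"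
  then show "x = y" using u_strict_mono[of x y] u_strict_mono[of y x] by (cases x y rule: linorder_cases) (simp_all add: abs_less_iff)
qed

lemma u_surj: "\<exists>x. \<bar>x\<bar> < a \<and> u x = c"
proof -
  define F where "F = (\<lambda>x. x - Ginv (c * R2 x ^ 4))"
  have p: "1 + 2 * \<epsilon> * c\<^sup>2 \<noteq> 0" for c
    using eps by (metis add_pos_nonneg less_irrefl mult_nonneg_nonneg zero_le_power2 zero_less_one less_imp_le zero_le_numeral)
  have "continuous_on {-a..a} F"
    unfolding F_def Ginv_def R2_def V1_def using p by (intro continuous_intros) auto
  moreover have "F (-a) \<le> 0" "0 \<le> F a"
    using Ginv_bound[of "c * R2 (-a) ^ 4"] Ginv_bound[of "c * R2 a ^ 4"] by (auto simp: F_def)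
  ultimately obtain x where "F x = 0" using IVT'[of F "-a" 0 a] a_pos by auto
  then have x: "x = Ginv (c * R2 x ^ 4)" by (simp add: F_def)
  then have "\<bar>x\<bar> < a" using Ginv_bound by metis
  moreover have "G x = c * R2 x ^ 4" using x G_Ginv by metis
  then have "u x = c" using R2_lower[of x] by (simp add: u_def)
  ultimately show ?thesis by blast
qed

definition u_inv :: "real \<Rightarrow> real" where "u_inv c = (THE x. \<bar>x\<bar> < a \<and> u x = c)"

lemma u_inv: "\<bar>u_inv c\<bar> < a" "u (u_inv c) = c"
proof -
  have "\<exists>!x. \<bar>x\<bar> < a \<and> u x = c"
    using u_surj[of c] u_inj by (auto simp: inj_on_def abs_less_iff)
  from theI'[OF this] show "\<bar>u_inv c\<bar> < a" "u (u_inv c) = c" by (auto simp: u_inv_def)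
qed

lemma u_inv_u: "\<bar>x\<bar> < a \<Longrightarrow> u_inv (u x) = x"
  using u_inv[of "u x"] u_inj by (auto simp: inj_on_def abs_less_iff)

lemma smooth_u_inv [smooth_intros]:
  fixes f :: "'x::real_normed_vector \<Rightarrow> real"
  assumes "smooth_on U f" "open U" shows "smooth_on U (\<lambda>q. u_inv (f q))"
proof -
  have "smooth_on UNIV u_inv"
  proof (rule smooth_on_inverse_function[where u=u and u'=u' and V="{-a<..<a}"])
    have "R2 x \<noteq> 0" for x using R2_lower[of x] by simp
    moreover have "0 < 1 - 2 * \<epsilon> * x\<^sup>2" if "x \<in> {-a<..<a}" for x
      using strip_pos[of x] that by auto
    ultimately show "smooth_on {-a<..<a} u'"
      unfolding u'_def by (intro smooth_intros) (auto simp: less_imp_neq[symmetric])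
    show "u' x \<noteq> 0" if "x \<in> {-a<..<a}" for x
      using u_derivative(2)[of x] that by (auto simp: abs_less_iff)
    show "u_inv c \<in> {-a<..<a}" for c using u_inv(1)[of c] by (simp only: abs_less_iff) auto
  qed (use u_inv u_inv_u u_derivative in \<open>auto simp: abs_less_iff\<close>)
  from smooth_on_compose[OF this assms open_UNIV] show ?thesis by simp
qed

definition v' :: "real \<Rightarrow> real" where
  "v' x = - 2 / x ^ 3 * R2 x ^ 8 + (1 / x\<^sup>2 - 2 * \<epsilon>) * (8 * R2 x ^ 7 * (32 * \<epsilon> * x * (x\<^sup>2 - a\<^sup>2)))"

text \<open>The two factors never compete: \<open>1 / x\<^sup>2 - 2 \<epsilon>\<close> is decreasing, and it is positive where \<open>R\<^sup>2\<close>
  decreases (\<open>x < a\<close>) and negative where \<open>R\<^sup>2\<close> increases (\<open>x > a\<close>).  So \<open>v\<close> is monotone beyond the saddle,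
  too.\<close>

lemma v_derivative:
  assumes "0 < x" shows "(v has_real_derivative v' x) (at x)" "v' x < 0"
proof -
  have "((\<lambda>x. R2 x ^ 8) has_real_derivative 8 * R2 x ^ 7 * (32 * \<epsilon> * x * (x\<^sup>2 - a\<^sup>2))) (at x)"
    using DERIV_power[OF R2_derivative[of x], of 8] by (simp add: algebra_simps)
  moreover have "((\<lambda>x. 1 / x\<^sup>2 - 2 * \<epsilon>) has_real_derivative - 2 / x ^ 3) (at x)"
    using assms by (auto intro!: derivative_eq_intros simp: field_simps eval_nat_numeral)
  ultimately show "(v has_real_derivative v' x) (at x)"
    unfolding v_def[abs_def] v'_def using DERIV_mult[of "\<lambda>x. 1 / x\<^sup>2 - 2 * \<epsilon>" "- 2 / x ^ 3" x UNIV "\<lambda>x. R2 x ^ 8"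
        "8 * R2 x ^ 7 * (32 * \<epsilon> * x * (x\<^sup>2 - a\<^sup>2))"]
    by (simp only: mult.commute[of "8 * R2 x ^ 7 * (32 * \<epsilon> * x * (x\<^sup>2 - a\<^sup>2))"])
  have "0 < R2 x" using R2_lower by simp
  then have 1: "0 < 2 / x ^ 3 * R2 x ^ 8" using assms by simp
  have "(1 / x\<^sup>2 - 2 * \<epsilon>) * (x\<^sup>2 - a\<^sup>2) = - ((1 - 2 * \<epsilon> * x\<^sup>2)\<^sup>2 / (2 * \<epsilon> * x\<^sup>2))"
    unfolding a_square using assms eps by (simp add: field_simps power2_eq_square)
  also have "\<dots> \<le> 0" using eps by simp
  finally have "(1 / x\<^sup>2 - 2 * \<epsilon>) * (x\<^sup>2 - a\<^sup>2) \<le> 0" .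
  then have "(256 * \<epsilon> * R2 x ^ 7 * x) * ((1 / x\<^sup>2 - 2 * \<epsilon>) * (x\<^sup>2 - a\<^sup>2)) \<le> 0"
    using \<open>0 < R2 x\<close> assms eps by (intro mult_nonneg_nonpos[of "256 * \<epsilon> * R2 x ^ 7 * x"]) simp_all
  moreover have "(256 * e * r * y) * (k * d) = k * (8 * r * (32 * e * y * d))" for e r y k d :: real
    by simp
  ultimately have "(1 / x\<^sup>2 - 2 * \<epsilon>) * (8 * R2 x ^ 7 * (32 * \<epsilon> * x * (x\<^sup>2 - a\<^sup>2))) \<le> 0"
    by metis
  moreover have "- 2 / x ^ 3 * R2 x ^ 8 < 0" using 1 by simp
  ultimately show "v' x < 0" unfolding v'_def by linarith
qed

lemma v_strict_antimono:
  assumes "0 < x" "x < y" shows "v y < v x"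
  using DERIV_neg_imp_decreasing[OF assms(2), of v] v_derivative assms by (meson less_le_trans)

lemma v_inj: "0 < x \<Longrightarrow> 0 < y \<Longrightarrow> v x = v y \<Longrightarrow> x = y"
  using v_strict_antimono[of x y] v_strict_antimono[of y x] by (cases x y rule: linorder_cases) auto

lemma v_surj: "\<exists>x>0. v x = c"
proof -
  define \<rho> where "\<rho> = 2 * (E - 1 / \<epsilon>)"
  have \<rho>: "0 < \<rho>" "\<rho> \<le> R2 x" for x using energy R2_lower(1) by (auto simp: \<rho>_def)
  \<comment> \<open>\<open>R\<^sup>2 \<ge> \<rho>\<close> turns a large first factor into \<open>v b \<ge> c\<close>.\<close>
  define b where "b = 1 / sqrt (2 * \<epsilon> + (\<bar>c\<bar> + 1) / \<rho> ^ 8)"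
  have bp: "0 < 2 * \<epsilon> + (\<bar>c\<bar> + 1) / \<rho> ^ 8" using eps \<rho>(1) by (intro add_pos_nonneg) auto
  then have b: "0 < b" "1 / b\<^sup>2 - 2 * \<epsilon> = (\<bar>c\<bar> + 1) / \<rho> ^ 8" by (auto simp: b_def power_divide)
  have "c \<le> (\<bar>c\<bar> + 1) / \<rho> ^ 8 * \<rho> ^ 8" using \<rho>(1) by simp
  also have "\<dots> \<le> (\<bar>c\<bar> + 1) / \<rho> ^ 8 * R2 b ^ 8"
    using \<rho> by (intro mult_left_mono power_mono) (auto intro: less_imp_le)
  finally have vb: "c \<le> v b" by (simp add: v_def b(2))
  \<comment> \<open>At \<open>d\<close> the first factor is at most \<open>- \<epsilon>\<close> and \<open>R\<^sup>2 \<ge> K \<ge> 1\<close>, whence \<open>v d \<le> - \<epsilon> K \<le> c\<close>.\<close>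
  define K where "K = (\<bar>c\<bar> + 1) / \<epsilon> + 1"
  define w where "w = 1 / (2 * \<epsilon>) + 1 + K / (8 * \<epsilon>)"
  define d where "d = sqrt (1 / (2 * \<epsilon>) + w)"
  have K: "1 \<le> K" "\<bar>c\<bar> \<le> \<epsilon> * K" using eps by (auto simp: K_def field_simps)
  have w: "1 \<le> w" "K \<le> 8 * \<epsilon> * w" "1 / (2 * \<epsilon>) \<le> w"
    using eps K by (auto simp: w_def field_simps)
  have d: "0 < d" "d\<^sup>2 = 1 / (2 * \<epsilon>) + w" using eps w by (auto simp: d_def add_pos_pos)
  have "8 * \<epsilon> * (w * 1) \<le> 8 * \<epsilon> * (w * w)" using eps w by (intro mult_left_mono) auto
  then have "K \<le> R2 d" unfolding R2_eq d(2) a_square using w(2) energy by (simp add: power2_eq_square)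
  moreover have "R2 d ^ 1 \<le> R2 d ^ 8" using K(1) calculation by (intro power_increasing) auto
  ultimately have "K \<le> R2 d ^ 8" by simp
  then have "\<bar>c\<bar> \<le> \<epsilon> * R2 d ^ 8" using K(2) eps by (meson mult_left_mono less_imp_le order_trans)
  moreover have "1 / d\<^sup>2 \<le> \<epsilon>"
  proof -
    have "1 / \<epsilon> \<le> d\<^sup>2" unfolding d(2) using w(3) eps by (simp add: field_simps)
    then show ?thesis using eps d(1) by (simp add: field_simps)
  qed
  then have "v d \<le> - \<epsilon> * R2 d ^ 8"
    unfolding v_def using R2_lower(2)[of d] by (intro mult_right_mono) auto
  ultimately have vd: "v d \<le> c" by linarith
  have "b \<le> d"
  proof (rule ccontr)
    assume "\<not> b \<le> d"
    then have "v b < v d" using v_strict_antimono[of d b] d(1) by simp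
    then show False using vb vd by simp
  qed
  moreover have "continuous_on {b..d} v"
    using DERIV_isCont[OF v_derivative(1)] b(1) by (intro continuous_at_imp_continuous_on) auto
  ultimately obtain x where "b \<le> x" "v x = c" using IVT2'[of v d c b] vb vd by auto
  then show ?thesis using b(1) by (intro exI[of _ x]) simp
qed

definition v_inv :: "real \<Rightarrow> real" where "v_inv c = (THE x. 0 < x \<and> v x = c)"

lemma v_inv: "0 < v_inv c" "v (v_inv c) = c"
proof -
  have "\<exists>!x. 0 < x \<and> v x = c" using v_surj[of c] v_inj by blast
  from theI'[OF this] show "0 < v_inv c" "v (v_inv c) = c" by (auto simp: v_inv_def)
qed

lemma v_inv_v: "0 < x \<Longrightarrow> v_inv (v x) = x"
  using v_inv[of "v x"] v_inj by blast

lemma smooth_v_inv [smooth_intros]: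
  fixes f :: "'x::real_normed_vector \<Rightarrow> real"
  assumes "smooth_on U f" "open U" shows "smooth_on U (\<lambda>q. v_inv (f q))"
proof -
  have "smooth_on UNIV v_inv"
  proof (rule smooth_on_inverse_function[where u=v and u'=v' and V="{0<..}"])
    show "smooth_on {0<..} v'" unfolding v'_def by (intro smooth_intros) auto
    show "v' x \<noteq> 0" if "x \<in> {0<..}" for x using v_derivative(2)[of x] that by auto
  qed (use v_inv v_inv_v v_derivative in auto)
  from smooth_on_compose[OF this assms open_UNIV] show ?thesis by simp
qed

section \<open>The leaves and their charts\<close>

text \<open>Signs \<open>s\<close> enter through \<open>s\<^sup>2 = 1\<close>: \<open>leafU s\<^sub>1 s\<^sub>2\<close> is the hemisphere over the saddle
  \<open>s\<^sub>1 a\<close> on which \<open>y\<^sub>1\<close> has the sign \<open>s\<^sub>2\<close>, and \<open>leafD s C\<close> is the plane over the gradient line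
  \<open>s G(x\<^sub>1) = C y\<^sub>1\<^sup>8\<close> on which \<open>y\<^sub>1\<close> has the sign \<open>s\<close>.\<close>

definition strip :: "R4 set" where "strip = {p. H p = E \<and> \<bar>x1 p\<bar> \<le> a}"
definition bind_orbits :: "R4 set" where
  "bind_orbits = {p. H p = E \<and> y1 p = 0 \<and> x1 p \<in> {0, a, - a}}"
definition M :: "R4 set" where "M = strip - bind_orbits"

definition leafU :: "real \<Rightarrow> real \<Rightarrow> R4 set" where
  "leafU s1 s2 = {p. H p = E \<and> x1 p = s1 * a \<and> 0 < s2 * y1 p}"
definition leafV :: "real \<Rightarrow> R4 set" where
  "leafV s = {p. H p = E \<and> y1 p = 0 \<and> 0 < s * x1 p \<and> s * x1 p < a}"
definition leafD :: "real \<Rightarrow> real \<Rightarrow> R4 set" where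
  "leafD s C = {p. H p = E \<and> \<bar>x1 p\<bar> < a \<and> 0 < s * y1 p \<and> s * G (x1 p) = C * y1 p ^ 8}"

definition leaves :: "R4 set set" where
  "leaves = {leafU s1 s2 | s1 s2. s1\<^sup>2 = 1 \<and> s2\<^sup>2 = 1} \<union> {leafV s | s. s\<^sup>2 = 1} \<union>
     {leafD s C | s C. s\<^sup>2 = 1}"

lemma sign_cases: "(s::real)\<^sup>2 = 1 \<Longrightarrow> s = 1 \<or> s = -1"
  by (simp add: power2_eq_1_iff)

lemma sign_square: "(s::real)\<^sup>2 = 1 \<Longrightarrow> s * s = 1" "(s::real)\<^sup>2 = 1 \<Longrightarrow> s * (s * x) = x"
  by (auto simp: power2_eq_square simp flip: mult.assoc)

lemma gno_y1_power8:
  assumes "s\<^sup>2 = 1" shows "y1 (gno s x z) ^ 8 = R2 x ^ 4 / (1 + (cmod z)\<^sup>2) ^ 4"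
proof -
  have "y1 (gno s x z) ^ 8 = ((y1 (gno s x z))\<^sup>2) ^ 4" by (simp flip: power_mult)
  then show ?thesis unfolding gno_coords(4)[OF assms] by (simp add: power_divide)
qed

lemma gno_in_leafD_iff:
  assumes "s\<^sup>2 = 1" "\<bar>x\<bar> < a"
  shows "gno s x z \<in> leafD s C \<longleftrightarrow> u x = s * C / (1 + (cmod z)\<^sup>2) ^ 4"
proof -
  have pos: "0 < R2 x ^ 4" "0 < (1 + (cmod z)\<^sup>2) ^ 4"
    using R2_lower(2)[of x] one_plus_norm_pos[of z] by auto
  have "gno s x z \<in> leafD s C \<longleftrightarrow> s * G x = C * (R2 x ^ 4 / (1 + (cmod z)\<^sup>2) ^ 4)"
    using assms by (simp add: leafD_def gno_coords gno_y1_power8)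
  also have "\<dots> \<longleftrightarrow> G x = s * C * (R2 x ^ 4 / (1 + (cmod z)\<^sup>2) ^ 4)"
    using sign_cases[OF assms(1)] by auto
  also have "\<dots> \<longleftrightarrow> u x = s * C / (1 + (cmod z)\<^sup>2) ^ 4"
    unfolding u_def using pos by (simp add: divide_simps mult_ac)
  finally show ?thesis .
qed

lemma leafD_eq_range:
  assumes "s\<^sup>2 = 1"
  shows "leafD s C = range (\<lambda>z. gno s (u_inv (s * C / (1 + (cmod z)\<^sup>2) ^ 4)) z)"
proof
  show "range (\<lambda>z. gno s (u_inv (s * C / (1 + (cmod z)\<^sup>2) ^ 4)) z) \<subseteq> leafD s C"
    using assms u_inv by (auto simp: gno_in_leafD_iff)
  show "leafD s C \<subseteq> range (\<lambda>z. gno s (u_inv (s * C / (1 + (cmod z)\<^sup>2) ^ 4)) z)"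
  proof
    fix p assume p: "p \<in> leafD s C"
    then have e: "p = gno s (x1 p) (gno_inv s p)" and x: "\<bar>x1 p\<bar> < a"
      using gno_surj[OF assms] by (auto simp: leafD_def)
    then have "u (x1 p) = s * C / (1 + (cmod (gno_inv s p))\<^sup>2) ^ 4"
      using gno_in_leafD_iff[OF assms x] p by metis
    then have "x1 p = u_inv (s * C / (1 + (cmod (gno_inv s p))\<^sup>2) ^ 4)" using u_inv_u[OF x] by simp
    then have "p = gno s (u_inv (s * C / (1 + (cmod (gno_inv s p))\<^sup>2) ^ 4)) (gno_inv s p)"
      using e by simp
    then show "p \<in> range (\<lambda>z. gno s (u_inv (s * C / (1 + (cmod z)\<^sup>2) ^ 4)) z)" by (rule range_eqI)
  qed
qed

lemma leafU_eq_range: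
  assumes "s2\<^sup>2 = 1" shows "leafU s1 s2 = range (\<lambda>z. gno s2 (s1 * a) z)"
proof
  show "range (\<lambda>z. gno s2 (s1 * a) z) \<subseteq> leafU s1 s2"
    using gno_coords[OF assms] by (auto simp: leafU_def)
  show "leafU s1 s2 \<subseteq> range (\<lambda>z. gno s2 (s1 * a) z)"
  proof
    fix p assume "p \<in> leafU s1 s2"
    then have "p = gno s2 (s1 * a) (gno_inv s2 p)"
      using gno_surj[OF assms, of p] by (simp add: leafU_def)
    then show "p \<in> range (\<lambda>z. gno s2 (s1 * a) z)" by (rule range_eqI)
  qed
qed

lemma gno_inv_differentiable: "y1 p \<noteq> 0 \<Longrightarrow> gno_inv s differentiable (at p)"
  by (rule smooth_on_imp_differentiable[OF smooth_gno_inv[OF open_y1 order_refl]]) simp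

lemma gno_y1_nonzero: "s\<^sup>2 = 1 \<Longrightarrow> y1 (gno s x z) \<noteq> 0"
  using gno_coords(3)[of s x z] by auto

lemma smooth_embedding_gno:
  assumes "s\<^sup>2 = 1" "smooth_on UNIV \<xi>"
  shows "smooth_embedding UNIV (\<lambda>z. gno s (\<xi> z) z)"
  by (rule smooth_embeddingI[where g="gno_inv s"])
    (auto intro!: smooth_intros assms gno_inv_differentiable simp: gno_coords gno_y1_nonzero assms(1))

lemma smooth_fibre_factor: "open U \<Longrightarrow> smooth_on U z \<Longrightarrow> smooth_on U (\<lambda>q. c / (1 + (cmod (z q))\<^sup>2) ^ n)"
  using one_plus_norm_pos(1) by (intro smooth_intros) (auto simp: less_imp_neq[symmetric])

lemma proper_plane_leafU:
  assumes "s1\<^sup>2 = 1" "s2\<^sup>2 = 1" shows "proper_plane M (leafU s1 s2)"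
  unfolding proper_plane_def
proof (intro conjI exI)
  show "smooth_embedding UNIV (\<lambda>z. gno s2 (s1 * a) z)"
    by (intro smooth_embedding_gno assms smooth_on_const)
  show "leafU s1 s2 = range (\<lambda>z. gno s2 (s1 * a) z)" by (rule leafU_eq_range[OF assms(2)])
  have "closed {p :: R4. x1 p = s1 * a \<and> 0 \<le> s2 * y1 p}"
    by (intro closed_Collect_conj closed_Collect_eq closed_Collect_le continuous_intros)
  moreover have "leafU s1 s2 = M \<inter> {p. x1 p = s1 * a \<and> 0 \<le> s2 * y1 p}"
    using sign_cases[OF assms(1)] sign_cases[OF assms(2)] a_pos
    by (auto simp: leafU_def M_def strip_def bind_orbits_def)
  ultimately show "closedin (top_of_set M) (leafU s1 s2)" by (auto simp: closedin_closed)
qed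

text \<open>\<open>G\<close> has poles at the saddles.  The squared equation has no denominators, so it defines a closed
  set; the points of \<open>S\<^sub>E\<close> that it adds to the leaf lie on the binding orbits.\<close>

lemma leafD_closed_in_M:
  assumes "s\<^sup>2 = 1"
  shows "leafD s C = M \<inter> {p. 0 \<le> s * y1 p \<and> 0 \<le> s * C * x1 p \<and>
     (x1 p)\<^sup>2 = C\<^sup>2 * y1 p ^ 16 * (1 - 2 * \<epsilon> * (x1 p)\<^sup>2)}" (is "_ = M \<inter> ?T")
proof
  show "leafD s C \<subseteq> M \<inter> ?T"
  proof
    fix p assume p: "p \<in> leafD s C"
    then have x: "\<bar>x1 p\<bar> < a" and y: "0 < s * y1 p" and e: "s * G (x1 p) = C * y1 p ^ 8"
      by (auto simp: leafD_def)
    have "(G (x1 p))\<^sup>2 = (s * G (x1 p))\<^sup>2" using assms by (simp add: power_mult_distrib)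
    also have "\<dots> = C\<^sup>2 * y1 p ^ 16" unfolding e by (simp add: power_mult_distrib flip: power_mult)
    finally have 1: "(x1 p)\<^sup>2 = C\<^sup>2 * y1 p ^ 16 * (1 - 2 * \<epsilon> * (x1 p)\<^sup>2)"
      using G_square[OF x] by simp
    have "s * C * x1 p = s * C * G (x1 p) * sqrt (1 - 2 * \<epsilon> * (x1 p)\<^sup>2)"
      using strip_pos[OF x] by (simp add: G_def)
    also have "s * C * G (x1 p) = C\<^sup>2 * y1 p ^ 8"
      using e by (simp add: power2_eq_square mult_ac)
    finally have "0 \<le> s * C * x1 p" using strip_pos[OF x] by simp
    moreover have "p \<in> M" using p x y by (auto simp: M_def strip_def bind_orbits_def leafD_def)
    ultimately show "p \<in> M \<inter> ?T" using 1 y by auto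
  qed
  show "M \<inter> ?T \<subseteq> leafD s C"
  proof
    fix p assume p: "p \<in> M \<inter> ?T"
    then have e: "(x1 p)\<^sup>2 = C\<^sup>2 * y1 p ^ 16 * (1 - 2 * \<epsilon> * (x1 p)\<^sup>2)"
      and H: "H p = E" and xa: "\<bar>x1 p\<bar> \<le> a" and sg: "0 \<le> s * y1 p" "0 \<le> s * C * x1 p"
      by (auto simp: M_def strip_def)
    have y: "y1 p \<noteq> 0"
    proof
      assume "y1 p = 0"
      then have "x1 p = 0" using e by simp
      then show False using p \<open>y1 p = 0\<close> by (auto simp: M_def bind_orbits_def strip_def)
    qed
    have x: "\<bar>x1 p\<bar> < a"
    proof (rule ccontr)
      assume "\<not> \<bar>x1 p\<bar> < a"
      then have "\<bar>x1 p\<bar> = a" using xa by simp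
      then have "(x1 p)\<^sup>2 = a\<^sup>2" by (metis power2_abs)
      then have "1 - 2 * \<epsilon> * (x1 p)\<^sup>2 = 0" using eps by (simp add: a_square)
      then have "x1 p = 0" using e by simp
      then show False using \<open>\<bar>x1 p\<bar> = a\<close> a_pos by simp
    qed
    let ?r = "1 - 2 * \<epsilon> * (x1 p)\<^sup>2"
    have r: "0 < ?r" using strip_pos[OF x] .
    have "(G (x1 p))\<^sup>2 * ?r = (C\<^sup>2 * y1 p ^ 16) * ?r" using G_square[OF x] e by simp
    then have "(G (x1 p))\<^sup>2 = C\<^sup>2 * y1 p ^ 16" using r by simp
    then have "(s * G (x1 p))\<^sup>2 = (C * y1 p ^ 8)\<^sup>2"
      using assms by (simp add: power_mult_distrib flip: power_mult)
    then have "s * G (x1 p) = C * y1 p ^ 8 \<or> s * G (x1 p) = - (C * y1 p ^ 8)"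
      by (simp add: power2_eq_iff)
    then have "s * G (x1 p) = C * y1 p ^ 8"
    proof
      assume n: "s * G (x1 p) = - (C * y1 p ^ 8)"
      have "s * C * G (x1 p) = s * C * x1 p / sqrt ?r" by (simp add: G_def)
      then have "0 \<le> s * C * G (x1 p)" using sg(2) r by simp
      also have "s * C * G (x1 p) = C * (s * G (x1 p))" by simp
      also have "\<dots> = - (C\<^sup>2 * y1 p ^ 8)" unfolding n by (simp add: power2_eq_square)
      finally have "C\<^sup>2 * y1 p ^ 8 \<le> 0" by simp
      moreover have "0 < y1 p ^ 8" using y by simp
      ultimately have "C = 0" by (metis mult_le_0_iff not_less power2_eq_square zero_le_square linorder_not_le zero_less_power2 less_le_not_le)
      then show ?thesis using n by simp
    qed
    moreover have "0 < s * y1 p" using sg(1) y sign_cases[OF assms] by auto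
    ultimately show "p \<in> leafD s C" using H x by (simp add: leafD_def)
  qed
qed

lemma proper_plane_leafD:
  assumes "s\<^sup>2 = 1" shows "proper_plane M (leafD s C)"
  unfolding proper_plane_def
proof (intro conjI exI)
  show "smooth_embedding UNIV (\<lambda>z. gno s (u_inv (s * C / (1 + (cmod z)\<^sup>2) ^ 4)) z)"
    by (intro smooth_embedding_gno assms smooth_u_inv smooth_fibre_factor smooth_on_id open_UNIV)
  show "leafD s C = range (\<lambda>z. gno s (u_inv (s * C / (1 + (cmod z)\<^sup>2) ^ 4)) z)"
    by (rule leafD_eq_range[OF assms])
  have "closed {p :: R4. 0 \<le> s * y1 p \<and> 0 \<le> s * C * x1 p \<and>
     (x1 p)\<^sup>2 = C\<^sup>2 * y1 p ^ 16 * (1 - 2 * \<epsilon> * (x1 p)\<^sup>2)}"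
    by (intro closed_Collect_conj closed_Collect_eq closed_Collect_le continuous_intros)
  then show "closedin (top_of_set M) (leafD s C)"
    using leafD_closed_in_M[OF assms] by (auto simp: closedin_closed)
qed

subsection \<open>Charts at the points off the cylinders\<close>

text \<open>\<open>C_of\<close> maps \<open>(0, 1)\<close> diffeomorphically onto the line, decreasing from \<open>\<infinity>\<close> to \<open>- \<infinity>\<close>, and \<open>tau_of\<close> is
  its inverse.\<close>

definition C_of :: "real \<Rightarrow> real" where "C_of \<tau> = (1/2 - \<tau>) / sqrt (\<tau> * (1 - \<tau>))"
definition tau_of :: "real \<Rightarrow> real" where "tau_of C = 1/2 - C / (2 * sqrt (1 + C\<^sup>2))"

lemma tau_of_bounds: "tau_of C \<in> {0<..<1}"
proof -
  have "\<bar>C\<bar> < sqrt (1 + C\<^sup>2)" by (rule real_less_rsqrt) simp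
  moreover have "0 < sqrt (1 + C\<^sup>2)" by (simp add: add_pos_nonneg)
  moreover define t where "t = C / (2 * sqrt (1 + C\<^sup>2))"
  ultimately have "\<bar>t\<bar> < 1 / 2" by (simp add: abs_mult)
  then show ?thesis unfolding tau_of_def t_def[symmetric] by (simp only: abs_less_iff) auto
qed

lemma C_of_tau_of: "C_of (tau_of C) = C"
proof -
  define r where "r = sqrt (1 + C\<^sup>2)"
  have r: "0 < r" "r\<^sup>2 = 1 + C\<^sup>2" by (simp_all add: r_def add_pos_nonneg)
  have t: "tau_of C = 1/2 - C / (2 * r)" by (simp add: tau_of_def r_def)
  have "tau_of C * (1 - tau_of C) = 1 / 4 - C\<^sup>2 / (4 * r\<^sup>2)"
    unfolding t using r(1) by (simp add: field_simps power2_eq_square)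
  also have "\<dots> = (r\<^sup>2 - C\<^sup>2) / (4 * r\<^sup>2)" using r(1) by (simp add: diff_divide_distrib)
  also have "r\<^sup>2 - C\<^sup>2 = 1" using r(2) by simp
  also have "1 / (4 * r\<^sup>2) = (1 / (2 * r))\<^sup>2" by (simp add: power_divide power_mult_distrib)
  finally have "sqrt (tau_of C * (1 - tau_of C)) = 1 / (2 * r)" using r(1) by simp
  then show ?thesis unfolding C_of_def using r(1) by (simp add: t)
qed

lemma tau_of_C_of: "\<tau> \<in> {0<..<1} \<Longrightarrow> tau_of (C_of \<tau>) = \<tau>"
proof -
  assume t: "\<tau> \<in> {0<..<1}"
  define r where "r = sqrt (\<tau> * (1 - \<tau>))"
  have r: "0 < r" "r\<^sup>2 = \<tau> * (1 - \<tau>)" using t by (simp_all add: r_def)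
  have c: "C_of \<tau> = (1/2 - \<tau>) / r" by (simp add: C_of_def r_def)
  have "1 + (C_of \<tau>)\<^sup>2 = (r\<^sup>2 + (1/2 - \<tau>)\<^sup>2) / r\<^sup>2"
    using r(1) by (simp add: c power_divide add_divide_distrib)
  also have "r\<^sup>2 + (1/2 - \<tau>)\<^sup>2 = 1 / 4" unfolding r(2) by (simp add: power2_eq_square algebra_simps)
  also have "1 / 4 / r\<^sup>2 = (1 / (2 * r))\<^sup>2" by (simp add: power_divide power_mult_distrib)
  finally have "sqrt (1 + (C_of \<tau>)\<^sup>2) = 1 / (2 * r)" using r(1) by simp
  then show ?thesis unfolding tau_of_def using r(1) by (simp add: c)
qed

lemma smooth_C_of: "open U \<Longrightarrow> smooth_on U f \<Longrightarrow> (\<And>q. q \<in> U \<Longrightarrow> f q \<in> {0<..<1}) \<Longrightarrow>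
    smooth_on U (\<lambda>q. C_of (f q))"
  unfolding C_of_def by (intro smooth_intros) (fastforce simp: mult_pos_pos)+

lemma smooth_tau_of: "open U \<Longrightarrow> smooth_on U f \<Longrightarrow> smooth_on U (\<lambda>q. tau_of (f q))"
proof -
  have "0 < 1 + (f q)\<^sup>2" for q by (simp add: add_pos_nonneg)
  then show "open U \<Longrightarrow> smooth_on U f \<Longrightarrow> smooth_on U (\<lambda>q. tau_of (f q))"
    unfolding tau_of_def by (intro smooth_intros) (auto simp: less_imp_neq[symmetric])
qed

text \<open>The half of the open strip on which \<open>y\<^sub>1\<close> has the sign \<open>s\<close> is covered by a single chart whose slices are
  the whole leaves.\<close>

definition family_chart :: "real \<Rightarrow> complex \<times> real \<Rightarrow> R4" where
  "family_chart s = (\<lambda>(z, \<tau>). gno s (u_inv (s * C_of \<tau> / (1 + (cmod z)\<^sup>2) ^ 4)) z)"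
definition family_chart_inv :: "real \<Rightarrow> R4 \<Rightarrow> complex \<times> real" where
  "family_chart_inv s p = (gno_inv s p, tau_of (s * G (x1 p) / y1 p ^ 8))"

lemma open_family_domain: "open ((UNIV :: complex set) \<times> {0<..<1::real})"
  by (intro open_Times) auto

lemma smooth_family_chart: "smooth_on (UNIV \<times> {0<..<1}) (family_chart s)"
  unfolding family_chart_def case_prod_unfold divide_inverse[of "s * _"]
  using one_plus_norm_pos(1)
  by (intro smooth_intros smooth_C_of open_family_domain) (auto simp: less_imp_neq[symmetric])

lemma family_chart_inv_differentiable:
  assumes "y1 p \<noteq> 0" "\<bar>x1 p\<bar> < a"
  shows "family_chart_inv s differentiable (at p)"
proof -
  let ?U = "{p :: R4. y1 p \<noteq> 0 \<and> \<bar>x1 p\<bar> < a}"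
  have o: "open ?U" by (intro open_Collect_conj open_Collect_neq open_Collect_less continuous_intros)
  have "smooth_on ?U (family_chart_inv s)"
    unfolding family_chart_inv_def by (intro smooth_intros smooth_tau_of o) auto
  then show ?thesis using smooth_on_imp_differentiable assms by blast
qed

lemma family_chart_in_leaf: "s\<^sup>2 = 1 \<Longrightarrow> family_chart s (z, \<tau>) \<in> leafD s (C_of \<tau>)"
  using leafD_eq_range by (auto simp: family_chart_def)

lemma family_chart_inv_chart:
  assumes "s\<^sup>2 = 1" "\<tau> \<in> {0<..<1}"
  shows "family_chart_inv s (family_chart s (z, \<tau>)) = (z, \<tau>)"
proof -
  let ?p = "family_chart s (z, \<tau>)"
  have "s * G (x1 ?p) / y1 ?p ^ 8 = C_of \<tau>"
    using family_chart_in_leaf[OF assms(1), of z \<tau>] by (auto simp: leafD_def)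
  moreover have "gno_inv s ?p = z" using assms(1) by (simp add: family_chart_def gno_coords)
  ultimately show ?thesis using tau_of_C_of[OF assms(2)] by (simp add: family_chart_inv_def)
qed

lemma family_chart_surj:
  assumes "s\<^sup>2 = 1" "H p = E" "\<bar>x1 p\<bar> < a" "0 < s * y1 p"
  shows "\<exists>z. \<exists>\<tau>\<in>{0<..<1}. p = family_chart s (z, \<tau>)"
proof -
  define C where "C = s * G (x1 p) / y1 p ^ 8"
  have "p \<in> leafD s C" using assms by (auto simp: leafD_def C_def)
  then obtain z where "p = gno s (u_inv (s * C / (1 + (cmod z)\<^sup>2) ^ 4)) z"
    unfolding leafD_eq_range[OF assms(1)] by blast
  then have "p = family_chart s (z, tau_of C)" by (simp add: family_chart_def C_of_tau_of)
  then show ?thesis using tau_of_bounds by blast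
qed

lemma smooth_plane_family_leafD:
  assumes "s\<^sup>2 = 1" shows "smooth_plane_family (\<lambda>\<tau>. leafD s (C_of \<tau>))"
  unfolding smooth_plane_family_def
proof (intro exI conjI ballI)
  show "smooth_embedding (UNIV \<times> {0<..<1}) (family_chart s)"
  proof (rule smooth_embeddingI[where g="family_chart_inv s", OF open_family_domain smooth_family_chart])
    fix q :: "complex \<times> real" assume "q \<in> UNIV \<times> {0<..<1}"
    then obtain z \<tau> where q: "q = (z, \<tau>)" "\<tau> \<in> {0<..<1}" by auto
    show "family_chart_inv s (family_chart s q) = q"
      using family_chart_inv_chart[OF assms q(2)] q(1) by simp
    show "family_chart_inv s differentiable (at (family_chart s q))"
      using family_chart_in_leaf[OF assms, of z \<tau>] q(1)
      by (intro family_chart_inv_differentiable) (auto simp: leafD_def)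
  qed
  show "leafD s (C_of \<tau>) = range (\<lambda>z. family_chart s (z, \<tau>))" for \<tau>
    using leafD_eq_range[OF assms] by (simp add: family_chart_def)
qed

lemma foliated_at_family:
  assumes "s\<^sup>2 = 1" "H p = E" "\<bar>x1 p\<bar> < a" "0 < s * y1 p"
  shows "foliated_at M leaves p"
proof -
  obtain z \<tau> where z: "\<tau> \<in> {0<..<1}" "p = family_chart s (z, \<tau>)"
    using family_chart_surj[OF assms] by blast
  let ?N = "{p :: R4. \<bar>x1 p\<bar> < a \<and> 0 < s * y1 p}"
  show ?thesis
  proof (rule foliated_atI[where V="UNIV \<times> {0<..<1}" and \<Phi>="family_chart s" and g="family_chart_inv s"
        and half=False and N="?N", OF open_family_domain smooth_family_chart])
    fix q :: "complex \<times> real" assume "q \<in> UNIV \<times> {0<..<1}"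
    then obtain z \<tau> where q: "q = (z, \<tau>)" "\<tau> \<in> {0<..<1}" by auto
    show "family_chart_inv s (family_chart s q) = q"
      using family_chart_inv_chart[OF assms(1) q(2)] q(1) by simp
    show "family_chart_inv s differentiable (at (family_chart s q))"
      using family_chart_in_leaf[OF assms(1), of z \<tau>] q(1)
      by (intro family_chart_inv_differentiable) (auto simp: leafD_def)
  next
    show "M \<inter> ?N = family_chart s ` {q \<in> UNIV \<times> {0<..<1}. False \<longrightarrow> 0 \<le> snd q}" (is "_ = ?I")
    proof
      show "M \<inter> ?N \<subseteq> ?I" using family_chart_surj[OF assms(1)] by (fastforce simp: M_def strip_def)
      show "?I \<subseteq> M \<inter> ?N"
        using family_chart_in_leaf[OF assms(1)] by (fastforce simp: M_def strip_def bind_orbits_def leafD_def)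
    qed
    show "\<exists>L\<in>leaves. \<forall>z. (z, c) \<in> UNIV \<times> {0<..<1} \<longrightarrow> family_chart s (z, c) \<in> L" for c
      using family_chart_in_leaf[OF assms(1)] assms(1) by (intro bexI[of _ "leafD s (C_of c)"]) (auto simp: leaves_def)
    show "open ?N" by (intro open_Collect_conj open_Collect_less continuous_intros)
  qed (use z assms(1) in \<open>auto simp: leaves_def\<close>)
qed

text \<open>Near a hemisphere over a saddle the leaves are the level sets of
  \<open>(1 / x\<^sub>1\<^sup>2 - 2 \<epsilon>) y\<^sub>1\<^sup>1\<^sup>6 = 1 / C\<^sup>2\<close>; this function is smooth across the saddle and negative
  beyond it.\<close>

definition saddle_chart :: "real \<Rightarrow> real \<Rightarrow> complex \<times> real \<Rightarrow> R4" where
  "saddle_chart s1 s2 = (\<lambda>(z, c). gno s2 (s1 * v_inv (c * (1 + (cmod z)\<^sup>2) ^ 8)) z)"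
definition saddle_chart_inv :: "real \<Rightarrow> R4 \<Rightarrow> complex \<times> real" where
  "saddle_chart_inv s2 p = (gno_inv s2 p, (1 / (x1 p)\<^sup>2 - 2 * \<epsilon>) * y1 p ^ 16)"

lemma gno_v:
  assumes "s2\<^sup>2 = 1" shows "(1 / x\<^sup>2 - 2 * \<epsilon>) * y1 (gno s2 x z) ^ 16 = v x / (1 + (cmod z)\<^sup>2) ^ 8"
proof -
  have "y1 (gno s2 x z) ^ 16 = (y1 (gno s2 x z) ^ 8)\<^sup>2" by (simp flip: power_mult)
  then show ?thesis unfolding gno_y1_power8[OF assms] v_def by (simp add: power_divide flip: power_mult)
qed

lemma v_even: "v (- x) = v x" by (simp add: v_def R2_even)

lemma v_sign: "s\<^sup>2 = 1 \<Longrightarrow> v (s * x) = v x"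
  using sign_cases[of s] by (auto simp: v_even)

lemma v_nonneg_iff: "0 < x \<Longrightarrow> 0 \<le> v x \<longleftrightarrow> x \<le> a"
proof -
  assume x: "0 < x"
  have va: "v a = 0" using eps by (simp add: v_def a_square)
  show ?thesis
    using v_strict_antimono[of x a] v_strict_antimono[of a x] x a_pos va
    by (cases x a rule: linorder_cases) auto
qed

lemma saddle_chart_inv_chart:
  assumes "s1\<^sup>2 = 1" "s2\<^sup>2 = 1"
  shows "saddle_chart_inv s2 (saddle_chart s1 s2 q) = q"
proof -
  obtain z c where q: "q = (z, c)" by force
  let ?x = "s1 * v_inv (c * (1 + (cmod z)\<^sup>2) ^ 8)"
  have "v ?x = c * (1 + (cmod z)\<^sup>2) ^ 8" using v_sign[OF assms(1)] v_inv by simp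
  then have "(1 / ?x\<^sup>2 - 2 * \<epsilon>) * y1 (gno s2 ?x z) ^ 16 = c"
    unfolding gno_v[OF assms(2)] using one_plus_norm_pos(1)[of z] by simp
  then show ?thesis by (simp add: q saddle_chart_def saddle_chart_inv_def gno_coords assms)
qed

lemma saddle_chart_coords:
  assumes "s1\<^sup>2 = 1" "s2\<^sup>2 = 1"
  shows "H (saddle_chart s1 s2 q) = E" "0 < s1 * x1 (saddle_chart s1 s2 q)"
    "0 < s2 * y1 (saddle_chart s1 s2 q)"
    "s1 * x1 (saddle_chart s1 s2 q) = v_inv (snd q * (1 + (cmod (fst q))\<^sup>2) ^ 8)"
  using v_inv(1) assms by (auto simp: saddle_chart_def gno_coords sign_square split: prod.splits)

lemma saddle_chart_in_strip_iff:
  assumes "s1\<^sup>2 = 1" "s2\<^sup>2 = 1"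
  shows "s1 * x1 (saddle_chart s1 s2 (z, c)) \<le> a \<longleftrightarrow> 0 \<le> c"
proof -
  have "0 < (1 + (cmod z)\<^sup>2) ^ 8" using one_plus_norm_pos(1)[of z] by simp
  then show ?thesis
    unfolding saddle_chart_coords(4)[OF assms] v_nonneg_iff[OF v_inv(1), symmetric] v_inv(2)
    by (simp add: zero_le_mult_iff)
qed

lemma saddle_chart_in_leaf:
  assumes s: "s1\<^sup>2 = 1" "s2\<^sup>2 = 1" and c: "0 \<le> c"
  shows "saddle_chart s1 s2 (z, c) \<in> (if c = 0 then leafU s1 s2 else leafD s2 (s1 * s2 / sqrt c))"
proof -
  define p where "p = saddle_chart s1 s2 (z, c)"
  define x where "x = s1 * x1 p"
  have p: "H p = E" "0 < x" "0 < s2 * y1 p"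
    unfolding p_def x_def using saddle_chart_coords[OF s] by auto
  have xx: "x1 p = s1 * x" "(x1 p)\<^sup>2 = x\<^sup>2" using s sign_square by (auto simp: x_def power_mult_distrib)
  have inv: "(1 / x\<^sup>2 - 2 * \<epsilon>) * y1 p ^ 16 = c"
    using saddle_chart_inv_chart[OF s, of "(z, c)"] by (simp add: saddle_chart_inv_def xx(2) flip: p_def)
  have y: "y1 p \<noteq> 0" using p(3) by auto
  show ?thesis
  proof (cases "c = 0")
    case True
    then have "1 / x\<^sup>2 = 2 * \<epsilon>" using inv y by simp
    then have "x\<^sup>2 = a\<^sup>2" using p(2) eps unfolding a_square by (simp add: field_simps)
    then have "x = a" using p(2) a_pos by (simp add: power2_eq_iff)
    then show ?thesis unfolding p_def[symmetric] using True p xx by (simp add: leafU_def)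
  next
    case False
    then have c0: "0 < c" using c by simp
    moreover have "0 < y1 p ^ 16" using y by simp
    ultimately have "0 < 1 / x\<^sup>2 - 2 * \<epsilon>" using inv by (metis zero_less_mult_pos2)
    then have r: "0 < 1 - 2 * \<epsilon> * x\<^sup>2" using p(2) by (simp add: field_simps)
    then have xa: "\<bar>x\<bar> < a" by (simp add: abs_less_a_iff)
    have "(G x)\<^sup>2 = 1 / (1 / x\<^sup>2 - 2 * \<epsilon>)" using r p(2) by (simp add: G_def power_divide field_simps)
    also have "\<dots> = y1 p ^ 16 / c" using inv c0 \<open>0 < 1 / x\<^sup>2 - 2 * \<epsilon>\<close> by (simp add: field_simps)
    also have "\<dots> = (y1 p ^ 8 / sqrt c)\<^sup>2" using c0 by (simp add: power_divide flip: power_mult)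
    finally have "(G x)\<^sup>2 = (y1 p ^ 8 / sqrt c)\<^sup>2" .
    moreover have "0 \<le> G x" using p(2) r by (simp add: G_def)
    moreover have "0 \<le> y1 p ^ 8 / sqrt c" using c0 by simp
    ultimately have Gx: "G x = y1 p ^ 8 / sqrt c" by (simp add: power2_eq_iff_nonneg)
    have "G (x1 p) = s1 * G x" using sign_cases[OF s(1)] by (auto simp: xx(1) G_odd)
    then have "s2 * G (x1 p) = s1 * s2 / sqrt c * y1 p ^ 8" by (simp add: Gx)
    moreover have "\<bar>x1 p\<bar> < a" using xa sign_cases[OF s(1)] by (auto simp: xx(1))
    ultimately show ?thesis using False p by (simp add: leafD_def flip: p_def)
  qed
qed

lemma foliated_at_saddle:
  assumes s: "s1\<^sup>2 = 1" "s2\<^sup>2 = 1" and p: "p \<in> leafU s1 s2"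
  shows "foliated_at M leaves p"
proof -
  let ?N = "{p :: R4. 0 < s1 * x1 p \<and> 0 < s2 * y1 p}"
  have surj: "p = saddle_chart s1 s2 (saddle_chart_inv s2 p)"
    if "H p = E" "0 < s1 * x1 p" "0 < s2 * y1 p" for p
  proof -
    have e: "p = gno s2 (x1 p) (gno_inv s2 p)" using gno_surj s that by blast
    let ?z = "gno_inv s2 p"
    have "(1 / (x1 p)\<^sup>2 - 2 * \<epsilon>) * y1 p ^ 16 = v (x1 p) / (1 + (cmod ?z)\<^sup>2) ^ 8"
      using gno_v[OF s(2), of "x1 p" ?z] e by simp
    then have "(1 / (x1 p)\<^sup>2 - 2 * \<epsilon>) * y1 p ^ 16 * (1 + (cmod ?z)\<^sup>2) ^ 8 = v (s1 * x1 p)"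
      using one_plus_norm_pos(1)[of ?z] v_sign[OF s(1)] by simp
    then have "s1 * v_inv ((1 / (x1 p)\<^sup>2 - 2 * \<epsilon>) * y1 p ^ 16 * (1 + (cmod ?z)\<^sup>2) ^ 8) = x1 p"
      using v_inv_v[OF that(2)] sign_square[OF s(1)] by simp
    then show ?thesis using e by (simp add: saddle_chart_def saddle_chart_inv_def)
  qed
  have pp: "H p = E" "0 < s1 * x1 p" "0 < s2 * y1 p" "x1 p = s1 * a"
    using p a_pos by (auto simp: leafU_def sign_square(2)[OF s(1)])
  show ?thesis
  proof (rule foliated_atI[where V=UNIV and \<Phi>="saddle_chart s1 s2" and g="saddle_chart_inv s2"
        and half=True and N="?N" and z\<^sub>0="gno_inv s2 p" and c\<^sub>0=0])
    show "smooth_on UNIV (saddle_chart s1 s2)"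
      unfolding saddle_chart_def case_prod_unfold by (intro smooth_intros) auto
    show "saddle_chart_inv s2 (saddle_chart s1 s2 q) = q" for q
      by (rule saddle_chart_inv_chart[OF s])
    show "saddle_chart_inv s2 differentiable (at (saddle_chart s1 s2 q))" for q
    proof -
      let ?U = "{p :: R4. x1 p \<noteq> 0 \<and> y1 p \<noteq> 0}"
      have o: "open ?U" by (intro open_Collect_conj open_Collect_neq continuous_intros)
      have "smooth_on ?U (saddle_chart_inv s2)"
        unfolding saddle_chart_inv_def by (intro smooth_intros o) auto
      moreover have "saddle_chart s1 s2 q \<in> ?U" using saddle_chart_coords(2,3)[OF s, of q] by auto
      ultimately show ?thesis using smooth_on_imp_differentiable by blast
    qed
    have "1 / (x1 p)\<^sup>2 - 2 * \<epsilon> = 0"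
      using pp(4) s(1) eps by (simp add: power_mult_distrib a_square)
    then show "saddle_chart s1 s2 (gno_inv s2 p, 0) = p"
      using surj[OF pp(1-3)] by (simp add: saddle_chart_inv_def)
    show "open ?N" by (intro open_Collect_conj open_Collect_less continuous_intros)
    show "M \<inter> ?N = saddle_chart s1 s2 ` {q \<in> UNIV. True \<longrightarrow> 0 \<le> snd q}" (is "_ = ?I")
    proof
      show "M \<inter> ?N \<subseteq> ?I"
      proof
        fix p assume p: "p \<in> M \<inter> ?N"
        then have e: "p = saddle_chart s1 s2 (saddle_chart_inv s2 p)"
          using surj[of p] by (auto simp: M_def strip_def)
        have "s1 * x1 p \<le> a" using p sign_cases[OF s(1)] by (auto simp: M_def strip_def)
        then have "0 \<le> snd (saddle_chart_inv s2 p)"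
          using saddle_chart_in_strip_iff[OF s] e by (metis prod.collapse)
        then show "p \<in> ?I" using e by blast
      qed
      show "?I \<subseteq> M \<inter> ?N"
      proof (rule image_subsetI)
        fix q :: "complex \<times> real" assume "q \<in> {q \<in> UNIV. True \<longrightarrow> 0 \<le> snd q}"
        then have "s1 * x1 (saddle_chart s1 s2 q) \<le> a"
          using saddle_chart_in_strip_iff[OF s, of "fst q" "snd q"] by simp
        then show "saddle_chart s1 s2 q \<in> M \<inter> ?N"
          using saddle_chart_coords(1-3)[OF s, of q] sign_cases[OF s(1)]
          by (auto simp: M_def strip_def bind_orbits_def)
      qed
    qed
    show "\<exists>L\<in>leaves. \<forall>z. (z, c) \<in> UNIV \<longrightarrow> saddle_chart s1 s2 (z, c) \<in> L"
      if "True \<Longrightarrow> 0 \<le> c" for c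
    proof -
      have "0 \<le> c" using that by simp
      then show ?thesis using saddle_chart_in_leaf[OF s, of c] s
        by (intro bexI[of _ "if c = 0 then leafU s1 s2 else leafD s2 (s1 * s2 / sqrt c)"])
          (auto simp: leaves_def)
    qed
  qed (use s in \<open>auto simp: leaves_def\<close>)
qed

subsection \<open>The cylinders and charts around them\<close>

text \<open>Around the cylinder \<open>y\<^sub>1 = 0\<close> the leaves are the level sets of \<open>k = y\<^sub>1 / G(s x\<^sub>1)\<^sup>1\<^sup>/\<^sup>8\<close>.\<close>

definition root8 :: "real \<Rightarrow> real" where "root8 x = sqrt (sqrt (sqrt x))"
definition cyl_x :: "complex \<Rightarrow> real" where "cyl_x z = a * (cmod z)\<^sup>2 / (1 + (cmod z)\<^sup>2)"
definition height :: "complex \<times> real \<Rightarrow> real" where "height = (\<lambda>(z, k). k * root8 (u (cyl_x z)))"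
definition cyl_domain :: "(complex \<times> real) set" where
  "cyl_domain = {q. fst q \<noteq> 0} \<inter> (\<lambda>q. (height q)\<^sup>2) -` {..<1}"
definition cyl_chart :: "real \<Rightarrow> complex \<times> real \<Rightarrow> R4" where
  "cyl_chart s q = pt (s * cyl_x (fst q)) ((sqrt (1 - (height q)\<^sup>2) / sqrt ((cmod (fst q))\<^sup>2)) *\<^sub>R fst q) (height q)"
definition cyl_inv :: "real \<Rightarrow> R4 \<Rightarrow> complex \<times> real" where
  "cyl_inv s p = ((sqrt (s * x1 p / (a - s * x1 p)) / sqrt ((cmod (zeta p))\<^sup>2)) *\<^sub>R zeta p,
      y1 p / root8 (G (s * x1 p)))"

lemma root8_pos: "0 < x \<Longrightarrow> 0 < root8 x" by (simp add: root8_def)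

lemma root8_power8: "0 \<le> x \<Longrightarrow> root8 x ^ 8 = x"
proof -
  assume "0 \<le> x"
  moreover have "root8 x ^ 8 = (((root8 x)\<^sup>2)\<^sup>2)\<^sup>2" by (simp flip: power_mult)
  ultimately show ?thesis by (simp add: root8_def)
qed

lemma smooth_root8: "open U \<Longrightarrow> smooth_on U f \<Longrightarrow> (\<And>q. q \<in> U \<Longrightarrow> 0 < f q) \<Longrightarrow> smooth_on U (\<lambda>q. root8 (f q))"
  unfolding root8_def by (intro smooth_intros) auto

lemma cyl_x_bounds: "z \<noteq> 0 \<Longrightarrow> 0 < cyl_x z" "cyl_x z < a"
  using a_pos one_plus_norm_pos(1)[of z] by (auto simp: cyl_x_def divide_simps)

lemma cyl_x_inverse: "cyl_x z / (a - cyl_x z) = (cmod z)\<^sup>2"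
proof -
  have n: "1 + (cmod z)\<^sup>2 \<noteq> 0" using one_plus_norm_pos(1)[of z] by simp
  have "a - cyl_x z = a / (1 + (cmod z)\<^sup>2)" using n by (simp add: cyl_x_def field_simps)
  then show ?thesis using n a_pos by (simp add: cyl_x_def)
qed

lemma u_pos: "0 < x \<Longrightarrow> x < a \<Longrightarrow> 0 < u x"
  using G_pos_iff[of x] R2_lower(2)[of x] by (simp add: u_def)

lemma root8_u: "0 < x \<Longrightarrow> x < a \<Longrightarrow> R x * root8 (u x) = root8 (G x)"
proof -
  assume x: "0 < x" "x < a"
  have "R2 x ^ 4 = ((R2 x)\<^sup>2)\<^sup>2" by (simp flip: power_mult)
  then have "root8 (R2 x ^ 4) = R x"
    using R2_lower(2)[of x] unfolding root8_def R_def by (simp only: real_sqrt_abs) simp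
  then have "root8 (u x) = root8 (G x) / R x" by (simp add: u_def root8_def real_sqrt_divide)
  then show ?thesis using R_pos[of x] by simp
qed

lemma smooth_height: "smooth_on {q. fst q \<noteq> 0} height"
proof -
  have o: "open {q :: complex \<times> real. fst q \<noteq> 0}"
    by (intro open_Collect_neq continuous_intros)
  have b: "\<bar>cyl_x z\<bar> < a" if "z \<noteq> 0" for z using cyl_x_bounds[of z] that by simp
  have scyl_x: "smooth_on {q :: complex \<times> real. fst q \<noteq> 0} (\<lambda>q. cyl_x (fst q))"
    unfolding cyl_x_def using one_plus_norm_pos(1) by (intro smooth_intros o) (auto simp: less_imp_neq[symmetric])
  have "smooth_on {q :: complex \<times> real. fst q \<noteq> 0} (\<lambda>q. u (cyl_x (fst q)))"
    unfolding u_def using R2_lower(2) b by (intro smooth_intros o scyl_x) (auto simp: less_imp_neq[symmetric])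
  then show ?thesis
    unfolding height_def case_prod_unfold using u_pos[OF cyl_x_bounds]
    by (intro smooth_intros smooth_root8 o) auto
qed

lemma open_cyl_domain: "open cyl_domain"
proof -
  have o: "open {q :: complex \<times> real. fst q \<noteq> 0}"
    by (intro open_Collect_neq continuous_intros)
  have "continuous_on {q. fst q \<noteq> 0} (\<lambda>q. (height q)\<^sup>2)"
    by (intro continuous_intros smooth_on_imp_continuous smooth_height)
  then show ?thesis unfolding cyl_domain_def by (intro continuous_open_preimage o) auto
qed

lemma smooth_cyl_chart: "smooth_on cyl_domain (cyl_chart s)"
proof -
  have h: "smooth_on cyl_domain height"
    by (rule smooth_on_subset[OF smooth_height]) (auto simp: cyl_domain_def)
  have scyl_x: "smooth_on cyl_domain (\<lambda>q. cyl_x (fst q))"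
    unfolding cyl_x_def using one_plus_norm_pos(1)
    by (intro smooth_intros open_cyl_domain) (auto simp: less_imp_neq[symmetric])
  have "0 < sqrt ((cmod (fst q))\<^sup>2)" if "q \<in> cyl_domain" for q :: "complex \<times> real"
    using that by (simp add: cyl_domain_def)
  then show ?thesis
    unfolding cyl_chart_def
    by (intro smooth_intros h scyl_x open_cyl_domain) (auto simp: cyl_domain_def)
qed

lemma cyl_chart_coords:
  assumes "s\<^sup>2 = 1" "(z, k) \<in> cyl_domain"
  shows "H (cyl_chart s (z, k)) = E" "s * x1 (cyl_chart s (z, k)) = cyl_x z"
    "zeta (cyl_chart s (z, k)) = (R (cyl_x z) * sqrt (1 - (height (z, k))\<^sup>2) / cmod z) *\<^sub>R z"
    "y1 (cyl_chart s (z, k)) = k * root8 (G (cyl_x z))"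
proof -
  have z: "z \<noteq> 0" "(height (z, k))\<^sup>2 < 1" using assms(2) by (auto simp: cyl_domain_def)
  have R: "R (s * x) = R x" for x using sign_cases[OF assms(1)] by (auto simp: R_even)
  show "H (cyl_chart s (z, k)) = E"
    unfolding cyl_chart_def using z by (intro energy_pt) (simp add: power_mult_distrib power_divide)
  show "s * x1 (cyl_chart s (z, k)) = cyl_x z" using assms(1) by (simp add: cyl_chart_def sign_square)
  show "zeta (cyl_chart s (z, k)) = (R (cyl_x z) * sqrt (1 - (height (z, k))\<^sup>2) / cmod z) *\<^sub>R z"
    by (simp add: cyl_chart_def R)
  have "y1 (cyl_chart s (z, k)) = R (cyl_x z) * height (z, k)" by (simp add: cyl_chart_def R)
  also have "\<dots> = k * (R (cyl_x z) * root8 (u (cyl_x z)))" by (simp add: height_def)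
  finally show "y1 (cyl_chart s (z, k)) = k * root8 (G (cyl_x z))" using root8_u cyl_x_bounds z(1) by simp
qed

lemma cyl_chart_range:
  assumes "s\<^sup>2 = 1" "(z, k) \<in> cyl_domain"
  shows "0 < s * x1 (cyl_chart s (z, k))" "s * x1 (cyl_chart s (z, k)) < a" "zeta (cyl_chart s (z, k)) \<noteq> 0"
  using cyl_chart_coords(2,3)[OF assms] cyl_x_bounds[of z] R_pos[of "cyl_x z"] assms(2)
  by (auto simp: cyl_domain_def)

lemma cyl_inv_chart:
  assumes "s\<^sup>2 = 1" "q \<in> cyl_domain"
  shows "cyl_inv s (cyl_chart s q) = q"
proof -
  obtain z k where q: "q = (z, k)" by force
  have zk: "(z, k) \<in> cyl_domain" using assms(2) q by simp
  note c = cyl_chart_coords[OF assms(1) zk]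
  have z: "z \<noteq> 0" "(height (z, k))\<^sup>2 < 1" using zk by (auto simp: cyl_domain_def)
  have w: "0 < R (cyl_x z) * sqrt (1 - (height (z, k))\<^sup>2)" using R_pos z(2) by simp
  have "cmod (zeta (cyl_chart s (z, k))) = R (cyl_x z) * sqrt (1 - (height (z, k))\<^sup>2)"
    unfolding c(3) norm_scaleR abs_divide abs_of_pos[OF w] using z(1) by simp
  then have "fst (cyl_inv s (cyl_chart s (z, k))) = z"
    unfolding cyl_inv_def using w z R_pos[of "cyl_x z"] by (simp add: c cyl_x_inverse)
  moreover have "0 < root8 (G (cyl_x z))"
    using root8_pos G_pos_iff[of "cyl_x z"] cyl_x_bounds[of z] z(1) by simp
  then have "snd (cyl_inv s (cyl_chart s (z, k))) = k" by (simp add: cyl_inv_def c)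
  ultimately show ?thesis by (simp add: q prod_eq_iff)
qed

lemma cyl_inv_differentiable:
  assumes "0 < s * x1 p" "s * x1 p < a" "zeta p \<noteq> 0"
  shows "cyl_inv s differentiable (at p)"
proof -
  have sz: "smooth_on UNIV zeta" by (intro smooth_intros) auto
  let ?U = "{p :: R4. 0 < s * x1 p \<and> s * x1 p < a \<and> zeta p \<noteq> 0}"
  have o: "open ?U"
    by (intro open_Collect_conj open_Collect_less open_Collect_neq continuous_intros smooth_on_imp_continuous[OF sz])
  have 1: "0 < s * x1 p / (a - s * x1 p)" "a - s * x1 p \<noteq> 0" "0 < G (s * x1 p)" "\<bar>s * x1 p\<bar> < a"
    "0 < (cmod (zeta p))\<^sup>2" if "p \<in> ?U" for p
    using that G_pos_iff[of "s * x1 p"] by simp_all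
  then have 2: "sqrt ((cmod (zeta p))\<^sup>2) \<noteq> 0" "root8 (G (s * x1 p)) \<noteq> 0" if "p \<in> ?U" for p
    using root8_pos[of "G (s * x1 p)"] 1(3,5)[OF that] by simp_all
  have "smooth_on ?U (cyl_inv s)"
    unfolding cyl_inv_def by (intro smooth_intros smooth_root8 o) (erule 1 2)+
  then show ?thesis using smooth_on_imp_differentiable assms by blast
qed

lemma cyl_chart_surj:
  assumes s: "s\<^sup>2 = 1" and p: "H p = E" "0 < s * x1 p" "s * x1 p < a" "zeta p \<noteq> 0"
  shows "cyl_inv s p \<in> cyl_domain" "p = cyl_chart s (cyl_inv s p)"
proof -
  define z where "z = fst (cyl_inv s p)"
  define k where "k = snd (cyl_inv s p)"
  define x where "x = s * x1 p"
  have x: "0 < x" "x < a" using p by (auto simp: x_def)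
  have q: "cyl_inv s p = (z, k)" by (simp add: z_def k_def)
  have zn: "cmod z = sqrt (x / (a - x))" and zdir: "z = (cmod z / cmod (zeta p)) *\<^sub>R zeta p"
    using p(4) x by (simp_all add: z_def cyl_inv_def flip: x_def)
  have z0: "z \<noteq> 0" using zn x by auto
  have "(cmod z)\<^sup>2 = x / (a - x)" using zn x by simp
  then have "a * (cmod z)\<^sup>2 = x * (1 + (cmod z)\<^sup>2)" using x by (simp add: field_simps)
  then have xz: "cyl_x z = x" using one_plus_norm_pos(1)[of z] by (simp add: cyl_x_def)
  have R: "R (x1 p) = R x" "R2 (x1 p) = R2 x"
    using sign_cases[OF s] by (auto simp: x_def R_even R2_even)
  have rG: "0 < root8 (G x)" using root8_pos G_pos_iff[of x] x by simp
  have "R x * height (z, k) = k * (R x * root8 (u x))" by (simp add: height_def xz)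
  also have "\<dots> = y1 p" using root8_u[OF x] rG by (simp add: k_def cyl_inv_def flip: x_def)
  finally have h: "R x * height (z, k) = y1 p" .
  have en: "(cmod (zeta p))\<^sup>2 + (y1 p)\<^sup>2 = (R x)\<^sup>2" using p(1) by (simp add: energy_iff R R_square)
  then have e2: "(cmod (zeta p))\<^sup>2 = (R x)\<^sup>2 * (1 - (height (z, k))\<^sup>2)"
    by (simp add: power_mult_distrib algebra_simps flip: h)
  moreover have "0 < (cmod (zeta p))\<^sup>2" using p(4) by simp
  ultimately have hl: "(height (z, k))\<^sup>2 < 1" using R_pos[of x] by (simp add: zero_less_mult_iff)
  show dom: "cyl_inv s p \<in> cyl_domain" using z0 hl by (simp add: q cyl_domain_def)
  have "cmod (zeta p) = R x * sqrt (1 - (height (z, k))\<^sup>2)"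
    using e2 R_pos[of x] hl by (metis abs_of_nonneg less_imp_le norm_ge_zero real_sqrt_abs real_sqrt_mult)
  then have zt: "zeta p = (R x * sqrt (1 - (height (z, k))\<^sup>2) / cmod z) *\<^sub>R z"
    using arg_cong[OF zdir, of "\<lambda>w. (cmod (zeta p) / cmod z) *\<^sub>R w"] z0 p(4) hl R_pos[of x] by simp
  show "p = cyl_chart s (cyl_inv s p)"
    unfolding q cyl_chart_def
  proof (rule pt_eqI)
    show e1: "x1 p = s * cyl_x (fst (z, k))" using s by (simp add: xz x_def sign_square)
    show "zeta p = R (s * cyl_x (fst (z, k))) *\<^sub>R
        ((sqrt (1 - (height (z, k))\<^sup>2) / sqrt ((cmod (fst (z, k)))\<^sup>2)) *\<^sub>R fst (z, k))"
      unfolding e1[symmetric] R by (subst zt) simp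
    show "y1 p = R (s * cyl_x (fst (z, k))) * height (z, k)"
      unfolding e1[symmetric] R using h by simp
  qed
qed

lemma cyl_chart_in_leaf:
  assumes "s\<^sup>2 = 1" "(z, k) \<in> cyl_domain"
  shows "cyl_chart s (z, k) \<in> (if k = 0 then leafV s else leafD (sgn k) (sgn k * s / k ^ 8))"
proof -
  define p where "p = cyl_chart s (z, k)"
  note c = cyl_chart_coords[OF assms] cyl_chart_range[OF assms]
  have rG: "0 < G (cyl_x z)" "0 < root8 (G (cyl_x z))"
    using root8_pos G_pos_iff[of "cyl_x z"] cyl_x_bounds[of z] assms(2) by (auto simp: cyl_domain_def)
  have y8: "y1 p ^ 8 = k ^ 8 * G (cyl_x z)"
    using rG root8_power8[of "G (cyl_x z)"] by (simp add: p_def c power_mult_distrib)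
  have "x1 p = s * cyl_x z" using c(2) sign_square[OF assms(1)] by (metis p_def)
  then have Gx: "G (x1 p) = s * G (cyl_x z)" using sign_cases[OF assms(1)] by (auto simp: G_odd)
  have xa: "\<bar>x1 p\<bar> < a" using c(5,6) sign_cases[OF assms(1)] by (auto simp: p_def)
  show ?thesis
  proof (cases "k = 0")
    case True
    then show ?thesis using c by (simp add: leafV_def)
  next
    case False
    have "sgn k * y1 p = \<bar>k\<bar> * root8 (G (cyl_x z))" by (simp add: p_def c abs_sgn)
    then have "0 < sgn k * y1 p" using rG False by simp
    moreover have "sgn k * G (x1 p) = sgn k * s / k ^ 8 * y1 p ^ 8"
      using False by (simp add: Gx y8)
    ultimately have "p \<in> leafD (sgn k) (sgn k * s / k ^ 8)" using c(1) xa by (simp add: leafD_def p_def)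
    then show ?thesis using False by (simp add: p_def)
  qed
qed

lemma foliated_at_cylinder:
  assumes s: "s\<^sup>2 = 1" and p: "p \<in> leafV s"
  shows "foliated_at M leaves p"
proof -
  have sz: "smooth_on UNIV zeta" by (intro smooth_intros) auto
  let ?N = "{p :: R4. 0 < s * x1 p \<and> s * x1 p < a \<and> zeta p \<noteq> 0}"
  have "(cmod (zeta p))\<^sup>2 = R2 (x1 p)" using p by (auto simp: leafV_def energy_iff)
  then have pp: "H p = E" "0 < s * x1 p" "s * x1 p < a" "zeta p \<noteq> 0" "y1 p = 0"
    using p R2_lower(2)[of "x1 p"] by (auto simp: leafV_def)
  show ?thesis
  proof (rule foliated_atI[where V=cyl_domain and \<Phi>="cyl_chart s" and g="cyl_inv s"
        and half=False and N="?N" and z\<^sub>0="fst (cyl_inv s p)" and c\<^sub>0="snd (cyl_inv s p)",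
        OF open_cyl_domain smooth_cyl_chart])
    show "cyl_inv s (cyl_chart s q) = q" if "q \<in> cyl_domain" for q by (rule cyl_inv_chart[OF s that])
    show "cyl_inv s differentiable (at (cyl_chart s q))" if "q \<in> cyl_domain" for q
      using cyl_chart_range[OF s, of "fst q" "snd q"] that by (intro cyl_inv_differentiable) auto
    show "open ?N"
      by (intro open_Collect_conj open_Collect_less open_Collect_neq continuous_intros smooth_on_imp_continuous[OF sz])
    show "M \<inter> ?N = cyl_chart s ` {q \<in> cyl_domain. False \<longrightarrow> 0 \<le> snd q}" (is "_ = ?I")
    proof
      show "M \<inter> ?N \<subseteq> ?I" using cyl_chart_surj[OF s] by (fastforce simp: M_def strip_def)
      show "?I \<subseteq> M \<inter> ?N"
      proof (rule image_subsetI)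
        fix q assume "q \<in> {q \<in> cyl_domain. False \<longrightarrow> 0 \<le> snd q}"
        then obtain z k where q: "q = (z, k)" "(z, k) \<in> cyl_domain" by (cases q) auto
        show "cyl_chart s q \<in> M \<inter> ?N"
          using cyl_chart_range[OF s q(2)] cyl_chart_coords(1)[OF s q(2)] sign_cases[OF s]
          by (auto simp: q(1) M_def strip_def bind_orbits_def)
      qed
    qed
    show "\<exists>L\<in>leaves. \<forall>z. (z, c) \<in> cyl_domain \<longrightarrow> cyl_chart s (z, c) \<in> L" for c
    proof (intro bexI allI impI)
      show "cyl_chart s (z, c) \<in> (if c = 0 then leafV s else leafD (sgn c) (sgn c * s / c ^ 8))"
        if "(z, c) \<in> cyl_domain" for z using cyl_chart_in_leaf[OF s that] .
      have "c \<noteq> 0 \<Longrightarrow> (sgn c)\<^sup>2 = 1" by (simp add: sgn_if)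
      then show "(if c = 0 then leafV s else leafD (sgn c) (sgn c * s / c ^ 8)) \<in> leaves"
        using s by (auto simp: leaves_def)
    qed
    show "(fst (cyl_inv s p), snd (cyl_inv s p)) \<in> cyl_domain"
      "cyl_chart s (fst (cyl_inv s p), snd (cyl_inv s p)) = p"
      using cyl_chart_surj[OF s pp(1-4)] by auto
  qed (use s in \<open>auto simp: leaves_def\<close>)
qed

lemma proper_cylinder_leafV:
  assumes s: "s\<^sup>2 = 1" shows "proper_cylinder M (leafV s)"
  unfolding proper_cylinder_def
proof (intro conjI exI)
  let ?f = "\<lambda>z. cyl_chart s (z, 0)"
  have dom: "(z, 0) \<in> cyl_domain" if "z \<noteq> 0" for z using that by (simp add: cyl_domain_def height_def)
  have o: "open (- {0 :: complex})" by auto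
  show "smooth_embedding (- {0}) ?f"
  proof (rule smooth_embeddingI[where g="\<lambda>p. fst (cyl_inv s p)", OF o])
    have "smooth_on (- {0 :: complex}) (\<lambda>z. (z, 0 :: real))" by (intro smooth_intros o)
    from smooth_on_compose[OF smooth_cyl_chart this o open_cyl_domain]
    show "smooth_on (- {0}) ?f" using dom by simp
    show "fst (cyl_inv s (?f z)) = z" if "z \<in> - {0}" for z
      using cyl_inv_chart[OF s dom] that by simp
    show "(\<lambda>p. fst (cyl_inv s p)) differentiable (at (?f z))" if "z \<in> - {0}" for z
    proof -
      have "cyl_inv s differentiable (at (?f z))"
        using cyl_chart_range[OF s dom[of z]] that by (intro cyl_inv_differentiable) auto
      then show ?thesis by (auto simp: differentiable_def intro: has_derivative_fst)
    qed
  qed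
  show "leafV s = ?f ` (- {0})"
  proof
    show "?f ` (- {0}) \<subseteq> leafV s"
    proof (rule image_subsetI)
      fix z :: complex assume "z \<in> - {0}"
      then show "?f z \<in> leafV s" using cyl_chart_in_leaf[OF s dom[of z]] by simp
    qed
    show "leafV s \<subseteq> ?f ` (- {0})"
    proof
      fix p assume p: "p \<in> leafV s"
      have "(cmod (zeta p))\<^sup>2 = R2 (x1 p)" using p by (auto simp: leafV_def energy_iff)
      then have pp: "H p = E" "0 < s * x1 p" "s * x1 p < a" "zeta p \<noteq> 0" "y1 p = 0"
        using p R2_lower(2)[of "x1 p"] by (auto simp: leafV_def)
      have "snd (cyl_inv s p) = 0" using pp(5) by (simp add: cyl_inv_def)
      then have "p = ?f (fst (cyl_inv s p))" "fst (cyl_inv s p) \<noteq> 0"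
        using cyl_chart_surj[OF s pp(1-4)] by (auto simp: cyl_domain_def) (metis prod.collapse)
      then show "p \<in> ?f ` (- {0})" by blast
    qed
  qed
  have "closed {p :: R4. y1 p = 0 \<and> 0 \<le> s * x1 p}"
    by (intro closed_Collect_conj closed_Collect_eq closed_Collect_le continuous_intros)
  moreover have "leafV s = M \<inter> {p. y1 p = 0 \<and> 0 \<le> s * x1 p}"
    using sign_cases[OF s] a_pos by (auto simp: leafV_def M_def strip_def bind_orbits_def)
  ultimately show "closedin (top_of_set M) (leafV s)" by (auto simp: closedin_closed)
qed

lemma M_cases:
  assumes "p \<in> M"
  obtains (saddle) s1 s2 where "s1\<^sup>2 = 1" "s2\<^sup>2 = 1" "p \<in> leafU s1 s2"
    | (cylinder) s where "s\<^sup>2 = 1" "p \<in> leafV s"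
    | (family) s where "s\<^sup>2 = 1" "\<bar>x1 p\<bar> < a" "0 < s * y1 p" "p \<in> leafD s (s * G (x1 p) / y1 p ^ 8)"
proof (cases "y1 p = 0")
  case True
  then have "x1 p \<noteq> 0" "\<bar>x1 p\<bar> < a" "H p = E"
    using assms a_pos by (auto simp: M_def strip_def bind_orbits_def)
  then have "(sgn (x1 p))\<^sup>2 = 1" "p \<in> leafV (sgn (x1 p))"
    using True by (auto simp: leafV_def sgn_if)
  then show ?thesis by (rule cylinder)
next
  case False
  then have s2: "(sgn (y1 p))\<^sup>2 = 1" "0 < sgn (y1 p) * y1 p" by (auto simp: sgn_if)
  show ?thesis
  proof (cases "\<bar>x1 p\<bar> < a")
    case True
    then show ?thesis using family[of "sgn (y1 p)"] s2 assms
      by (auto simp: leafD_def M_def strip_def)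
  next
    case False
    then have "\<bar>x1 p\<bar> = a" using assms by (auto simp: M_def strip_def)
    then have "(sgn (x1 p))\<^sup>2 = 1" "x1 p = sgn (x1 p) * a" using a_pos by (auto simp: sgn_if)
    then show ?thesis using saddle[of "sgn (x1 p)" "sgn (y1 p)"] s2 assms
      by (simp add: leafU_def M_def strip_def)
  qed
qed

lemma foliated_at_M:
  assumes "p \<in> M" shows "foliated_at M leaves p"
  using assms
proof (cases rule: M_cases)
  case (saddle s1 s2)
  then show ?thesis by (rule foliated_at_saddle)
next
  case (cylinder s)
  then show ?thesis by (rule foliated_at_cylinder)
next
  case (family s)
  then show ?thesis using assms by (intro foliated_at_family) (auto simp: M_def strip_def)
qed

section \<open>Closures of the leaves\<close>

lemma continuous_on_X [continuous_intros]:
  assumes "continuous_on S f" shows "continuous_on S (\<lambda>x. X (f x))"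
proof -
  have "smooth_on UNIV X" using smooth_X[OF smooth_on_id[OF open_UNIV] open_UNIV] .
  from continuous_on_compose2[OF smooth_on_imp_continuous[OF this] assms] show ?thesis by simp
qed

lemma continuous_on_R [continuous_intros]:
  assumes "continuous_on S f" shows "continuous_on S (\<lambda>x. R (f x))"
proof -
  have "smooth_on UNIV R" using smooth_R[OF smooth_on_id[OF open_UNIV] open_UNIV] .
  from continuous_on_compose2[OF smooth_on_imp_continuous[OF this] assms] show ?thesis by simp
qed

lemma continuous_on_u_inv [continuous_intros]:
  fixes f :: "'x::topological_space \<Rightarrow> real"
  assumes "continuous_on S f" shows "continuous_on S (\<lambda>x. u_inv (f x))"
proof -
  have "smooth_on UNIV u_inv" using smooth_u_inv[OF smooth_on_id[OF open_UNIV] open_UNIV] .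
  from continuous_on_compose2[OF smooth_on_imp_continuous[OF this] assms] show ?thesis by simp
qed

lemma continuous_on_pt [continuous_intros]:
  assumes "continuous_on S f" "continuous_on S z" "continuous_on S m"
  shows "continuous_on S (\<lambda>q. pt (f q) (z q) (m q))"
  unfolding pt_def by (intro continuous_intros assms)

lemma pt_inverse: "zeta (pt x \<zeta> m) /\<^sub>R R (x1 (pt x \<zeta> m)) = \<zeta>"
  using R_pos[of x] by simp

definition circle :: "real \<Rightarrow> R4 set" where
  "circle x = {p. H p = E \<and> y1 p = 0 \<and> x1 p = x}"

text \<open>A disc that is a graph \<open>x\<^sub>1 = f(\<mu>)\<close> over a hemisphere of the fibre sphere, where \<open>\<mu>\<close> is the
  height \<open>|y\<^sub>1| / R(x\<^sub>1)\<close>.  Both the hemispheres over the saddles and the planes of the families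
  have this form.\<close>

definition disc :: "real \<Rightarrow> (real \<Rightarrow> real) \<Rightarrow> complex \<Rightarrow> R4" where
  "disc s f w = pt (f (sqrt (1 - (cmod w)\<^sup>2))) w (s * sqrt (1 - (cmod w)\<^sup>2))"

lemma disc_inj: "inj_on (disc s f) S"
  by (rule inj_on_inverseI[where g="\<lambda>p. zeta p /\<^sub>R R (x1 p)"]) (simp only: disc_def pt_inverse)

lemma disc_continuous: "continuous_on {0..1} f \<Longrightarrow> continuous_on (cball 0 1) (disc s f)"
proof -
  assume f: "continuous_on {0..1} f"
  have "continuous_on (cball 0 1) (\<lambda>w :: complex. f (sqrt (1 - (cmod w)\<^sup>2)))"
    by (rule continuous_on_compose2[OF f]) (auto intro!: continuous_intros simp: power_le_one)
  then show ?thesis unfolding disc_def by (intro continuous_intros)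
qed

lemma disc_image:
  assumes s: "s\<^sup>2 = 1" and W: "\<And>w. w \<in> W \<longleftrightarrow> cmod w \<le> 1 \<and> P (sqrt (1 - (cmod w)\<^sup>2))"
  shows "disc s f ` W = {p. H p = E \<and> 0 \<le> s * y1 p \<and> P (s * y1 p / R (x1 p)) \<and>
     x1 p = f (s * y1 p / R (x1 p))}" (is "_ = ?L")
proof
  show "disc s f ` W \<subseteq> ?L"
  proof (rule image_subsetI)
    fix w assume w: "w \<in> W"
    define \<mu> where "\<mu> = sqrt (1 - (cmod w)\<^sup>2)"
    have "cmod w \<le> 1" using w W by blast
    then have \<mu>: "0 \<le> \<mu>" "\<mu>\<^sup>2 = 1 - (cmod w)\<^sup>2" by (auto simp: \<mu>_def power_le_one)
    have d: "disc s f w = pt (f \<mu>) w (s * \<mu>)" by (simp add: disc_def \<mu>_def)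
    have y: "s * y1 (disc s f w) = R (f \<mu>) * \<mu>" using s by (simp add: d sign_square mult.left_commute)
    have "H (disc s f w) = E"
      unfolding d using \<mu> s by (intro energy_pt) (simp add: power_mult_distrib)
    moreover have "P \<mu>" using w W by (simp add: \<mu>_def)
    moreover have "s * y1 (disc s f w) / R (x1 (disc s f w)) = \<mu>"
      unfolding y using R_pos[of "f \<mu>"] by (simp add: d)
    moreover have "x1 (disc s f w) = f \<mu>" by (simp add: d)
    moreover have "0 \<le> s * y1 (disc s f w)" unfolding y using \<mu> R_pos[of "f \<mu>"] by simp
    ultimately show "disc s f w \<in> ?L" by simp
  qed
  show "?L \<subseteq> disc s f ` W"
  proof
    fix p assume p: "p \<in> ?L"
    then have H: "H p = E" by blast
    obtain w m where e: "p = pt (x1 p) w m" "(cmod w)\<^sup>2 + m\<^sup>2 = 1" "m = y1 p / R (x1 p)"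
      using pt_surj[OF H] by metis
    have sm: "s * m = s * y1 p / R (x1 p)" by (simp add: e(3))
    have "0 \<le> s * m" unfolding sm using p R_pos[of "x1 p"] by simp
    moreover have "(s * m)\<^sup>2 = 1 - (cmod w)\<^sup>2" using e(2) s by (simp add: power_mult_distrib)
    ultimately have \<mu>: "sqrt (1 - (cmod w)\<^sup>2) = s * m" by (metis real_sqrt_unique)
    have "s * (s * m) = m" using s by (simp add: sign_square)
    then have "p = disc s f w" unfolding disc_def \<mu> using e(1) p sm by simp
    moreover have "(cmod w)\<^sup>2 \<le> 1\<^sup>2" using e(2) zero_le_power2[of m] unfolding one_power2 by linarith
    then have "cmod w \<le> 1" by (rule power2_le_imp_le) simp
    then have "w \<in> W" using W \<mu> p sm by simp
    ultimately show "p \<in> disc s f ` W" by blast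
  qed
qed

lemma disc_image_ball:
  assumes "s\<^sup>2 = 1"
  shows "disc s f ` ball 0 1 = {p. H p = E \<and> 0 < s * y1 p \<and> x1 p = f (s * y1 p / R (x1 p))}"
proof -
  have "w \<in> ball 0 1 \<longleftrightarrow> cmod w \<le> 1 \<and> 0 < sqrt (1 - (cmod w)\<^sup>2)" for w :: complex
    by (auto simp: abs_square_less_1 power2_less_1_iff)
  from disc_image[OF assms this, of f] show ?thesis
    using R_pos by (auto simp: zero_less_divide_iff)
qed

lemma disc_image_cball:
  assumes "s\<^sup>2 = 1"
  shows "disc s f ` cball 0 1 = {p. H p = E \<and> 0 \<le> s * y1 p \<and> x1 p = f (s * y1 p / R (x1 p))}"
  using disc_image[OF assms, of "cball 0 1" "\<lambda>_. True" f] by simp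

lemma disc_image_sphere:
  assumes "s\<^sup>2 = 1" shows "disc s f ` sphere 0 1 = circle (f 0)"
proof -
  have "w \<in> sphere 0 1 \<longleftrightarrow> cmod w \<le> 1 \<and> sqrt (1 - (cmod w)\<^sup>2) = 0" for w :: complex
    by (auto simp: abs_square_eq_1 power2_eq_1_iff)
  from disc_image[OF assms this, of f] have
    "disc s f ` sphere 0 1 = {p. H p = E \<and> 0 \<le> s * y1 p \<and> s * y1 p / R (x1 p) = 0 \<and>
     x1 p = f (s * y1 p / R (x1 p))}" .
  also have "\<dots> = circle (f 0)"
    using R_pos assms sign_cases[OF assms] by (auto simp: circle_def less_imp_neq[symmetric])
  finally show ?thesis .
qed

lemma leafU_eq_disc: "s2\<^sup>2 = 1 \<Longrightarrow> leafU s1 s2 = disc s2 (\<lambda>_. s1 * a) ` ball 0 1"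
  by (auto simp: disc_image_ball leafU_def)

lemma u_0: "u 0 = 0" by (simp add: u_def G_def)

lemma u_odd: "u (- x) = - u x" by (simp add: u_def G_odd R2_even)

lemma leafD_eq_disc:
  assumes "s\<^sup>2 = 1" shows "leafD s C = disc s (\<lambda>\<mu>. u_inv (s * C * \<mu> ^ 8)) ` ball 0 1"
proof -
  have "(\<bar>x1 p\<bar> < a \<and> s * G (x1 p) = C * y1 p ^ 8) \<longleftrightarrow> x1 p = u_inv (s * C * (s * y1 p / R (x1 p)) ^ 8)" for p
  proof -
    have "R (x1 p) ^ 8 = ((R (x1 p))\<^sup>2) ^ 4" "s ^ 8 = (s\<^sup>2) ^ 4" by (simp_all flip: power_mult)
    then have e: "(s * y1 p / R (x1 p)) ^ 8 = y1 p ^ 8 / R2 (x1 p) ^ 4"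
      using assms by (simp add: R_square power_divide power_mult_distrib)
    have "s * G (x1 p) = C * y1 p ^ 8 \<longleftrightarrow> G (x1 p) = s * C * y1 p ^ 8"
      using sign_cases[OF assms] by auto
    also have "\<dots> \<longleftrightarrow> u (x1 p) = s * C * (s * y1 p / R (x1 p)) ^ 8"
      unfolding e u_def using R2_lower(2)[of "x1 p"] by (simp add: field_simps)
    finally have "s * G (x1 p) = C * y1 p ^ 8 \<longleftrightarrow> u (x1 p) = s * C * (s * y1 p / R (x1 p)) ^ 8" .
    then show ?thesis using u_inv u_inv_u by metis
  qed
  then show ?thesis unfolding disc_image_ball[OF assms] leafD_def by blast
qed

lemma closure_leafU:
  assumes "s2\<^sup>2 = 1"
  shows "closure (leafU s1 s2) = {p. H p = E \<and> x1 p = s1 * a \<and> 0 \<le> s2 * y1 p}"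
proof -
  have "closure (leafU s1 s2) = disc s2 (\<lambda>_. s1 * a) ` cball 0 1"
    unfolding leafU_eq_disc[OF assms] by (intro closure_disc_image disc_continuous continuous_intros)
  then show ?thesis by (auto simp: disc_image_cball[OF assms])
qed

lemma asymptotic_leafU:
  assumes "s2\<^sup>2 = 1" shows "asymptotic_to (leafU s1 s2) (circle (s1 * a))"
  unfolding leafU_eq_disc[OF assms] disc_image_sphere[OF assms, of "\<lambda>_. s1 * a", symmetric]
  by (intro asymptotic_to_disc disc_continuous disc_inj continuous_intros)

lemma asymptotic_leafD:
  assumes "s\<^sup>2 = 1" shows "asymptotic_to (leafD s C) (circle 0)"
proof -
  have "u_inv (s * C * 0 ^ 8) = 0" using u_inv_u[of 0] a_pos by (simp add: u_0)
  then show ?thesis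
    unfolding leafD_eq_disc[OF assms]
    using asymptotic_to_disc[OF disc_continuous disc_inj, of "\<lambda>\<mu>. u_inv (s * C * \<mu> ^ 8)" s]
      disc_image_sphere[OF assms, of "\<lambda>\<mu>. u_inv (s * C * \<mu> ^ 8)"]
    by (simp add: continuous_on_u_inv continuous_on_mult continuous_on_power)
qed

definition band :: "real \<Rightarrow> complex \<Rightarrow> R4" where
  "band s w = pt (s * (a * (cmod w - 1))) (w /\<^sub>R cmod w) 0"

lemma band_coords:
  assumes "s\<^sup>2 = 1" "w \<noteq> 0"
  shows "H (band s w) = E" "s * x1 (band s w) = a * (cmod w - 1)" "y1 (band s w) = 0"
    "(1 + s * x1 (band s w) / a) *\<^sub>R (zeta (band s w) /\<^sub>R R (x1 (band s w))) = w"
proof -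
  show "H (band s w) = E"
    unfolding band_def using assms(2) by (intro energy_pt) simp
  show x: "s * x1 (band s w) = a * (cmod w - 1)" using assms(1) by (simp add: band_def sign_square)
  show "y1 (band s w) = 0" by (simp add: band_def)
  have "zeta (band s w) /\<^sub>R R (x1 (band s w)) = w /\<^sub>R cmod w" unfolding band_def by (rule pt_inverse)
  moreover have "1 + s * x1 (band s w) / a = cmod w" unfolding x using a_pos by simp
  ultimately show "(1 + s * x1 (band s w) / a) *\<^sub>R (zeta (band s w) /\<^sub>R R (x1 (band s w))) = w"
    using assms(2) by simp
qed

lemma band_image:
  assumes s: "s\<^sup>2 = 1" and W: "\<And>w. w \<in> W \<longleftrightarrow> cmod w \<in> T" "T \<subseteq> {1..}"
  shows "band s ` W = {p. H p = E \<and> y1 p = 0 \<and> 1 + s * x1 p / a \<in> T}" (is "_ = ?L")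
proof
  show "band s ` W \<subseteq> ?L"
  proof (rule image_subsetI)
    fix w assume w: "w \<in> W"
    then have "w \<noteq> 0" using W by force
    then show "band s w \<in> ?L" using band_coords[OF s, of w] w W(1) a_pos by simp
  qed
  show "?L \<subseteq> band s ` W"
  proof
    fix p assume p: "p \<in> ?L"
    then have H: "H p = E" by blast
    obtain \<zeta> m where e: "p = pt (x1 p) \<zeta> m" "(cmod \<zeta>)\<^sup>2 + m\<^sup>2 = 1" "m = y1 p / R (x1 p)"
      using pt_surj[OF H] by metis
    have m: "m = 0" using e(3) p by simp
    then have "(cmod \<zeta>)\<^sup>2 = 1\<^sup>2" using e(2) by simp
    then have "cmod \<zeta> = 1" by (rule power2_eq_imp_eq) simp_all
    note m = m this
    define r where "r = 1 + s * x1 p / a"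
    have r: "r \<in> T" "1 \<le> r" using p W(2) by (auto simp: r_def)
    have n: "cmod (r *\<^sub>R \<zeta>) = r" using r m by simp
    have "s * (a * (r - 1)) = x1 p" using a_pos sign_square(2)[OF s] by (simp add: r_def)
    moreover have "(r *\<^sub>R \<zeta>) /\<^sub>R r = \<zeta>" using r(2) by simp
    ultimately have "p = band s (r *\<^sub>R \<zeta>)" using e(1) m unfolding band_def n by simp
    moreover have "r *\<^sub>R \<zeta> \<in> W" using n r W(1) by simp
    ultimately show "p \<in> band s ` W" by blast
  qed
qed

lemma band_continuous: "continuous_on annulus (band s)"
  unfolding band_def by (intro continuous_intros) (auto simp: annulus_def)

lemma band_inj: "s\<^sup>2 = 1 \<Longrightarrow> inj_on (band s) annulus"
  by (rule inj_on_inverseI[where g="\<lambda>p. (1 + s * x1 p / a) *\<^sub>R (zeta p /\<^sub>R R (x1 p))"], rule band_coords(4))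
    (auto simp: annulus_def)

lemma leafV_eq_band: "s\<^sup>2 = 1 \<Longrightarrow> leafV s = band s ` open_annulus"
proof -
  assume "s\<^sup>2 = 1"
  then have "band s ` open_annulus = {p. H p = E \<and> y1 p = 0 \<and> 1 + s * x1 p / a \<in> {1<..<2}}"
    by (rule band_image) (auto simp: open_annulus_def)
  also have "\<dots> = leafV s" using a_pos unfolding leafV_def by (simp add: zero_less_divide_iff)
  finally show ?thesis by simp
qed

lemma closure_leafV:
  assumes "s\<^sup>2 = 1"
  shows "closure (leafV s) = {p. H p = E \<and> y1 p = 0 \<and> 0 \<le> s * x1 p \<and> s * x1 p \<le> a}"
proof -
  have "closure (leafV s) = band s ` annulus"
    unfolding leafV_eq_band[OF assms] by (rule closure_annulus_image[OF band_continuous])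
  also have "\<dots> = {p. H p = E \<and> y1 p = 0 \<and> 1 + s * x1 p / a \<in> {1..2}}"
    by (rule band_image[OF assms]) (auto simp: annulus_def)
  finally show ?thesis using a_pos by (simp add: zero_le_divide_iff)
qed

lemma asymptotic_leafV:
  assumes "s\<^sup>2 = 1"
  shows "asymptotic_to (leafV s) (circle 0)" "asymptotic_to (leafV s) (circle (s * a))"
proof -
  have "band s ` sphere 0 1 = {p. H p = E \<and> y1 p = 0 \<and> 1 + s * x1 p / a \<in> {1}}"
    by (rule band_image[OF assms]) auto
  also have "\<dots> = circle 0" using a_pos sign_cases[OF assms] by (auto simp: circle_def)
  finally have 1: "band s ` sphere 0 1 = circle 0" .
  have "band s ` sphere 0 2 = {p. H p = E \<and> y1 p = 0 \<and> 1 + s * x1 p / a \<in> {2}}"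
    by (rule band_image[OF assms]) auto
  also have "\<dots> = circle (s * a)" using a_pos sign_cases[OF assms] by (auto simp: circle_def field_simps)
  finally have 2: "band s ` sphere 0 2 = circle (s * a)" .
  show "asymptotic_to (leafV s) (circle 0)" "asymptotic_to (leafV s) (circle (s * a))"
    using asymptotic_to_annulus[OF band_continuous band_inj[OF assms]] leafV_eq_band[OF assms] 1 2 by simp_all
qed

section \<open>Breaking of the families of planes\<close>

lemma C_of_large:
  assumes "0 < K" "0 < \<tau>" "\<tau> < 1 / 4" "\<tau> < 1 / (16 * K\<^sup>2)"
  shows "K \<le> C_of \<tau>"
proof -
  have "sqrt (\<tau> * (1 - \<tau>)) \<le> sqrt (1 / (16 * K\<^sup>2))"
    using assms mult_left_mono[of "1 - \<tau>" 1 \<tau>] by (intro real_sqrt_le_mono) linarith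
  also have "\<dots> = 1 / (4 * K)" using assms(1) by (simp add: real_sqrt_divide real_sqrt_mult)
  finally have "sqrt (\<tau> * (1 - \<tau>)) * K \<le> 1 / 4" using assms(1) by (simp add: field_simps)
  also have "\<dots> \<le> 1 / 2 - \<tau>" using assms(3) by simp
  finally show ?thesis using assms by (simp add: C_of_def field_simps)
qed

lemma C_of_reflect: "C_of (1 - \<tau>) = - C_of \<tau>"
proof -
  have "(1 - \<tau>) * (1 - (1 - \<tau>)) = \<tau> * (1 - \<tau>)" "1 / 2 - (1 - \<tau>) = - (1 / 2 - \<tau>)" by simp_all
  then show ?thesis unfolding C_of_def by (simp only: minus_divide_left)
qed

lemma C_of_at_0: "\<forall>\<^sub>F \<tau> in at_right 0. K \<le> C_of \<tau>"
proof -
  let ?K = "max K 1"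
  have "?K \<le> C_of \<tau>" if "0 < \<tau>" "\<tau> < min (1 / 4) (1 / (16 * ?K\<^sup>2))" for \<tau>
    using that by (intro C_of_large) auto
  then have "\<forall>\<tau>>0. \<tau> < min (1 / 4) (1 / (16 * ?K\<^sup>2)) \<longrightarrow> K \<le> C_of \<tau>" by force
  moreover have "0 < min (1 / 4) (1 / (16 * ?K\<^sup>2))" by simp
  ultimately show ?thesis unfolding eventually_at_right_field by blast
qed

lemma C_of_at_1: "\<forall>\<^sub>F \<tau> in at_left 1. K \<le> - C_of \<tau>"
proof -
  obtain b where b: "0 < b" "\<And>\<tau>. 0 < \<tau> \<Longrightarrow> \<tau> < b \<Longrightarrow> K \<le> C_of \<tau>"
    using C_of_at_0[of K] unfolding eventually_at_right_field by blast
  have "K \<le> - C_of \<tau>" if "1 - b < \<tau>" "\<tau> < 1" for \<tau>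
    using b(2)[of "1 - \<tau>"] that by (simp add: C_of_reflect)
  then show ?thesis unfolding eventually_at_left_field using b(1) by (intro exI[of _ "1 - b"]) auto
qed

text \<open>Distances on \<open>S\<^sub>E\<close> can be controlled by the coordinates of the sphere bundle.\<close>

lemma pt_uniformly_continuous:
  assumes "0 < \<eta>"
  obtains \<delta> where "0 < \<delta>"
    "\<And>x \<zeta> m x' \<zeta>' m'. \<bar>x\<bar> \<le> a \<Longrightarrow> \<bar>x'\<bar> \<le> a \<Longrightarrow> cmod \<zeta> \<le> 1 \<Longrightarrow> cmod \<zeta>' \<le> 1 \<Longrightarrow> \<bar>m\<bar> \<le> 1 \<Longrightarrow> \<bar>m'\<bar> \<le> 1 \<Longrightarrow>
       \<bar>x - x'\<bar> \<le> \<delta> \<Longrightarrow> cmod (\<zeta> - \<zeta>') \<le> \<delta> \<Longrightarrow> \<bar>m - m'\<bar> \<le> \<delta> \<Longrightarrow> dist (pt x \<zeta> m) (pt x' \<zeta>' m') < \<eta>"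
proof -
  let ?K = "{-a..a} \<times> cball (0::complex) 1 \<times> {-1..1::real}"
  let ?f = "\<lambda>q. pt (fst q) (fst (snd q)) (snd (snd q))"
  have "continuous_on ?K ?f" by (intro continuous_intros)
  then have "uniformly_continuous_on ?K ?f"
    by (intro compact_uniformly_continuous compact_Times) auto
  then obtain d where d: "0 < d" "\<And>q q'. q \<in> ?K \<Longrightarrow> q' \<in> ?K \<Longrightarrow> dist q' q < d \<Longrightarrow> dist (?f q') (?f q) < \<eta>"
    using assms unfolding uniformly_continuous_on_def by metis
  show thesis
  proof (rule that[of "d / 4"])
    show "0 < d / 4" using d(1) by simp
    fix x x' m m' :: real and \<zeta> \<zeta>' :: complex
    assume "\<bar>x\<bar> \<le> a" "\<bar>x'\<bar> \<le> a" "cmod \<zeta> \<le> 1" "cmod \<zeta>' \<le> 1" "\<bar>m\<bar> \<le> 1" "\<bar>m'\<bar> \<le> 1"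
    then have K: "(x, \<zeta>, m) \<in> ?K" "(x', \<zeta>', m') \<in> ?K" by auto
    assume cl: "\<bar>x - x'\<bar> \<le> d / 4" "cmod (\<zeta> - \<zeta>') \<le> d / 4" "\<bar>m - m'\<bar> \<le> d / 4"
    have "dist (x, \<zeta>, m) (x', \<zeta>', m') \<le> \<bar>x - x'\<bar> + norm (\<zeta> - \<zeta>', m - m')"
      using norm_Pair_le[of "x - x'" "(\<zeta> - \<zeta>', m - m')"] by (simp add: dist_norm)
    also have "norm (\<zeta> - \<zeta>', m - m') \<le> cmod (\<zeta> - \<zeta>') + \<bar>m - m'\<bar>"
      using norm_Pair_le[of "\<zeta> - \<zeta>'" "m - m'"] by simp
    finally have "dist (x, \<zeta>, m) (x', \<zeta>', m') < d" using cl d(1) by linarith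
    then show "dist (pt x \<zeta> m) (pt x' \<zeta>' m') < \<eta>" using d(2)[OF K(2,1)] by simp
  qed
qed

lemma pt_in_leafD:
  assumes "s\<^sup>2 = 1" "0 < s * m" "(cmod \<zeta>)\<^sup>2 + m\<^sup>2 = 1" "\<bar>x\<bar> < a" "u x = s * C * (s * m) ^ 8"
  shows "pt x \<zeta> m \<in> leafD s C"
proof -
  have "s * y1 (pt x \<zeta> m) / R (x1 (pt x \<zeta> m)) = s * m" using R_pos[of x] by simp
  moreover have "u_inv (s * C * (s * m) ^ 8) = x" using u_inv_u[OF assms(4)] assms(5) by simp
  moreover have "0 < s * y1 (pt x \<zeta> m)" 
    using mult_pos_pos[OF R_pos[of x] assms(2)] by (simp add: mult.left_commute)
  ultimately show ?thesis
    unfolding leafD_eq_disc[OF assms(1)] disc_image_ball[OF assms(1)] using energy_pt[OF assms(3)] by simp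
qed

lemma leafD_pt:
  assumes "s\<^sup>2 = 1" "p \<in> leafD s C"
  obtains x \<zeta> m where "p = pt x \<zeta> m" "0 < s * m" "(cmod \<zeta>)\<^sup>2 + m\<^sup>2 = 1" "\<bar>x\<bar> < a" "u x = s * C * (s * m) ^ 8"
proof -
  from assms(2) have p: "H p = E" "0 < s * y1 p"
    "x1 p = u_inv (s * C * (s * y1 p / R (x1 p)) ^ 8)"
    unfolding leafD_eq_disc[OF assms(1)] disc_image_ball[OF assms(1)] by auto
  obtain \<zeta> m where e: "p = pt (x1 p) \<zeta> m" "(cmod \<zeta>)\<^sup>2 + m\<^sup>2 = 1" "m = y1 p / R (x1 p)"
    using pt_surj[OF p(1)] by metis
  have "0 < s * m" using p(2) R_pos[of "x1 p"] by (simp add: e(3))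
  moreover have "\<bar>x1 p\<bar> < a" using p(3) u_inv(1) by metis
  moreover have "u (x1 p) = s * C * (s * m) ^ 8" using p(3) u_inv(2) by (metis e(3) times_divide_eq_right)
  ultimately show thesis using that e by blast
qed

lemma one_minus_sqrt_le: "0 \<le> \<mu> \<Longrightarrow> \<mu> \<le> 1 \<Longrightarrow> 1 - sqrt (1 - \<mu>\<^sup>2) \<le> \<mu>" for \<mu> :: real
proof -
  assume \<mu>: "0 \<le> \<mu>" "\<mu> \<le> 1"
  have "(1 - \<mu>)\<^sup>2 \<le> 1 - \<mu>\<^sup>2" using \<mu> mult_left_mono[of \<mu> 1 \<mu>] by (simp add: power2_eq_square algebra_simps)
  then have "1 - \<mu> \<le> sqrt (1 - \<mu>\<^sup>2)" by (rule real_le_rsqrt)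
  then show ?thesis by simp
qed

lemma sign_abs: "(s::real)\<^sup>2 = 1 \<Longrightarrow> \<bar>s * x\<bar> = \<bar>x\<bar>"
  using sign_cases[of s] by auto

lemma u_sign: "s\<^sup>2 = 1 \<Longrightarrow> u (s * x) = s * u x"
  using sign_cases[of s] by (auto simp: u_odd)

lemma u_le_iff: "\<bar>x\<bar> < a \<Longrightarrow> \<bar>y\<bar> < a \<Longrightarrow> u x \<le> u y \<longleftrightarrow> x \<le> y"
  using u_strict_mono[of x y] u_strict_mono[of y x] by (cases x y rule: linorder_cases) auto

text \<open>On \<open>leafD s C\<close> the height \<open>\<mu>\<close> and \<open>t = \<sigma> s x\<^sub>1\<close> satisfy \<open>u(t) = \<sigma> C \<mu>\<^sup>8\<close>.  When \<open>\<sigma> C\<close> is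
  large compared with \<open>u(a - \<kappa>) / \<kappa>\<^sup>8\<close>, a height of at least \<open>\<kappa>\<close> forces \<open>t\<close> to be within \<open>\<kappa>\<close>
  of \<open>a\<close>, and every \<open>t \<le> a - \<kappa>\<close> is attained at a height of at most \<open>\<kappa>\<close>.\<close>

lemma hausdorff_converges_leafD:
  assumes s: "s\<^sup>2 = 1" and \<sigma>: "\<sigma>\<^sup>2 = 1" and C: "\<And>K. \<forall>\<^sub>F \<tau> in F. K \<le> \<sigma> * C_of \<tau>"
  shows "hausdorff_converges (\<lambda>\<tau>. leafD s (C_of \<tau>)) (closure (leafU (\<sigma> * s) s \<union> leafV (\<sigma> * s))) F"
  unfolding hausdorff_converges_def
proof (intro allI impI)
  fix \<eta> :: real assume "0 < \<eta>"
  then obtain \<delta> where \<delta>: "0 < \<delta>"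
    and near: "\<And>x \<zeta> m x' \<zeta>' m'. \<bar>x\<bar> \<le> a \<Longrightarrow> \<bar>x'\<bar> \<le> a \<Longrightarrow> cmod \<zeta> \<le> 1 \<Longrightarrow> cmod \<zeta>' \<le> 1 \<Longrightarrow> \<bar>m\<bar> \<le> 1 \<Longrightarrow> \<bar>m'\<bar> \<le> 1 \<Longrightarrow>
       \<bar>x - x'\<bar> \<le> \<delta> \<Longrightarrow> cmod (\<zeta> - \<zeta>') \<le> \<delta> \<Longrightarrow> \<bar>m - m'\<bar> \<le> \<delta> \<Longrightarrow> dist (pt x \<zeta> m) (pt x' \<zeta>' m') < \<eta>"
    using pt_uniformly_continuous by blast
  define s1 where "s1 = \<sigma> * s"
  have s1: "s1\<^sup>2 = 1" "s1 * \<sigma> = s" "s1 * s = \<sigma>"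
    using sign_cases[OF s] sign_cases[OF \<sigma>] by (auto simp: s1_def)
  define A where "A = closure (leafU s1 s \<union> leafV s1)"
  have A: "p \<in> A \<longleftrightarrow> H p = E \<and> ((x1 p = s1 * a \<and> 0 \<le> s * y1 p) \<or> (y1 p = 0 \<and> 0 \<le> s1 * x1 p \<and> s1 * x1 p \<le> a))" for p
    unfolding A_def closure_Un closure_leafU[OF s] closure_leafV[OF s1(1)] by auto
  define \<kappa> where "\<kappa> = min \<delta> (min (a / 2) (1 / 2))"
  have \<kappa>: "0 < \<kappa>" "\<kappa> \<le> \<delta>" "\<kappa> \<le> a / 2" "\<kappa> < 1" using \<delta> a_pos by (auto simp: \<kappa>_def)
  have ua: "0 < u (a - \<kappa>)" using u_pos[of "a - \<kappa>"] \<kappa> a_pos by simp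
  define K where "K = u (a - \<kappa>) / \<kappa> ^ 8"
  have K: "0 < K" "K * \<kappa> ^ 8 = u (a - \<kappa>)" using ua \<kappa> by (simp_all add: K_def)
  have "\<forall>\<^sub>F \<tau> in F. (\<forall>p\<in>A. \<exists>d\<in>leafD s (C_of \<tau>). dist p d < \<eta>) \<and> (\<forall>d\<in>leafD s (C_of \<tau>). \<exists>p\<in>A. dist p d < \<eta>)"
    using C[of K]
  proof eventually_elim
    case (elim \<tau>)
    define c where "c = C_of \<tau>"
    have c: "K \<le> \<sigma> * c" "0 < \<sigma> * c" using elim K by (auto simp: c_def)
    have high: "a - \<kappa> \<le> t" if "\<bar>t\<bar> < a" "u t = \<sigma> * c * \<mu> ^ 8" "\<kappa> \<le> \<mu>" for t \<mu>
    proof -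
      have "u (a - \<kappa>) \<le> (\<sigma> * c) * \<mu> ^ 8"
        unfolding K(2)[symmetric] using c K \<kappa> that(3) by (intro mult_mono power_mono) auto
      then show ?thesis using u_le_iff[of "a - \<kappa>" t] that \<kappa> a_pos by simp
    qed
    have su: "s1 * (s * c * \<mu> ^ 8) = \<sigma> * c * \<mu> ^ 8" for \<mu> using s1(3) by (metis mult.assoc)
    have "\<exists>d\<in>leafD s c. dist p d < \<eta>" if pA: "p \<in> A" for p
    proof -
      obtain \<zeta> m where e: "p = pt (x1 p) \<zeta> m" "(cmod \<zeta>)\<^sup>2 + m\<^sup>2 = 1" "m = y1 p / R (x1 p)"
        using pt_surj[of p] pA A by metis
      have n1: "cmod \<zeta> \<le> 1" "\<bar>m\<bar> \<le> 1"
        using e(2) by (metis abs_le_square_iff abs_norm_cancel abs_one le_add_same_cancel1 one_power2 zero_le_power2,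
          metis abs_le_square_iff abs_one le_add_same_cancel2 one_power2 zero_le_power2)
      show ?thesis
      proof (cases "x1 p = s1 * a \<and> 0 \<le> s * y1 p")
        case True
        define \<mu> where "\<mu> = s * m"
        have "0 \<le> \<mu>" using True R_pos[of "x1 p"] by (simp add: \<mu>_def e(3))
        moreover have "\<mu> \<le> 1" using n1(2) sign_abs[OF s, of m] by (simp add: \<mu>_def)
        moreover have "\<mu>\<^sup>2 = 1 - (cmod \<zeta>)\<^sup>2" using e(2) s by (simp add: \<mu>_def power_mult_distrib)
        moreover have "s * \<mu> = m" using s by (simp add: \<mu>_def sign_square)
        ultimately have \<mu>: "0 \<le> \<mu>" "\<mu> \<le> 1" "\<mu>\<^sup>2 = 1 - (cmod \<zeta>)\<^sup>2" "s * \<mu> = m" .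
        define \<mu>' where "\<mu>' = max \<mu> \<kappa>"
        have \<mu>': "\<kappa> \<le> \<mu>'" "\<mu> \<le> \<mu>'" "\<mu>' \<le> 1" "\<mu>' - \<mu> \<le> \<kappa>" using \<mu> \<kappa> by (auto simp: \<mu>'_def)
        define \<zeta>' where "\<zeta>' = sqrt (1 - \<mu>'\<^sup>2) *\<^sub>R sgn \<zeta>"
        define x' where "x' = u_inv (s * c * \<mu>' ^ 8)"
        have m': "\<mu>'\<^sup>2 \<le> 1" using \<mu>' \<kappa> by (simp add: power_le_one)
        have \<zeta>: "\<zeta> = sqrt (1 - \<mu>\<^sup>2) *\<^sub>R sgn \<zeta>" unfolding \<mu>(3) by (cases "\<zeta> = 0") (simp_all add: sgn_div_norm)
        have z': "(cmod \<zeta>')\<^sup>2 + (s * \<mu>')\<^sup>2 = 1" "cmod \<zeta>' \<le> 1" "cmod (\<zeta> - \<zeta>') \<le> \<kappa>"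
        proof -
          show 1: "(cmod \<zeta>')\<^sup>2 + (s * \<mu>')\<^sup>2 = 1"
          proof (cases "\<zeta> = 0")
            case True
            then have "\<mu> = 1" using \<mu> by (simp add: power2_eq_1_iff)
            then have "\<mu>' = 1" using \<mu>' by simp
            then show ?thesis using True s by (simp add: \<zeta>'_def)
          next
            case False
            then show ?thesis using m' s by (simp add: \<zeta>'_def norm_sgn power_mult_distrib)
          qed
          then have "(cmod \<zeta>')\<^sup>2 \<le> 1\<^sup>2"
            using zero_le_power2[of "s * \<mu>'"] unfolding one_power2 by linarith
          then show "cmod \<zeta>' \<le> 1" by (rule power2_le_imp_le) simp
          have "cmod (\<zeta> - \<zeta>') = \<bar>sqrt (1 - \<mu>\<^sup>2) - sqrt (1 - \<mu>'\<^sup>2)\<bar> * cmod (sgn \<zeta>)"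
            unfolding \<zeta>'_def by (subst \<zeta>) (simp flip: scaleR_left_diff_distrib)
          also have "\<dots> \<le> \<bar>sqrt (1 - \<mu>\<^sup>2) - sqrt (1 - \<mu>'\<^sup>2)\<bar>"
            by (simp add: norm_sgn)
          also have "\<dots> \<le> \<kappa>"
          proof (cases "\<kappa> \<le> \<mu>")
            case True then show ?thesis using \<kappa> by (simp add: \<mu>'_def)
          next
            case False
            then have mk: "\<mu>' = \<kappa>" by (simp add: \<mu>'_def)
            have "\<mu>\<^sup>2 \<le> \<kappa>\<^sup>2" using False \<mu>(1) by (intro power_mono) auto
            then have "sqrt (1 - \<kappa>\<^sup>2) \<le> sqrt (1 - \<mu>\<^sup>2)" by simp
            moreover have "sqrt (1 - \<mu>\<^sup>2) \<le> 1" by simp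
            moreover have "1 - sqrt (1 - \<kappa>\<^sup>2) \<le> \<kappa>" using one_minus_sqrt_le[of \<kappa>] \<kappa> by simp
            ultimately show ?thesis unfolding mk abs_le_iff by linarith
          qed
          finally show "cmod (\<zeta> - \<zeta>') \<le> \<kappa>" .
        qed
        have x': "\<bar>x'\<bar> < a" "u x' = s * c * \<mu>' ^ 8" using u_inv by (auto simp: x'_def)
        have ss: "s * (s * \<mu>') = \<mu>'" using s by (simp add: sign_square)
        have "u (s1 * x') = \<sigma> * c * \<mu>' ^ 8" using u_sign[OF s1(1)] x'(2) su by simp
        then have "a - \<kappa> \<le> s1 * x'" using high[of "s1 * x'" \<mu>'] x'(1) sign_abs[OF s1(1)] \<mu>'(1) by simp
        moreover have "s1 * x' < a" using x'(1) sign_abs[OF s1(1), of x'] by linarith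
        moreover have "\<bar>s1 * a - x'\<bar> = \<bar>a - s1 * x'\<bar>"
          using sign_abs[OF s1(1), of "s1 * a - x'"] sign_square(2)[OF s1(1)] by (simp add: right_diff_distrib)
        ultimately have xx: "\<bar>s1 * a - x'\<bar> \<le> \<delta>" using \<kappa> by linarith
        have "pt x' \<zeta>' (s * \<mu>') \<in> leafD s c"
          using \<kappa> \<mu>' z' x' s by (intro pt_in_leafD) (simp_all add: ss)
        moreover have "dist (pt (s1 * a) \<zeta> m) (pt x' \<zeta>' (s * \<mu>')) < \<eta>"
        proof (rule near)
          show "\<bar>s1 * a\<bar> \<le> a" using sign_abs[OF s1(1), of a] a_pos by simp
          show "\<bar>s * \<mu>'\<bar> \<le> 1" using sign_abs[OF s, of \<mu>'] \<mu>' \<kappa> by simp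
          have "m - s * \<mu>' = s * (\<mu> - \<mu>')" using \<mu>(4) by (simp add: right_diff_distrib)
          then show "\<bar>m - s * \<mu>'\<bar> \<le> \<delta>" using sign_abs[OF s, of "\<mu> - \<mu>'"] \<mu>' \<kappa> by simp
        qed (use n1 z' x' xx \<kappa> in auto)
        ultimately show ?thesis using e(1) True by metis
      next
        case False
        then have q: "y1 p = 0" "0 \<le> s1 * x1 p" "s1 * x1 p \<le> a" using pA A by auto
        then have m: "m = 0" "cmod \<zeta> = 1"
          using e(2,3) by (auto simp: power2_eq_1_iff) (metis norm_ge_zero not_one_le_zero neg_0_le_iff_le)
        define t where "t = s1 * x1 p"
        define t' where "t' = max \<kappa> (min t (a - \<kappa>))"
        have t': "0 < t'" "t' \<le> a - \<kappa>" "\<bar>t - t'\<bar> \<le> \<kappa>" "t' < a"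
          using q \<kappa> by (auto simp: t'_def t_def)
        define \<mu>' where "\<mu>' = root8 (u t' / (\<sigma> * c))"
        have ut: "0 < u t'" using u_pos t' by simp
        have \<mu>'8: "\<mu>' ^ 8 = u t' / (\<sigma> * c)" using root8_power8 ut c(2) by (simp add: \<mu>'_def)
        have \<mu>'0: "0 < \<mu>'" using root8_pos ut c(2) by (simp add: \<mu>'_def)
        have "u t' \<le> u (a - \<kappa>)" using u_le_iff[of t' "a - \<kappa>"] t' \<kappa> a_pos by simp
        also have "\<dots> \<le> \<sigma> * c * \<kappa> ^ 8" unfolding K(2)[symmetric] using c \<kappa> by (intro mult_right_mono) auto
        finally have "\<mu>' ^ 8 \<le> \<kappa> ^ 8" unfolding \<mu>'8 using c(2) by (simp add: field_simps)
        then have \<mu>'k: "\<mu>' \<le> \<kappa>" using \<kappa> by (metis less_imp_le power_mono_iff \<mu>'0 zero_less_numeral)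
        define \<zeta>' where "\<zeta>' = sqrt (1 - \<mu>'\<^sup>2) *\<^sub>R \<zeta>"
        have m1: "\<mu>'\<^sup>2 \<le> 1" using \<mu>'0 \<mu>'k \<kappa> by (simp add: power_le_one)
        have z': "(cmod \<zeta>')\<^sup>2 + (s * \<mu>')\<^sup>2 = 1" "cmod \<zeta>' \<le> 1" "cmod (\<zeta> - \<zeta>') \<le> \<kappa>"
        proof -
          show "(cmod \<zeta>')\<^sup>2 + (s * \<mu>')\<^sup>2 = 1" using m1 m s by (simp add: \<zeta>'_def power_mult_distrib)
          show "cmod \<zeta>' \<le> 1" using m1 m by (simp add: \<zeta>'_def)
          have "\<zeta> - \<zeta>' = (1 - sqrt (1 - \<mu>'\<^sup>2)) *\<^sub>R \<zeta>" by (simp add: \<zeta>'_def scaleR_left_diff_distrib)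
          then have "cmod (\<zeta> - \<zeta>') = \<bar>1 - sqrt (1 - \<mu>'\<^sup>2)\<bar>" using m by simp
          also have "\<dots> = 1 - sqrt (1 - \<mu>'\<^sup>2)" by simp
          finally show "cmod (\<zeta> - \<zeta>') \<le> \<kappa>" using one_minus_sqrt_le[of \<mu>'] \<mu>'0 \<mu>'k \<kappa> by simp
        qed
        have ss: "s * (s * \<mu>') = \<mu>'" using s by (simp add: sign_square)
        have "\<sigma> * c * \<mu>' ^ 8 = u t'" unfolding \<mu>'8 using c(2) by (metis less_irrefl nonzero_mult_div_cancel_left times_divide_eq_right)
        then have "s1 * u t' = s1 * (\<sigma> * c * \<mu>' ^ 8)" by simp
        also have "\<dots> = s * c * \<mu>' ^ 8" using s1(2) by (metis mult.assoc)
        finally have ux: "u (s1 * t') = s * c * \<mu>' ^ 8" using u_sign[OF s1(1)] by simp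
        have "pt (s1 * t') \<zeta>' (s * \<mu>') \<in> leafD s c"
          using \<mu>'0 z' ux s t' sign_abs[OF s1(1), of t'] by (intro pt_in_leafD) (simp_all add: ss)
        moreover have "dist (pt (x1 p) \<zeta> m) (pt (s1 * t') \<zeta>' (s * \<mu>')) < \<eta>"
        proof (rule near)
          show "\<bar>x1 p\<bar> \<le> a" using q sign_abs[OF s1(1), of "x1 p"] by simp
          show "\<bar>s1 * t'\<bar> \<le> a" using t' sign_abs[OF s1(1), of t'] by simp
          have "x1 p - s1 * t' = s1 * (t - t')"
            using sign_square(2)[OF s1(1)] by (simp add: t_def right_diff_distrib)
          then show "\<bar>x1 p - s1 * t'\<bar> \<le> \<delta>" using sign_abs[OF s1(1)] t'(3) \<kappa> by simp
          show "\<bar>s * \<mu>'\<bar> \<le> 1" "\<bar>m - s * \<mu>'\<bar> \<le> \<delta>"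
            using sign_abs[OF s, of \<mu>'] \<mu>'0 \<mu>'k \<kappa> m by simp_all
        qed (use n1 z' \<kappa> in auto)
        ultimately show ?thesis using e(1) by metis
      qed
    qed
    moreover have "\<exists>p\<in>A. dist p d < \<eta>" if d: "d \<in> leafD s c" for d
    proof -
      obtain x \<zeta> m where e: "d = pt x \<zeta> m" "0 < s * m" "(cmod \<zeta>)\<^sup>2 + m\<^sup>2 = 1" "\<bar>x\<bar> < a" "u x = s * c * (s * m) ^ 8"
        using leafD_pt[OF s d] by blast
      have n1: "cmod \<zeta> \<le> 1" "\<bar>m\<bar> \<le> 1"
        using e(3) by (metis abs_le_square_iff abs_norm_cancel abs_one le_add_same_cancel1 one_power2 zero_le_power2,
          metis abs_le_square_iff abs_one le_add_same_cancel2 one_power2 zero_le_power2)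
      have t: "\<bar>s1 * x\<bar> < a" "u (s1 * x) = \<sigma> * c * (s * m) ^ 8"
        using e(4,5) s1(3) sign_abs[OF s1(1)] u_sign[OF s1(1)] by simp_all
      have sa: "\<bar>s1 * a\<bar> \<le> a" using sign_abs[OF s1(1), of a] a_pos by simp
      show ?thesis
      proof (cases "\<kappa> \<le> s * m")
        case True
        have "a - \<kappa> \<le> s1 * x" by (rule high[OF t True])
        moreover have "\<bar>s1 * a - x\<bar> = \<bar>a - s1 * x\<bar>"
          using sign_abs[OF s1(1), of "s1 * a - x"] sign_square(2)[OF s1(1)] by (simp add: right_diff_distrib)
        ultimately have xx: "\<bar>s1 * a - x\<bar> \<le> \<delta>" using t(1) \<kappa> by linarith
        have "pt (s1 * a) \<zeta> m \<in> A"
          unfolding A using energy_pt[OF e(3)] mult_pos_pos[OF R_pos[of "s1 * a"] e(2)]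
          by (simp add: mult.left_commute less_imp_le)
        moreover have "dist (pt (s1 * a) \<zeta> m) (pt x \<zeta> m) < \<eta>"
          by (rule near) (use n1 e(4) xx \<delta> sa in auto)
        ultimately show ?thesis using e(1) by blast
      next
        case False
        then have mk: "\<bar>m\<bar> \<le> \<kappa>" using e(2) sign_abs[OF s, of m] by simp
        then have "m\<^sup>2 < 1" using \<kappa> by (simp add: abs_square_less_1)
        then have z0: "0 < cmod \<zeta>" using e(3) by auto
        have nz: "cmod \<zeta> = sqrt (1 - \<bar>m\<bar>\<^sup>2)" using e(3) by (simp add: real_sqrt_unique algebra_simps)
        have "(sgn \<zeta> - \<zeta>) = (1 - cmod \<zeta>) *\<^sub>R sgn \<zeta>"
          using z0 by (simp add: sgn_div_norm scaleR_left_diff_distrib left_diff_distrib)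
        then have "cmod (sgn \<zeta> - \<zeta>) = 1 - cmod \<zeta>" using z0 n1 by (simp add: norm_sgn)
        then have zz: "cmod (sgn \<zeta> - \<zeta>) \<le> \<kappa>" unfolding nz using one_minus_sqrt_le[of "\<bar>m\<bar>"] n1 mk by simp
        have "0 < u (s1 * x)" unfolding t(2) by (rule mult_pos_pos[OF c(2) zero_less_power[OF e(2)]])
        then have "0 \<le> s1 * x" using u_le_iff[of "s1 * x" 0] t(1) a_pos u_0 by force
        then have "pt x (sgn \<zeta>) 0 \<in> A"
          unfolding A using energy_pt[of "sgn \<zeta>" 0 x] z0 t(1) by (simp add: norm_sgn)
        moreover have "dist (pt x (sgn \<zeta>) 0) (pt x \<zeta> m) < \<eta>"
          by (rule near) (use n1 e(4) zz mk \<kappa> z0 in \<open>auto simp: norm_sgn\<close>)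
        ultimately show ?thesis using e(1) by blast
      qed
    qed
    ultimately show ?case by (simp add: c_def)
  qed
  then show "\<forall>\<^sub>F \<tau> in F. (\<forall>p\<in>closure (leafU (\<sigma> * s) s \<union> leafV (\<sigma> * s)). \<exists>d\<in>leafD s (C_of \<tau>). dist p d < \<eta>) \<and>
      (\<forall>d\<in>leafD s (C_of \<tau>). \<exists>p\<in>closure (leafU (\<sigma> * s) s \<union> leafV (\<sigma> * s)). dist p d < \<eta>)"
    unfolding A_def s1_def .
qed

end

section \<open>Transversality\<close>

lemma gradient_eqI:
  fixes f :: "'a::euclidean_space \<Rightarrow> real"
  assumes "(f has_derivative (\<lambda>v. d \<bullet> v)) (at p)"
  shows "gradient f p = d"
  unfolding gradient_def frechet_derivative_at[OF assms, symmetric] by (rule euclidean_representation)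

lemma not_tangent_to_level_set:
  assumes "(F has_derivative F') (at p)" "\<And>q. q \<in> L \<Longrightarrow> F q = (c::real)" "F' v \<noteq> 0"
  shows "v \<notin> tangent_vectors L p"
proof
  assume "v \<in> tangent_vectors L p"
  then obtain \<gamma> :: "real \<Rightarrow> _" where \<gamma>: "range \<gamma> \<subseteq> L" "\<gamma> 0 = p" "(\<gamma> has_vector_derivative v) (at 0)"
    by (auto simp: tangent_vectors_def)
  have "((\<lambda>t. F (\<gamma> t)) has_derivative (\<lambda>h. F' (h *\<^sub>R v))) (at 0)"
    using diff_chain_at[OF \<gamma>(3)[unfolded has_vector_derivative_def]] assms(1) \<gamma>(2) by (simp add: o_def)
  moreover have "(\<lambda>t. F (\<gamma> t)) = (\<lambda>t. c)" using \<gamma>(1) assms(2) by auto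
  ultimately have "(\<lambda>h. F' (h *\<^sub>R v)) = (\<lambda>h. 0)"
    using has_derivative_unique has_derivative_const by metis
  from fun_cong[OF this, of 1] show False using assms(3) by simp
qed

context stark
begin

definition W1 :: "real \<Rightarrow> real" where "W1 x = 8 * x - 16 * \<epsilon> * x ^ 3"
definition W2 :: "real \<Rightarrow> real" where "W2 x = 8 * x + 16 * \<epsilon> * x ^ 3"

abbreviation x2 :: "R4 \<Rightarrow> real" where "x2 p \<equiv> fst (snd p)"
abbreviation y2 :: "R4 \<Rightarrow> real" where "y2 p \<equiv> snd (snd (snd p))"

lemma stark_H_projections:
  "H = (\<lambda>p. ((y1 p)\<^sup>2 + (y2 p)\<^sup>2) / 2 + 4 * ((x1 p)\<^sup>2 - \<epsilon> * x1 p ^ 4) + 4 * ((x2 p)\<^sup>2 + \<epsilon> * x2 p ^ 4))"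
  by (auto simp: stark_H_def V1_def V2_def fun_eq_iff)

lemma gradient_stark_H: "gradient H p = (W1 (x1 p), W2 (x2 p), y1 p, y2 p)"
  by (rule gradient_eqI, unfold stark_H_projections)
    (auto intro!: derivative_eq_intros simp: fun_eq_iff W1_def W2_def inner_prod_def algebra_simps
      power2_eq_square power3_eq_cube)

lemma ham_vf_stark: "ham_vf H p = (y1 p, y2 p, - W1 (x1 p), - W2 (x2 p))"
  by (simp add: ham_vf_def gradient_stark_H split: prod.splits)

lemma gradient_H1: "gradient (H1 \<epsilon>) q = (W1 (fst q), snd q)"
proof -
  have "H1 \<epsilon> = (\<lambda>q. (snd q)\<^sup>2 / 2 + 4 * ((fst q)\<^sup>2 - \<epsilon> * fst q ^ 4))"
    by (auto simp: H1_def V1_def fun_eq_iff)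
  then show ?thesis
    by (intro gradient_eqI, simp only:)
      (auto intro!: derivative_eq_intros simp: fun_eq_iff W1_def inner_prod_def algebra_simps
      power2_eq_square power3_eq_cube)
qed

lemma W1_factor: "W1 x = 8 * x * (1 - 2 * \<epsilon> * x\<^sup>2)"
  by (simp add: W1_def algebra_simps power2_eq_square power3_eq_cube)

lemma leafU_transverse: "p \<in> leafU s1 s2 \<Longrightarrow> ham_vf H p \<notin> tangent_vectors (leafU s1 s2) p"
  by (rule not_tangent_to_level_set[where F=fst and c="s1 * a" and F'=fst])
    (auto simp: leafU_def ham_vf_stark intro: has_derivative_fst)

lemma leafV_transverse:
  assumes s: "s\<^sup>2 = 1" and p: "p \<in> leafV s"
  shows "ham_vf H p \<notin> tangent_vectors (leafV s) p"
proof (rule not_tangent_to_level_set[where F="\<lambda>p. y1 p" and c=0 and F'="\<lambda>p. y1 p"])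
  have "\<bar>x1 p\<bar> < a" "x1 p \<noteq> 0" using p sign_abs[OF s, of "x1 p"] by (auto simp: leafV_def)
  then show "y1 (ham_vf H p) \<noteq> 0"
    using strip_pos[of "x1 p"] by (simp add: ham_vf_stark W1_factor)
qed (auto simp: leafV_def intro!: derivative_eq_intros)

text \<open>On \<open>leafD s C\<close> the derivative of \<open>s G(x\<^sub>1) - C y\<^sub>1\<^sup>8\<close> along the flow is
  \<open>s y\<^sub>1 G'(x\<^sub>1) + 8 s G(x\<^sub>1) V\<^sub>1'(x\<^sub>1) / y\<^sub>1\<close>; the first summand is positive and the second has the
  sign of \<open>G V\<^sub>1' \<ge> 0\<close>.\<close>

lemma leafD_transverse:
  assumes s: "s\<^sup>2 = 1" and p: "p \<in> leafD s C"
  shows "ham_vf H p \<notin> tangent_vectors (leafD s C) p"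
proof -
  have x: "\<bar>x1 p\<bar> < a" and y: "0 < s * y1 p" and e: "s * G (x1 p) = C * y1 p ^ 8"
    using p by (auto simp: leafD_def)
  define G' where "G' = 1 / sqrt (1 - 2 * \<epsilon> * (x1 p)\<^sup>2) ^ 3"
  have G': "0 < G'" using strip_pos[OF x] by (simp add: G'_def)
  have "(fst has_derivative fst) (at p)" by (auto intro: has_derivative_fst)
  from diff_chain_at[OF this G_derivative[OF x, folded G'_def, unfolded has_field_derivative_def]]
  have "((\<lambda>p. G (x1 p)) has_derivative (\<lambda>v. G' * x1 v)) (at p)" by (simp add: o_def)
  then have der: "((\<lambda>p. s * G (x1 p) - C * y1 p ^ 8) has_derivative
      (\<lambda>v. s * (G' * x1 v) - 8 * C * y1 p ^ 7 * y1 v)) (at p)"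
    by (auto intro!: derivative_eq_intros simp: fun_eq_iff algebra_simps)
  show ?thesis
  proof (rule not_tangent_to_level_set[OF der, of _ 0])
    have y0: "y1 p \<noteq> 0" using y by auto
    have "C * y1 p ^ 7 = s * G (x1 p) / y1 p"
      unfolding e using y0 by (simp add: eval_nat_numeral)
    also have "\<dots> = G (x1 p) / (s * y1 p)"
      using sign_cases[OF s] by auto
    finally have "C * y1 p ^ 7 * W1 (x1 p) = G (x1 p) * W1 (x1 p) / (s * y1 p)" by simp
    moreover have "0 \<le> G (x1 p) * W1 (x1 p)"
    proof -
      have "G (x1 p) * W1 (x1 p) = 8 * (x1 p)\<^sup>2 * ((1 - 2 * \<epsilon> * (x1 p)\<^sup>2) / sqrt (1 - 2 * \<epsilon> * (x1 p)\<^sup>2))"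
        by (simp add: G_def W1_factor power2_eq_square)
      then show ?thesis using strip_pos[OF x] by simp
    qed
    ultimately have "0 \<le> C * y1 p ^ 7 * W1 (x1 p)" using y by simp
    moreover have "0 < G' * (s * y1 p)" using G' y by simp
    ultimately show "s * (G' * x1 (ham_vf H p)) - 8 * C * y1 p ^ 7 * y1 (ham_vf H p) \<noteq> 0"
      by (simp add: ham_vf_stark mult_ac)
  qed (auto simp: leafD_def)
qed

section \<open>Projection to gradient lines\<close>

lemma proj1_restrict:
  assumes "L = {p \<in> S. P (proj1 p)}" "range \<gamma> = {q. P q}"
  shows "proj1 ` L = range \<gamma> \<inter> proj1 ` S"
  unfolding assms by auto

lemma proj1_eq: "proj1 p = (x1 p, y1 p)"
  by (auto simp: proj1_def split: prod.splits)

text \<open>In the coordinate \<open>w = G(x)\<close> the equation \<open>x\<^sup>\<prime> = V\<^sub>1\<^sup>\<prime>(x)\<close> becomes \<open>w\<^sup>\<prime> = 8 w\<close>.\<close>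

lemma Ginv_trajectory:
  "((\<lambda>t. Ginv (c * exp (8 * t))) has_real_derivative W1 (Ginv (c * exp (8 * t)))) (at t)"
proof -
  define w where "w = c * exp (8 * t)"
  define r where "r = sqrt (1 + 2 * \<epsilon> * w\<^sup>2)"
  have p: "0 < 1 + 2 * \<epsilon> * w\<^sup>2" for w using eps by (simp add: add_pos_nonneg)
  have r: "0 < r" "r\<^sup>2 = 1 + 2 * \<epsilon> * w\<^sup>2" using p[of w] by (auto simp: r_def)
  have "((\<lambda>w. sqrt (1 + 2 * \<epsilon> * w\<^sup>2)) has_real_derivative 2 * \<epsilon> * w / r) (at w)"
    using p[of w] by (auto intro!: derivative_eq_intros simp: r_def field_simps)
  from DERIV_divide[OF DERIV_ident this] r(1)
  have "(Ginv has_real_derivative (1 * r - w * (2 * \<epsilon> * w / r)) / (r * r)) (at w)"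
    unfolding Ginv_def[abs_def] r_def by simp
  moreover have "(1 * r - w * (2 * \<epsilon> * w / r)) / (r * r) = (r\<^sup>2 - 2 * \<epsilon> * w\<^sup>2) / r ^ 3"
    using r(1) by (simp add: field_simps power2_eq_square power3_eq_cube)
  ultimately have "(Ginv has_real_derivative 1 / r ^ 3) (at w)" unfolding r(2) by simp
  moreover have "((\<lambda>t. c * exp (8 * t)) has_real_derivative 8 * w) (at t)"
    by (auto intro!: derivative_eq_intros simp: w_def)
  ultimately have "((\<lambda>t. Ginv (c * exp (8 * t))) has_real_derivative 1 / r ^ 3 * (8 * w)) (at t)"
    using DERIV_chain2[of Ginv _ "\<lambda>t. c * exp (8 * t)" t _ UNIV] unfolding w_def by blast
  moreover have "1 / r ^ 3 * (8 * w) = W1 (Ginv w)"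
  proof -
    have g: "Ginv w = w / r" by (simp add: Ginv_def r_def)
    have "1 - 2 * \<epsilon> * (Ginv w)\<^sup>2 = (r\<^sup>2 - 2 * \<epsilon> * w\<^sup>2) / r\<^sup>2"
      using r(1) by (simp add: g power_divide diff_divide_distrib)
    also have "\<dots> = 1 / r\<^sup>2" unfolding r(2) by simp
    finally show ?thesis unfolding W1_factor by (simp add: g eval_nat_numeral)
  qed
  ultimately show ?thesis by (simp add: w_def)
qed

lemma gradient_trajectoryI:
  assumes "\<And>t. (f has_real_derivative W1 (f t)) (at t)" "\<And>t. (k has_real_derivative k t) (at t)"
    and "f 0 \<noteq> f 1 \<or> k 0 \<noteq> k 1"
  shows "gradient_trajectory (H1 \<epsilon>) (\<lambda>t. (f t, k t))"
  unfolding gradient_trajectory_def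
proof (intro conjI allI)
  show "((\<lambda>t. (f t, k t)) has_vector_derivative gradient (H1 \<epsilon>) (f t, k t)) (at t)" for t
    using assms(1,2) unfolding gradient_H1
    by (auto intro!: has_vector_derivative_Pair simp: has_real_derivative_iff_has_vector_derivative)
  show "\<not> (\<lambda>t. (f t, k t)) constant_on UNIV"
  proof
    assume "(\<lambda>t. (f t, k t)) constant_on UNIV"
    then obtain c where "\<And>t. (f t, k t) = c" by (auto simp: constant_on_def)
    from this[of 0] this[of 1] show False using assms(3) by auto
  qed
qed

lemma leafU_gradient_line:
  assumes s: "s1\<^sup>2 = 1" "s2\<^sup>2 = 1"
  shows "\<exists>\<gamma>. gradient_trajectory (H1 \<epsilon>) \<gamma> \<and> proj1 ` leafU s1 s2 = range \<gamma> \<inter> proj1 ` strip"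
proof (intro exI conjI)
  let ?\<gamma> = "\<lambda>t. (s1 * a, s2 * exp t)"
  have "W1 (s1 * a) = 0" using s(1) eps by (simp add: W1_factor power_mult_distrib a_square)
  then show "gradient_trajectory (H1 \<epsilon>) ?\<gamma>"
    using sign_cases[OF s(2)] by (intro gradient_trajectoryI) (auto intro!: derivative_eq_intros)
  have ran: "range ?\<gamma> = {(x, y). x = s1 * a \<and> 0 < s2 * y}"
  proof -
    have "(x, y) \<in> range ?\<gamma>" if "x = s1 * a" "0 < s2 * y" for x y
      using that sign_square(2)[OF s(2)] by (intro range_eqI[of _ _ "ln (s2 * y)"]) simp
    then show ?thesis by (auto simp: sign_square(2)[OF s(2)])
  qed
  show "proj1 ` leafU s1 s2 = range ?\<gamma> \<inter> proj1 ` strip"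
  proof (rule proj1_restrict[where P="\<lambda>q. fst q = s1 * a \<and> 0 < s2 * snd q"])
    show "leafU s1 s2 = {p \<in> strip. fst (proj1 p) = s1 * a \<and> 0 < s2 * snd (proj1 p)}"
      using a_pos sign_abs[OF s(1), of a] by (auto simp: leafU_def strip_def proj1_eq)
  qed (auto simp: ran)
qed

lemma leafV_gradient_line:
  assumes s: "s\<^sup>2 = 1"
  shows "\<exists>\<gamma>. gradient_trajectory (H1 \<epsilon>) \<gamma> \<and> proj1 ` leafV s = range \<gamma> \<inter> proj1 ` strip"
proof (intro exI conjI)
  let ?\<gamma> = "\<lambda>t. (Ginv (s * exp (8 * t)), 0 :: real)"
  have "Ginv (s * exp (8 * 0)) \<noteq> Ginv (s * exp (8 * 1))"
  proof
    assume "Ginv (s * exp (8 * 0)) = Ginv (s * exp (8 * 1))"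
    then have "s * exp (8 * 0) = s * exp (8 * 1)" using G_Ginv by metis
    then show False using sign_cases[OF s] by auto
  qed
  then show "gradient_trajectory (H1 \<epsilon>) ?\<gamma>"
    by (intro gradient_trajectoryI Ginv_trajectory) (auto intro!: derivative_eq_intros)
  have odd: "Ginv (s * w) = s * Ginv w" for w
    using sign_cases[OF s] by (auto simp: Ginv_def)
  have ran: "range ?\<gamma> = {(x, y). y = 0 \<and> 0 < s * x \<and> s * x < a}"
  proof -
    have "(x, 0) \<in> range ?\<gamma>" if x: "0 < s * x" "s * x < a" for x
    proof -
      have sx: "\<bar>s * x\<bar> < a" using x by simp
      then have "0 < G (s * x)" using G_pos_iff[OF sx] x(1) by simp
      then have "Ginv (s * exp (8 * (ln (G (s * x)) / 8))) = s * Ginv (G (s * x))" by (simp add: odd)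
      also have "\<dots> = x" using Ginv_G[OF sx] sign_square(2)[OF s] by simp
      finally show ?thesis by (intro range_eqI[of _ _ "ln (G (s * x)) / 8"]) simp
    qed
    moreover have "0 < s * Ginv (s * exp (8 * t))" "s * Ginv (s * exp (8 * t)) < a" for t
    proof -
      have e: "s * Ginv (s * exp (8 * t)) = Ginv (exp (8 * t))" using odd sign_square(2)[OF s] by simp
      show "0 < s * Ginv (s * exp (8 * t))"
        unfolding e using G_pos_iff[OF Ginv_bound] by (simp flip: G_pos_iff add: G_Ginv)
      show "s * Ginv (s * exp (8 * t)) < a" unfolding e using Ginv_bound[of "exp (8 * t)"] by linarith
    qed
    ultimately show ?thesis by auto
  qed
  show "proj1 ` leafV s = range ?\<gamma> \<inter> proj1 ` strip"
  proof (rule proj1_restrict[where P="\<lambda>q. snd q = 0 \<and> 0 < s * fst q \<and> s * fst q < a"])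
    show "leafV s = {p \<in> strip. snd (proj1 p) = 0 \<and> 0 < s * fst (proj1 p) \<and> s * fst (proj1 p) < a}"
    proof -
      have "\<bar>x1 p\<bar> \<le> a" if "0 < s * x1 p" "s * x1 p < a" for p
        using sign_abs[OF s, of "x1 p"] that by simp
      then show ?thesis by (auto simp: leafV_def strip_def proj1_eq)
    qed
  qed (auto simp: ran)
qed

lemma leafD_gradient_line:
  assumes s: "s\<^sup>2 = 1"
  shows "\<exists>\<gamma>. gradient_trajectory (H1 \<epsilon>) \<gamma> \<and> proj1 ` leafD s C = range \<gamma> \<inter> proj1 ` strip"
proof (intro exI conjI)
  let ?\<gamma> = "\<lambda>t. (Ginv (s * C * exp (8 * t)), s * exp t)"
  show "gradient_trajectory (H1 \<epsilon>) ?\<gamma>"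
    using sign_cases[OF s] by (intro gradient_trajectoryI Ginv_trajectory) (auto intro!: derivative_eq_intros)
  have e8: "(s * exp t) ^ 8 = exp (8 * t)" for t
  proof -
    have "s ^ 8 = 1" using sign_cases[OF s] by auto
    then show ?thesis by (simp add: power_mult_distrib flip: exp_of_nat_mult)
  qed
  have ran: "range ?\<gamma> = {(x, y). \<bar>x\<bar> < a \<and> 0 < s * y \<and> s * G x = C * y ^ 8}"
  proof -
    have "(x, y) \<in> range ?\<gamma>" if x: "\<bar>x\<bar> < a" "0 < s * y" "s * G x = C * y ^ 8" for x y
    proof (rule range_eqI[of _ _ "ln (s * y)"])
      have y: "s * exp (ln (s * y)) = y" using x(2) sign_square(2)[OF s] by simp
      have "s * C * exp (8 * ln (s * y)) = s * (C * y ^ 8)" unfolding e8[symmetric] y by simp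
      also have "\<dots> = G x" unfolding x(3)[symmetric] by (rule sign_square(2)[OF s])
      finally show "(x, y) = ?\<gamma> (ln (s * y))" using y Ginv_G[OF x(1)] by simp
    qed
    moreover have "s * G (Ginv (s * C * exp (8 * t))) = C * (s * exp t) ^ 8" for t
      unfolding e8 G_Ginv using sign_square(2)[OF s, of "C * exp (8 * t)"] by (simp add: mult.assoc)
    ultimately show ?thesis using Ginv_bound by (auto simp: sign_square(2)[OF s])
  qed
  show "proj1 ` leafD s C = range ?\<gamma> \<inter> proj1 ` strip"
  proof (rule proj1_restrict[where P="\<lambda>q. \<bar>fst q\<bar> < a \<and> 0 < s * snd q \<and> s * G (fst q) = C * snd q ^ 8"])
    show "leafD s C = {p \<in> strip. \<bar>fst (proj1 p)\<bar> < a \<and> 0 < s * snd (proj1 p) \<and>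
        s * G (fst (proj1 p)) = C * snd (proj1 p) ^ 8}"
      by (auto simp: leafD_def strip_def proj1_eq)
  qed (auto simp: ran)
qed

end

section \<open>Uniformly positive periodic rotation\<close>

text \<open>The time needed to reach the angle \<open>\<theta>\<close> is an antiderivative of \<open>1 / \<kappa>\<close>; its inverse is
  the solution.\<close>

lemma angle_solution:
  fixes \<kappa> :: "real \<Rightarrow> real"
  assumes cont: "continuous_on UNIV \<kappa>" and bounds: "\<And>\<theta>. m \<le> \<kappa> \<theta>" "\<And>\<theta>. \<kappa> \<theta> \<le> K" "0 < m"
    and per: "\<And>\<theta>. \<kappa> (\<theta> + 2 * pi) = \<kappa> \<theta>"
  obtains \<phi> T where "0 < T" "m * T \<le> 2 * pi" "\<phi> 0 = 0" "strict_mono \<phi>" "surj \<phi>"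
    "\<And>t. (\<phi> has_real_derivative \<kappa> (\<phi> t)) (at t)" "\<And>t. \<phi> (t + T) = \<phi> t + 2 * pi"
proof -
  have kp: "0 < \<kappa> \<theta>" for \<theta> using bounds(1)[of \<theta>] bounds(3) by linarith
  have Kp: "0 < K" using bounds(2)[of 0] kp[of 0] by linarith
  have "\<exists>F. \<forall>x::real. -\<infinity> < ereal x \<longrightarrow> ereal x < \<infinity> \<longrightarrow> (F has_vector_derivative 1 / \<kappa> x) (at x)"
  proof (rule einterval_antiderivative)
    show "isCont (\<lambda>x. 1 / \<kappa> x) x" for x
      using cont kp[of x] by (intro continuous_intros) (auto simp: continuous_on_eq_continuous_at)
  qed simp
  then obtain F0 where F0: "\<And>x. (F0 has_real_derivative 1 / \<kappa> x) (at x)"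
    by (auto simp: has_real_derivative_iff_has_vector_derivative)
  define F where "F = (\<lambda>x. F0 x - F0 0)"
  have F: "(F has_real_derivative 1 / \<kappa> x) (at x)" for x
    unfolding F_def using F0 by (auto intro!: derivative_eq_intros)
  have F00: "F 0 = 0" by (simp add: F_def)
  have incr: "(y - x) / K \<le> F y - F x" "F y - F x \<le> (y - x) / m" if xy: "x < y" for x y
  proof -
    obtain z where z: "F y - F x = (y - x) * (1 / \<kappa> z)" using MVT2[OF xy, of F "\<lambda>z. 1 / \<kappa> z"] F by blast
    have "1 / K \<le> 1 / \<kappa> z" "1 / \<kappa> z \<le> 1 / m"
      using bounds kp[of z] by (auto intro!: divide_left_mono mult_pos_pos Kp)
    then have "(y - x) * (1 / K) \<le> F y - F x" "F y - F x \<le> (y - x) * (1 / m)"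
      unfolding z using xy by (intro mult_left_mono; simp)+
    then show "(y - x) / K \<le> F y - F x" "F y - F x \<le> (y - x) / m" by simp_all
  qed
  have mono: "F x < F y" if "x < y" for x y
    using incr(1)[OF that] Kp that by (smt (verit) divide_pos_pos)
  have surjF: "\<exists>x. F x = t" for t
  proof -
    have c: "continuous_on A F" for A using F by (auto intro!: continuous_at_imp_continuous_on DERIV_isCont)
    define b where "b = K * \<bar>t\<bar> + 1"
    have b: "0 < b" using Kp by (simp add: b_def add_nonneg_pos)
    have "\<bar>t\<bar> \<le> b / K" using Kp by (simp add: b_def field_simps)
    then have "F (- b) \<le> t" "t \<le> F b"
      using incr(1)[of 0 b] incr(1)[of "- b" 0] b F00 by auto
    then show ?thesis using IVT'[of F "- b" t b] c b by auto
  qed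
  define \<phi> where "\<phi> = (\<lambda>t. THE x. F x = t)"
  have inj: "F x = F y \<Longrightarrow> x = y" for x y using mono[of x y] mono[of y x] by (cases x y rule: linorder_cases) auto
  have \<phi>: "F (\<phi> t) = t" for t
  proof -
    have "\<exists>!x. F x = t" using surjF inj by metis
    from theI'[OF this] show ?thesis by (simp add: \<phi>_def)
  qed
  have \<phi>F: "\<phi> (F x) = x" for x using \<phi>[of "F x"] inj by blast
  have der: "(\<phi> has_real_derivative \<kappa> (\<phi> t)) (at t)" for t
  proof -
    have "(\<phi> has_real_derivative inverse (1 / \<kappa> (\<phi> t))) (at t)"
      by (rule inverse_function_derivative[where V=UNIV and u=F])
        (use F \<phi> \<phi>F kp in \<open>auto simp: less_imp_neq[symmetric]\<close>)
    then show ?thesis by simp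
  qed
  define T where "T = F (2 * pi)"
  have T: "0 < T" using mono[of 0 "2 * pi"] F00 by (simp add: T_def)
  have "F (x + 2 * pi) - F x = F (0 + 2 * pi) - F 0" for x
  proof -
    have "((\<lambda>x. F (x + 2 * pi) - F x) has_real_derivative 1 / \<kappa> (x + 2 * pi) * 1 - 1 / \<kappa> x) (at x)" for x
      by (intro derivative_intros DERIV_chain2[OF F] F) (auto intro!: derivative_eq_intros)
    then have "((\<lambda>x. F (x + 2 * pi) - F x) has_real_derivative 0) (at x)" for x
      by (simp add: per)
    from DERIV_isconst_all[of "\<lambda>x. F (x + 2 * pi) - F x" x 0] this show ?thesis by blast
  qed
  then have Fper: "F (x + 2 * pi) = F x + T" for x by (simp add: T_def F00 algebra_simps)
  show thesis
  proof (rule that[OF T])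
    show "m * T \<le> 2 * pi" using incr(2)[of 0 "2 * pi"] bounds(3) F00 by (simp add: T_def field_simps)
    show "\<phi> 0 = 0" using \<phi>F[of 0] F00 by simp
    show "strict_mono \<phi>"
    proof (rule strict_monoI)
      fix s t :: real assume "s < t"
      then have "F (\<phi> s) < F (\<phi> t)" by (simp add: \<phi>)
      then show "\<phi> s < \<phi> t" using mono[of "\<phi> t" "\<phi> s"] by (cases "\<phi> s" "\<phi> t" rule: linorder_cases) auto
    qed
    show "surj \<phi>" using \<phi>F by (metis surjI)
    show "(\<phi> has_real_derivative \<kappa> (\<phi> t)) (at t)" for t by (rule der)
    show "\<phi> (t + T) = \<phi> t + 2 * pi" for t
    proof -
      have "F (\<phi> t + 2 * pi) = F (\<phi> (t + T))" by (simp add: Fper \<phi>)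
      then show ?thesis using inj by metis
    qed
  qed
qed

section \<open>The binding orbits and their indices\<close>

context stark
begin

definition Q' :: "real \<Rightarrow> real" where
  "Q' x = 8 * (1 + 2 * \<epsilon> * x\<^sup>2) / sqrt (8 * (1 + \<epsilon> * x\<^sup>2))"

lemma Q_derivative: "(Q has_real_derivative Q' x) (at x)"
proof -
  define r where "r = sqrt (8 * (1 + \<epsilon> * x\<^sup>2))"
  have p: "0 < 8 * (1 + \<epsilon> * x\<^sup>2)" using one_plus_pos[of x] by simp
  have r: "0 < r" "r\<^sup>2 = 8 * (1 + \<epsilon> * x\<^sup>2)" using p by (auto simp: r_def)
  have "((\<lambda>x. sqrt (8 * (1 + \<epsilon> * x\<^sup>2))) has_real_derivative 8 * \<epsilon> * x / r) (at x)"
    using p r(1) by (auto intro!: derivative_eq_intros simp: r_def field_simps)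
  from DERIV_mult[OF DERIV_ident this]
  have "(Q has_real_derivative 1 * r + 8 * \<epsilon> * x / r * x) (at x)"
    unfolding Q_def[abs_def] r_def .
  moreover have "1 * r + 8 * \<epsilon> * x / r * x = (r\<^sup>2 + 8 * \<epsilon> * x\<^sup>2) / r"
    using r(1) by (simp add: field_simps power2_eq_square)
  moreover have "Q' x = 8 * (1 + 2 * \<epsilon> * x\<^sup>2) / r" by (simp add: Q'_def r_def)
  then have "(r\<^sup>2 + 8 * \<epsilon> * x\<^sup>2) / r = Q' x"
    unfolding r(2) by (simp add: algebra_simps)
  ultimately show ?thesis by simp
qed

lemma Q_Q': "Q x * Q' x = W2 x"
proof -
  have "sqrt (8 * (1 + \<epsilon> * x\<^sup>2)) \<noteq> 0" using one_plus_pos[of x] by simp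
  then have "Q x * Q' x = x * (8 * (1 + 2 * \<epsilon> * x\<^sup>2))" unfolding Q_def Q'_def by simp
  then show ?thesis by (simp add: W2_def algebra_simps power2_eq_square power3_eq_cube)
qed

text \<open>The angle of \<open>\<zeta>\<close> moves along orbits of \<open>H\<^sub>2\<close> with the speed \<open>Q\<^sup>\<prime>\<close>, so their periods are at most
  \<open>2 \<pi> / \<surd>8\<close>.\<close>

lemma sqrt8_le_Q': "sqrt 8 \<le> Q' x"
proof -
  define t where "t = \<epsilon> * x\<^sup>2"
  have t: "0 \<le> t" using eps by (simp add: t_def)
  have "1 + t \<le> (1 + t)\<^sup>2" using t by (simp add: power2_eq_square algebra_simps)
  then have "sqrt (1 + t) \<le> 1 + t" using t by (metis add_nonneg_nonneg real_le_lsqrt zero_le_one)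
  also have "\<dots> \<le> 1 + 2 * t" using t by simp
  finally have "8 * sqrt (1 + t) \<le> 8 * (1 + 2 * t)" by simp
  moreover have "sqrt 8 * sqrt (8 * (1 + t)) = 8 * sqrt (1 + t)"
    unfolding real_sqrt_mult[of 8] by (simp flip: mult.assoc)
  moreover have "0 < sqrt (8 * (1 + t))" using t by simp
  ultimately have "sqrt 8 \<le> 8 * (1 + 2 * t) / sqrt (8 * (1 + t))" by (simp only: pos_le_divide_eq)
  then show ?thesis by (simp only: Q'_def t_def mult.assoc)
qed

lemma Q'_pos: "0 < Q' x"
  using sqrt8_le_Q'[of x] by (smt (verit) real_sqrt_gt_0_iff)

lemma Q'_upper: "\<bar>x\<bar> \<le> \<rho> \<Longrightarrow> Q' x \<le> 8 * (1 + 2 * \<epsilon> * \<rho>\<^sup>2)"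
proof -
  assume "\<bar>x\<bar> \<le> \<rho>"
  then have "x\<^sup>2 \<le> \<rho>\<^sup>2" using abs_le_square_iff[of x \<rho>] by linarith
  then have 1: "8 * (1 + 2 * \<epsilon> * x\<^sup>2) \<le> 8 * (1 + 2 * \<epsilon> * \<rho>\<^sup>2)" using eps by simp
  have 2: "1 \<le> sqrt (8 * (1 + \<epsilon> * x\<^sup>2))" using eps by simp
  have "0 \<le> 8 * (1 + 2 * \<epsilon> * x\<^sup>2)" using eps by simp
  then have "Q' x \<le> 8 * (1 + 2 * \<epsilon> * x\<^sup>2) / 1"
    unfolding Q'_def using 2 by (intro divide_left_mono) auto
  then show ?thesis using 1 by simp
qed

lemma X_bound: "\<bar>X q\<bar> \<le> \<bar>q\<bar>"
proof -
  have "1 \<le> sqrt (1 + sqrt (1 + \<epsilon> * q\<^sup>2 / 2))" using eps by simp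
  then have "1 \<le> 2 * sqrt (1 + sqrt (1 + \<epsilon> * q\<^sup>2 / 2))" by linarith
  then show ?thesis using divide_left_mono[of 1 _ "\<bar>q\<bar>"] by (simp add: X_def abs_mult)
qed

lemma X_derivative: "(X has_real_derivative inverse (Q' (X q))) (at q)"
  by (rule inverse_function_derivative[where V=UNIV and u=Q])
    (auto simp: Q_derivative Q_X X_Q Q'_pos less_imp_neq[symmetric])

lemma continuous_on_Q' [continuous_intros]:
  assumes "continuous_on S f" shows "continuous_on S (\<lambda>x. Q' (f x))"
proof -
  have "sqrt (8 * (1 + \<epsilon> * (f x)\<^sup>2)) \<noteq> 0" for x using one_plus_pos[of "f x"] by simp
  then show ?thesis unfolding Q'_def by (intro continuous_intros assms) auto
qed

lemma frechet_derivative_ham_vf: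
  "frechet_derivative (ham_vf H) (at p) d =
     (y1 d, y2 d, - ((8 - 48 * \<epsilon> * (x1 p)\<^sup>2) * x1 d), - ((8 + 48 * \<epsilon> * (x2 p)\<^sup>2) * x2 d))"
proof -
  have der: "((\<lambda>p. (y1 p, y2 p, - W1 (x1 p), - W2 (x2 p))) has_derivative
     (\<lambda>d. (y1 d, y2 d, - ((8 - 48 * \<epsilon> * (x1 p)\<^sup>2) * x1 d), - ((8 + 48 * \<epsilon> * (x2 p)\<^sup>2) * x2 d)))) (at p)"
    unfolding W1_def W2_def
    by (auto intro!: derivative_eq_intros simp: fun_eq_iff algebra_simps power2_eq_square)
  have "ham_vf H = (\<lambda>p. (y1 p, y2 p, - W1 (x1 p), - W2 (x2 p)))"
    by (rule ext) (rule ham_vf_stark)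
  then show ?thesis by (simp only: frechet_derivative_at[OF der, symmetric])
qed

end

text \<open>A solution \<open>\<phi>\<close> of the equation of the angle of \<open>\<zeta>\<close> in the plane of \<open>H\<^sub>2\<close>, over a critical
  point \<open>b\<close> of \<open>V\<^sub>1\<close>.\<close>

locale stark_orbit = stark +
  fixes b T :: real and \<phi> :: "real \<Rightarrow> real"
  assumes crit: "W1 b = 0" and T_pos: "0 < T" and \<phi>_0: "\<phi> 0 = 0" and \<phi>_mono: "strict_mono \<phi>"
    and \<phi>_surj: "surj \<phi>" and \<phi>_deriv: "\<And>t. (\<phi> has_real_derivative Q' (X (R b * cos (\<phi> t)))) (at t)"
    and \<phi>_shift: "\<And>t. \<phi> (t + T) = \<phi> t + 2 * pi"
begin

definition w :: "real \<Rightarrow> R4" where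
  "w t = (b, X (R b * cos (\<phi> t)), 0, - (R b * sin (\<phi> t)))"

lemma w_coords [simp]: "x1 (w t) = b" "x2 (w t) = X (R b * cos (\<phi> t))" "y1 (w t) = 0"
  "y2 (w t) = - (R b * sin (\<phi> t))"
  by (simp_all add: w_def)

lemma w_derivative: "(w has_vector_derivative ham_vf H (w t)) (at t)"
proof -
  define x where "x = X (R b * cos (\<phi> t))"
  have "((\<lambda>t. R b * cos (\<phi> t)) has_real_derivative - (R b * sin (\<phi> t)) * Q' x) (at t)"
    using \<phi>_deriv[of t] by (auto intro!: derivative_eq_intros simp: x_def)
  from DERIV_chain2[OF X_derivative this]
  have "((\<lambda>t. X (R b * cos (\<phi> t))) has_real_derivative - (R b * sin (\<phi> t))) (at t)"
    using Q'_pos[of x] by (simp add: x_def field_simps)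
  moreover have "((\<lambda>t. - (R b * sin (\<phi> t))) has_real_derivative - W2 x) (at t)"
    using \<phi>_deriv[of t] unfolding Q_Q'[symmetric]
    by (auto intro!: derivative_eq_intros simp: x_def Q_X)
  ultimately show ?thesis
    unfolding w_def[abs_def] ham_vf_stark using crit
    by (auto intro!: has_vector_derivative_Pair simp: x_def has_real_derivative_iff_has_vector_derivative)
qed

lemma w_periodic: "w (t + T) = w t"
  by (simp add: w_def \<phi>_shift)

lemma \<phi>_T: "\<phi> T = 2 * pi"
  using \<phi>_shift[of 0] \<phi>_0 by simp

lemma periodic_w: "periodic_orbit H (w, T)"
  unfolding periodic_orbit_def prod.case
proof (intro conjI allI impI)
  show "(w has_vector_derivative ham_vf H (w t)) (at t)" for t by (rule w_derivative)
  show "0 < T" by (rule T_pos)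
  show "w (t + T) = w t" for t by (rule w_periodic)
  have Rb: "0 < R b" by (rule R_pos)
  show minimal: "\<not> (\<forall>t. w (t + S) = w t)" if "0 < S \<and> S < T" for S
  proof
    assume "\<forall>t. w (t + S) = w t"
    then have "w (0 + S) = w 0" by blast
    then have "X (R b * cos (\<phi> S)) = X (R b)" by (simp add: w_def \<phi>_0)
    then have "R b * cos (\<phi> S) = R b" using Q_X by metis
    then have "cos (\<phi> S) = 1" using Rb by simp
    then obtain n :: int where n: "\<phi> S = of_int n * 2 * pi" by (auto simp: cos_one_2pi_int)
    have "0 < \<phi> S" "\<phi> S < 2 * pi"
      using strict_monoD[OF \<phi>_mono, of 0 S] strict_monoD[OF \<phi>_mono, of S T] that \<phi>_0 \<phi>_T by auto
    then have "0 < of_int n * (2 * pi)" "of_int n * (2 * pi) < 1 * (2 * pi)" using n by auto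
    then have "0 < (of_int n :: real)" "(of_int n :: real) < 1"
      by (auto simp: zero_less_mult_iff)
    then have "0 < n" "n < 1" by simp_all
    then show False by linarith
  qed
  show "\<not> w constant_on UNIV"
  proof
    assume "w constant_on UNIV"
    then have "\<forall>t. w (t + T / 2) = w t" by (auto simp: constant_on_def)
    then show False using minimal[of "T / 2"] T_pos by simp
  qed
qed

lemma zeta_w: "zeta (w t) = R b *\<^sub>R cis (- \<phi> t)"
  by (simp add: zeta_def Q_X complex_eq_iff)

lemma orbit_set_w: "orbit_set (w, T) = circle b"
proof -
  have "w t \<in> circle b" for t
    by (simp add: circle_def energy_iff zeta_w R_square norm_mult)
  moreover have "p \<in> range w" if "p \<in> circle b" for p
  proof -
    have p: "x1 p = b" "y1 p = 0" "(cmod (zeta p))\<^sup>2 = (R b)\<^sup>2"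
      using that by (auto simp: circle_def energy_iff R_square)
    then have n: "cmod (zeta p) = R b" using R_pos[of b] by (simp add: power2_eq_iff_nonneg less_imp_le)
    obtain t where t: "- Arg (zeta p) = \<phi> t" using \<phi>_surj by (metis surjD)
    have z: "zeta p = R b *\<^sub>R cis (- \<phi> t)"
      using rcis_cmod_Arg[of "zeta p"] by (simp add: rcis_def n scaleR_conv_of_real flip: t)
    have "p = pt b (cis (- \<phi> t)) 0" using p z by (intro pt_eqI) auto
    also have "\<dots> = w t" by (simp add: pt_def w_def)
    finally show ?thesis by simp
  qed
  ultimately show ?thesis by (auto simp: orbit_set_def)
qed

text \<open>The frame \<open>X\<^sub>1, X\<^sub>2\<close> turns in the \<open>(x\<^sub>1, y\<^sub>1)\<close> plane like the unit vector \<open>e\<close>: the transverse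
  part \<open>\<alpha>\<close> of a linearized solution with components \<open>\<xi>, \<eta>\<close> in that plane is given by
  \<open>\<xi> + i \<eta> = e \<cdot> cnj \<alpha>\<close>.\<close>

definition e :: "real \<Rightarrow> complex" where
  "e t = sgn (Complex (y2 (w t)) (W2 (x2 (w t))))"

text \<open>The vector \<open>y\<^sub>2 + i V\<^sub>2\<^sup>\<prime>(x\<^sub>2)\<close> stays in the open half plane around
  \<open>i exp (i \<phi>)\<close>, because \<open>y\<^sub>2\<close> is a negative multiple of \<open>sin \<phi>\<close> and \<open>V\<^sub>2\<^sup>\<prime>(x\<^sub>2)\<close> a positive multiple of
  \<open>cos \<phi>\<close>.\<close>

lemma frame_vector_direction: "0 < Re (Complex (y2 (w t)) (W2 (x2 (w t))) / cis (\<phi> t + pi / 2))"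
proof -
  have W: "W2 (x2 (w t)) = R b * cos (\<phi> t) * Q' (x2 (w t))"
    using Q_Q'[of "x2 (w t)"] by (simp add: Q_X)
  have "Re (Complex (y2 (w t)) (W2 (x2 (w t))) / cis (\<phi> t + pi / 2)) =
      R b * ((sin (\<phi> t))\<^sup>2 + (cos (\<phi> t))\<^sup>2 * Q' (x2 (w t)))"
    unfolding W by (simp add: Re_divide cos_add sin_add power2_eq_square algebra_simps flip: distrib_left)
  moreover have "0 < (sin (\<phi> t))\<^sup>2 + (cos (\<phi> t))\<^sup>2 * Q' (x2 (w t))"
    using Q'_pos[of "x2 (w t)"] sin_cos_squared_add[of "\<phi> t"]
    by (cases "cos (\<phi> t) = 0") (auto intro!: add_nonneg_pos simp del: w_coords)
  ultimately show ?thesis using R_pos[of b] by simp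
qed

lemma frame_vector_nonzero: "Complex (y2 (w t)) (W2 (x2 (w t))) \<noteq> 0"
  using frame_vector_direction[of t] by (metis divide_eq_0_iff less_irrefl zero_complex.simps(1))

lemma norm_e: "cmod (e t) = 1"
  unfolding e_def norm_sgn using frame_vector_nonzero[of t] by simp

lemma e_cnj_e: "e t * cnj (e t) = 1" "cnj (e t) * e t = 1"
  using complex_norm_square[of "e t"] norm_e[of t] by (simp_all add: mult.commute)

lemma e_periodic: "e T = e 0"
  using w_periodic[of 0] by (simp add: e_def)

lemma continuous_e: "continuous_on UNIV e"
proof -
  have "continuous_on UNIV \<phi>"
    using \<phi>_deriv by (auto intro!: continuous_at_imp_continuous_on DERIV_isCont)
  then have "continuous_on UNIV (\<lambda>t. Complex (y2 (w t)) (W2 (x2 (w t))))"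
    unfolding W2_def w_coords Complex_eq by (intro continuous_intros)
  then show ?thesis
    unfolding e_def[abs_def] using frame_vector_nonzero by (intro continuous_on_sgn) blast+
qed

lemma e_turns_once:
  assumes "angle_lift e \<psi>" shows "\<psi> T - \<psi> 0 = 2 * pi"
proof -
  let ?c = "\<lambda>t. cis (\<phi> t + pi / 2)"
  have c\<phi>: "continuous_on UNIV \<phi>"
    using \<phi>_deriv by (auto intro!: continuous_at_imp_continuous_on DERIV_isCont)
  have "angle_lift ?c (\<lambda>t. \<phi> t + pi / 2)"
    using c\<phi> by (auto simp: angle_lift_def intro!: continuous_intros)
  moreover have "e t / ?c t \<notin> \<real>\<^sub>\<le>\<^sub>0" for t
  proof -
    let ?D = "Complex (y2 (w t)) (W2 (x2 (w t)))"
    have "e t / ?c t = (?D / ?c t) / of_real (cmod ?D)"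
      by (simp add: e_def sgn_eq)
    then have "Re (e t / ?c t) = Re (?D / ?c t) / cmod ?D" by (simp only: Re_divide_of_real)
    also have "\<dots> > 0" using frame_vector_direction[of t] frame_vector_nonzero[of t] by simp
    finally show ?thesis by (auto simp: complex_nonpos_Reals_iff)
  qed
  moreover have "continuous_on UNIV ?c" by (intro continuous_intros c\<phi>)
  moreover have "?c T = ?c 0" by (simp only: \<phi>_T \<phi>_0 cis_mult[symmetric]) simp
  ultimately show ?thesis
    using angle_lift_compare[OF _ assms _ continuous_e, of ?c "\<lambda>t. \<phi> t + pi / 2" T 0]
    by (simp add: e_periodic \<phi>_T \<phi>_0)
qed

abbreviation \<mu> :: real where "\<mu> \<equiv> 8 - 48 * \<epsilon> * b\<^sup>2"

lemma frame:
  "A *\<^sub>R j1 (X0 H (w t)) + B *\<^sub>R j2 (X0 H (w t)) + c *\<^sub>R j3 (X0 H (w t)) =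
   (Re (e t * cnj (Complex A B)), c * Re (e t), Im (e t * cnj (Complex A B)), - c * Im (e t))"
proof -
  let ?D = "Complex (y2 (w t)) (W2 (x2 (w t)))"
  have g: "gradient H (w t) = (0, W2 (x2 (w t)), 0, y2 (w t))"
    unfolding gradient_stark_H using crit by simp
  have n: "norm (gradient H (w t)) = cmod ?D"
    unfolding g by (simp add: norm_Pair cmod_def add.commute)
  have X0: "X0 H (w t) = (0, Im (e t), 0, Re (e t))"
    
    unfolding X0_def n unfolding g by (simp add: e_def sgn_div_norm del: w_coords)
  show ?thesis unfolding X0 by (simp add: j1_def j2_def j3_def algebra_simps)
qed

lemma transverse_solution_lin:
  assumes "transverse_solution H w \<alpha>"
  obtains \<xi> \<eta> where "lin_solution \<mu> \<xi> \<eta>" "\<And>t. Complex (\<xi> t) (\<eta> t) = e t * cnj (\<alpha> t)"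
proof -
  obtain uu \<alpha>3 where lin: "linearized_solution H w uu"
    and uu: "\<And>t. uu t = Re (\<alpha> t) *\<^sub>R j1 (X0 H (w t)) + Im (\<alpha> t) *\<^sub>R j2 (X0 H (w t))
       + \<alpha>3 t *\<^sub>R j3 (X0 H (w t))"
    using assms unfolding transverse_solution_def by blast
  define \<xi> \<eta> where "\<xi> t = x1 (uu t)" and "\<eta> t = y1 (uu t)" for t
  have c: "Complex (\<xi> t) (\<eta> t) = e t * cnj (\<alpha> t)" for t
    unfolding \<xi>_def \<eta>_def uu frame by (simp add: complex_eq_iff)
  have d: "(uu has_vector_derivative (y1 (uu t), y2 (uu t), - (\<mu> * x1 (uu t)),
      - ((8 + 48 * \<epsilon> * (x2 (w t))\<^sup>2) * x2 (uu t)))) (at t)" for t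
    using lin unfolding linearized_solution_def frechet_derivative_ham_vf by simp
  have "(\<xi> has_real_derivative \<eta> t) (at t)" for t
    unfolding \<xi>_def[abs_def] \<eta>_def has_real_derivative_iff_has_vector_derivative
    using bounded_linear.has_vector_derivative[OF bounded_linear_fst d[of t]] by simp
  moreover have "(\<eta> has_real_derivative - \<mu> * \<xi> t) (at t)" for t
    unfolding \<xi>_def \<eta>_def[abs_def] has_real_derivative_iff_has_vector_derivative
    using bounded_linear.has_vector_derivative[OF bounded_linear_fst
        bounded_linear.has_vector_derivative[OF bounded_linear_snd
        bounded_linear.has_vector_derivative[OF bounded_linear_snd d[of t]]]] by (simp add: algebra_simps)
  ultimately have "lin_solution \<mu> \<xi> \<eta>" by (simp add: lin_solution_def)
  then show thesis using c by (rule that)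
qed

lemma lin_transverse_solution:
  assumes "lin_solution \<mu> \<xi> \<eta>"
  shows "transverse_solution H w (\<lambda>t. e t * cnj (Complex (\<xi> t) (\<eta> t)))"
  unfolding transverse_solution_def
proof (intro exI conjI allI)
  let ?u = "\<lambda>t. (\<xi> t, 0 :: real, \<eta> t, 0 :: real)"
  show "linearized_solution H w ?u"
    unfolding linearized_solution_def frechet_derivative_ham_vf
    using assms by (auto intro!: has_vector_derivative_Pair
        simp: lin_solution_def algebra_simps simp flip: has_real_derivative_iff_has_vector_derivative)
  fix t
  let ?z = "Complex (\<xi> t) (\<eta> t)"
  have "e t * cnj (Complex (Re (e t * cnj ?z)) (Im (e t * cnj ?z))) = (e t * cnj (e t)) * ?z"
    by (simp only: complex_surj complex_cnj_mult complex_cnj_cnj mult.assoc)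
  also have "\<dots> = ?z" using e_cnj_e by simp
  finally show "?u t = Re (e t * cnj ?z) *\<^sub>R j1 (X0 H (w t)) +
      Im (e t * cnj ?z) *\<^sub>R j2 (X0 H (w t)) + 0 *\<^sub>R j3 (X0 H (w t))"
    unfolding frame by simp
qed

text \<open>Along the orbit the frame makes one positive turn, from which the rotation of the
  linearized flow in the \<open>(x\<^sub>1, y\<^sub>1)\<close> plane is subtracted.\<close>

lemma rotation_interval_iff:
  "r \<in> rotation_interval H (w, T) \<longleftrightarrow>
    (\<exists>\<xi> \<eta> \<psi>. lin_solution \<mu> \<xi> \<eta> \<and> Complex (\<xi> 0) (\<eta> 0) \<noteq> 0 \<and>
       angle_lift (\<lambda>t. Complex (\<xi> t) (\<eta> t)) \<psi> \<and> r = 1 + (\<psi> 0 - \<psi> T) / (2 * pi))" (is "?L \<longleftrightarrow> ?R")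
proof -
  have "e t \<noteq> 0" for t using norm_e[of t] by auto
  then obtain \<psi>e where \<psi>e: "angle_lift e \<psi>e" using angle_lift_exists[OF continuous_e] by blast
  note turn = e_turns_once[OF \<psi>e]
  show ?thesis
  proof
    assume ?L
    then obtain \<theta> \<alpha> where \<alpha>: "transverse_solution H w \<alpha>" "\<alpha> 0 \<noteq> 0"
      and lift: "angle_lift \<alpha> \<theta>" and r: "r = (\<theta> T - \<theta> 0) / (2 * pi)"
      unfolding rotation_interval_def angle_lift_def by auto
    obtain \<xi> \<eta> where lin: "lin_solution \<mu> \<xi> \<eta>" and c: "\<And>t. Complex (\<xi> t) (\<eta> t) = e t * cnj (\<alpha> t)"
      using transverse_solution_lin[OF \<alpha>(1)] by blast
    have "angle_lift (\<lambda>t. Complex (\<xi> t) (\<eta> t)) (\<lambda>t. \<psi>e t + - \<theta> t)"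
      unfolding c by (rule angle_lift_mult[OF \<psi>e angle_lift_cnj[OF lift]])
    moreover have "Complex (\<xi> 0) (\<eta> 0) \<noteq> 0" unfolding c using \<alpha>(2) \<open>\<And>t. e t \<noteq> 0\<close> by simp
    moreover have "r = 1 + ((\<psi>e 0 + - \<theta> 0) - (\<psi>e T + - \<theta> T)) / (2 * pi)"
      unfolding r using turn by (simp add: field_simps)
    ultimately show ?R using lin by blast
  next
    assume ?R
    then obtain \<xi> \<eta> \<psi> where lin: "lin_solution \<mu> \<xi> \<eta>" and nz: "Complex (\<xi> 0) (\<eta> 0) \<noteq> 0"
      and lift: "angle_lift (\<lambda>t. Complex (\<xi> t) (\<eta> t)) \<psi>" and r: "r = 1 + (\<psi> 0 - \<psi> T) / (2 * pi)"
      by blast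
    let ?\<alpha> = "\<lambda>t. e t * cnj (Complex (\<xi> t) (\<eta> t))"
    have "angle_lift ?\<alpha> (\<lambda>t. \<psi>e t + - \<psi> t)"
      by (rule angle_lift_mult[OF \<psi>e angle_lift_cnj[OF lift]])
    moreover have "?\<alpha> 0 \<noteq> 0" using nz \<open>\<And>t. e t \<noteq> 0\<close> by simp
    moreover have "r = ((\<psi>e T + - \<psi> T) - (\<psi>e 0 + - \<psi> 0)) / (2 * pi)"
      unfolding r using turn by (simp add: field_simps)
    ultimately show ?L
      unfolding rotation_interval_def angle_lift_def prod.case using lin_transverse_solution[OF lin]
      by (intro CollectI exI[of _ "\<lambda>t. \<psi>e t + - \<psi> t"] exI[of _ ?\<alpha>]) blast
  qed
qed

text \<open>The linearization over the origin is an oscillator of frequency \<open>\<surd>8\<close>, and the orbit is not longer than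
  its period.\<close>

lemma index_3:
  assumes "b = 0" "sqrt 8 * T \<le> 2 * pi"
  shows "orbit_index H (w, T) = 3"
proof (rule orbit_index_3I)
  have \<mu>: "\<mu> = (sqrt 8)\<^sup>2" using assms(1) by simp
  define \<xi> \<eta> where "\<xi> t = cos (sqrt 8 * t)" and "\<eta> t = - sqrt 8 * sin (sqrt 8 * t)" for t
  have lin: "lin_solution \<mu> \<xi> \<eta>"
    unfolding \<mu> lin_solution_def \<xi>_def[abs_def] \<eta>_def[abs_def]
    by (auto intro!: derivative_eq_intros simp: power2_eq_square)
  have nz: "Complex (\<xi> 0) (\<eta> 0) \<noteq> 0" by (simp add: \<xi>_def Complex_eq_0)
  then have "Complex (\<xi> t) (\<eta> t) \<noteq> 0" for t
    using oscillator_nonzero[OF lin[unfolded \<mu>] _ nz] by simp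
  then obtain \<psi> where "angle_lift (\<lambda>t. Complex (\<xi> t) (\<eta> t)) \<psi>"
    using angle_lift_exists[OF lin_solution_continuous[OF lin]] by blast
  then have "1 + (\<psi> 0 - \<psi> T) / (2 * pi) \<in> rotation_interval H (w, T)"
    unfolding rotation_interval_iff using lin nz by blast
  then show "rotation_interval H (w, T) \<noteq> {}" by blast
  show "rotation_interval H (w, T) \<subseteq> {1 + T / (2 * pi)..2}"
  proof
    fix r assume "r \<in> rotation_interval H (w, T)"
    then obtain \<xi> \<eta> \<psi> where lin: "lin_solution \<mu> \<xi> \<eta>" and nz: "Complex (\<xi> 0) (\<eta> 0) \<noteq> 0"
      and lift: "angle_lift (\<lambda>t. Complex (\<xi> t) (\<eta> t)) \<psi>" and r: "r = 1 + (\<psi> 0 - \<psi> T) / (2 * pi)"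
      unfolding rotation_interval_iff by blast
    have "(1::real) \<le> sqrt 8" by simp
    from oscillator_angle[OF lin[unfolded \<mu>] this nz lift T_pos assms(2)]
    have "T / (2 * pi) \<le> (\<psi> 0 - \<psi> T) / (2 * pi)" "(\<psi> 0 - \<psi> T) / (2 * pi) \<le> (2 * pi) / (2 * pi)"
      by (intro divide_right_mono; simp)+
    then show "r \<in> {1 + T / (2 * pi)..2}" unfolding r by simp
  qed
  show "1 < 1 + T / (2 * pi)" using T_pos by simp
qed

lemma saddle_\<mu>: "b\<^sup>2 = a\<^sup>2 \<Longrightarrow> \<mu> = - 4\<^sup>2"
  using eps by (simp add: a_square)

text \<open>The linearization over a saddle is the hyperbolic flow with exponents \<open>\<plusminus>4\<close>.\<close>

lemma index_2:
  assumes "b\<^sup>2 = a\<^sup>2" shows "orbit_index H (w, T) = 2"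
proof -
  note \<mu> = saddle_\<mu>[OF assms]
  obtain c where c: "0 < c"
    "\<And>d. 0 \<le> d \<Longrightarrow> d \<le> c \<Longrightarrow> \<exists>\<xi> \<eta> \<psi>. lin_solution (- 4\<^sup>2) \<xi> \<eta> \<and> Complex (\<xi> 0) (\<eta> 0) \<noteq> 0 \<and>
       angle_lift (\<lambda>t. Complex (\<xi> t) (\<eta> t)) \<psi> \<and> \<psi> 0 - \<psi> T = d"
    using repeller_angle_interval[OF zero_less_numeral T_pos] by blast
  show ?thesis
  proof (rule orbit_index_2I)
    show "rotation_interval H (w, T) \<subseteq> {1/2<..<3/2}"
    proof
      fix r assume "r \<in> rotation_interval H (w, T)"
      then obtain \<xi> \<eta> \<psi> where lin: "lin_solution \<mu> \<xi> \<eta>" and nz: "Complex (\<xi> 0) (\<eta> 0) \<noteq> 0"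
        and lift: "angle_lift (\<lambda>t. Complex (\<xi> t) (\<eta> t)) \<psi>" and r: "r = 1 + (\<psi> 0 - \<psi> T) / (2 * pi)"
        unfolding rotation_interval_iff by blast
      have "\<bar>\<psi> 0 - \<psi> T\<bar> < pi"
        by (rule repeller_angle[OF lin[unfolded \<mu>] _ nz lift]) simp
      then have "- pi < \<psi> 0 - \<psi> T" "\<psi> 0 - \<psi> T < pi" by linarith+
      then show "r \<in> {1/2<..<3/2}" unfolding r by (simp add: field_simps)
    qed
    show "{1..1 + c / (2 * pi)} \<subseteq> rotation_interval H (w, T)"
    proof
      fix r assume r: "r \<in> {1..1 + c / (2 * pi)}"
      then have "0 \<le> (r - 1) * (2 * pi)" "(r - 1) * (2 * pi) \<le> c" by (auto simp: field_simps)
      then obtain \<xi> \<eta> \<psi> where "lin_solution (- 4\<^sup>2) \<xi> \<eta>" "Complex (\<xi> 0) (\<eta> 0) \<noteq> 0"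
         "angle_lift (\<lambda>t. Complex (\<xi> t) (\<eta> t)) \<psi>" "\<psi> 0 - \<psi> T = (r - 1) * (2 * pi)" using c(2) by blast
      moreover from this have "r = 1 + (\<psi> 0 - \<psi> T) / (2 * pi)" by simp
      ultimately show "r \<in> rotation_interval H (w, T)"
        unfolding rotation_interval_iff \<mu> by blast
    qed
    show "0 < c / (2 * pi)" using c(1) by simp
  qed
qed

lemma hyperbolic:
  assumes "b\<^sup>2 = a\<^sup>2" shows "hyperbolic_orbit H (w, T)"
  unfolding hyperbolic_orbit_def prod.case
proof (intro exI[of _ "exp (4 * T)"] conjI ballI)
  show "1 < \<bar>exp (4 * T)\<bar>" using T_pos by simp
  fix \<kappa> assume "\<kappa> \<in> {exp (4 * T), 1 / exp (4 * T)}"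
  then obtain k :: real where k: "k\<^sup>2 = 4\<^sup>2" "\<kappa> = exp (k * T)"
    by (auto simp: exp_minus field_simps intro: that[of 4] that[of "-4"])
  have lin: "lin_solution \<mu> (\<lambda>t. exp (k * t)) (\<lambda>t. k * exp (k * t))"
    unfolding saddle_\<mu>[OF assms] k(1)[symmetric] lin_solution_def
    by (auto intro!: derivative_eq_intros simp: power2_eq_square)
  have "Complex (exp (k * T)) (k * exp (k * T)) = of_real \<kappa> * Complex (exp (k * 0)) (k * exp (k * 0))"
    by (simp add: k(2) complex_eq_iff)
  then have "e T * cnj (Complex (exp (k * T)) (k * exp (k * T))) =
      of_real \<kappa> * (e 0 * cnj (Complex (exp (k * 0)) (k * exp (k * 0))))"
    by (simp add: e_periodic)
  moreover have "e 0 \<noteq> 0" using norm_e[of 0] by auto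
  then have "e 0 * cnj (Complex (exp (k * 0)) (k * exp (k * 0))) \<noteq> 0"
    by (simp add: Complex_eq_0)
  ultimately show "\<exists>\<alpha>. transverse_solution H w \<alpha> \<and> \<alpha> 0 \<noteq> 0 \<and> \<alpha> T = of_real \<kappa> * \<alpha> 0"
    using lin_transverse_solution[OF lin] by blast
qed

end

context stark
begin

lemma orbit_exists:
  assumes "W1 b = 0"
  obtains T \<phi> where "stark_orbit \<epsilon> E b T \<phi>" "sqrt 8 * T \<le> 2 * pi"
proof -
  let ?\<kappa> = "\<lambda>\<theta>. Q' (X (R b * cos \<theta>))"
  have "continuous_on UNIV ?\<kappa>" by (intro continuous_intros)
  moreover have "?\<kappa> \<theta> \<le> 8 * (1 + 2 * \<epsilon> * (R b)\<^sup>2)" for \<theta>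
  proof (rule Q'_upper)
    have "\<bar>X (R b * cos \<theta>)\<bar> \<le> \<bar>R b * cos \<theta>\<bar>" by (rule X_bound)
    also have "\<dots> \<le> R b" using R_pos[of b] by (simp add: abs_mult mult_left_le)
    finally show "\<bar>X (R b * cos \<theta>)\<bar> \<le> R b" .
  qed
  ultimately obtain \<phi> T where "0 < T" "sqrt 8 * T \<le> 2 * pi" "\<phi> 0 = 0" "strict_mono \<phi>" "surj \<phi>"
    "\<And>t. (\<phi> has_real_derivative ?\<kappa> (\<phi> t)) (at t)" "\<And>t. \<phi> (t + T) = \<phi> t + 2 * pi"
    using angle_solution[of ?\<kappa> "sqrt 8"] sqrt8_le_Q' by (metis (no_types, lifting) cos_periodic real_sqrt_gt_0_iff zero_less_numeral)
  then show thesis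
    using assms stark_axioms by (intro that) (auto simp: stark_orbit_def stark_orbit_axioms_def)
qed

section \<open>The region between the Lyapunov orbits\<close>

lemma saddle_x1_eq: "saddle_x1 \<epsilon> j = (if j = 1 then a else - a)"
  by (simp add: saddle_x1_def a_def)

lemma V1_saddle: "x\<^sup>2 = a\<^sup>2 \<Longrightarrow> V1 \<epsilon> x = 1 / \<epsilon>"
proof -
  assume x: "x\<^sup>2 = a\<^sup>2"
  have "x ^ 4 = (x\<^sup>2)\<^sup>2" by (simp flip: power_mult)
  then show ?thesis unfolding V1_def x a_square using eps by (simp add: field_simps power2_eq_square)
qed

lemma V1_bounds:
  assumes "\<bar>x\<bar> \<le> a" shows "0 \<le> V1 \<epsilon> x" "V1 \<epsilon> x \<le> 1 / \<epsilon>"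
proof -
  have "x\<^sup>2 \<le> 1 / (2 * \<epsilon>)" using assms a_pos abs_le_square_iff[of x a] by (simp add: a_square)
  then have x2: "2 * \<epsilon> * x\<^sup>2 \<le> 1" using eps by (simp add: field_simps)
  have "V1 \<epsilon> x = 2 * x\<^sup>2 * (2 - 2 * \<epsilon> * x\<^sup>2)"
    by (simp add: V1_def algebra_simps power2_eq_square power4_eq_xxxx)
  then show "0 \<le> V1 \<epsilon> x" using x2 by simp
  show "V1 \<epsilon> x \<le> 1 / \<epsilon>" using R2_lower(1)[of x] by (simp add: R2_def)
qed

lemma V2_mono: "\<bar>y\<bar> \<le> \<bar>z\<bar> \<Longrightarrow> V2 \<epsilon> y \<le> V2 \<epsilon> z"
proof -
  assume "\<bar>y\<bar> \<le> \<bar>z\<bar>"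
  then have "y\<^sup>2 \<le> z\<^sup>2" by (simp add: abs_le_square_iff)
  moreover from this have "(y\<^sup>2)\<^sup>2 \<le> (z\<^sup>2)\<^sup>2" by (intro power_mono[of "y\<^sup>2"]) simp_all
  then have "y ^ 4 \<le> z ^ 4" by (simp flip: power_mult)
  ultimately show ?thesis using eps by (simp add: V2_def add_mono)
qed

definition K_closed :: "(real \<times> real) set" where
  "K_closed = {(x, y). \<bar>x\<bar> \<le> a \<and> V1 \<epsilon> x + V2 \<epsilon> y \<le> E}"
definition K_open :: "(real \<times> real) set" where
  "K_open = {(x, y). \<bar>x\<bar> < a \<and> V1 \<epsilon> x + V2 \<epsilon> y < E}"

lemma lyapunov_eq_circle: "lyapunov_set \<epsilon> E j = circle (if j = 1 then a else - a)"
  using V1_saddle[of a] V1_saddle[of "- a"]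
  by (auto simp: lyapunov_set_def circle_def saddle_x1_eq H2_def stark_H_def e_star_def)

lemma x_proj_circle:
  "x_proj ` circle x = {(x', y). x' = x \<and> V1 \<epsilon> x + V2 \<epsilon> y \<le> E}"
proof -
  have "(x, y) \<in> x_proj ` circle x" if "V1 \<epsilon> x + V2 \<epsilon> y \<le> E" for y
  proof (rule image_eqI)
    show "(x, y, 0, sqrt (2 * (E - V1 \<epsilon> x - V2 \<epsilon> y))) \<in> circle x"
      using that by (simp add: circle_def stark_H_def) (simp add: field_simps)
  qed (simp add: x_proj_def)
  moreover have "V1 \<epsilon> x + V2 \<epsilon> y \<le> E" if "(x, y, d, c) \<in> circle x" for y d c
  proof -
    have "E = (0\<^sup>2 + c\<^sup>2) / 2 + V1 \<epsilon> x + V2 \<epsilon> y" using that by (auto simp: circle_def stark_H_def)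
    then show ?thesis by (simp add: add.assoc)
  qed
  ultimately show ?thesis by (auto simp: x_proj_def circle_def split: prod.splits)
qed

lemma K_curve_eq: "K_curve \<epsilon> E = K_closed - K_open"
proof -
  have "K_curve \<epsilon> E = {(x, y). x = a \<and> V1 \<epsilon> a + V2 \<epsilon> y \<le> E} \<union> {(x, y). x = - a \<and> V1 \<epsilon> (- a) + V2 \<epsilon> y \<le> E}
     \<union> {(x, y). V1 \<epsilon> x + V2 \<epsilon> y = E \<and> \<bar>x\<bar> \<le> a}"
    unfolding K_curve_def lyapunov_eq_circle x_proj_circle saddle_x1_eq by (auto simp: abs_le_iff)
  also have "\<dots> = K_closed - K_open"
  proof (rule set_eqI, clarify)
    fix x y
    have "x = a \<or> x = - a \<or> \<bar>x\<bar> < a \<or> a < \<bar>x\<bar>" by linarith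
    then show "(x, y) \<in> {(x, y). x = a \<and> V1 \<epsilon> a + V2 \<epsilon> y \<le> E} \<union> {(x, y). x = - a \<and> V1 \<epsilon> (- a) + V2 \<epsilon> y \<le> E}
     \<union> {(x, y). V1 \<epsilon> x + V2 \<epsilon> y = E \<and> \<bar>x\<bar> \<le> a} \<longleftrightarrow> (x, y) \<in> K_closed - K_open"
      using a_pos by (elim disjE) (auto simp: K_closed_def K_open_def)
  qed
  finally show ?thesis .
qed

lemma closed_K_closed: "closed K_closed"
  unfolding K_closed_def case_prod_unfold V1_def V2_def
  by (intro closed_Collect_conj closed_Collect_le continuous_intros)

lemma open_K_open: "open K_open"
  unfolding K_open_def case_prod_unfold V1_def V2_def
  by (intro open_Collect_conj open_Collect_less continuous_intros)

lemma bounded_K_closed: "bounded K_closed"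
proof (rule bounded_subset)
  show "bounded ({-a..a} \<times> {-(E + 1)..E + 1})" by (intro bounded_Times) auto
  have E0: "0 < E" using energy eps by (smt (verit) divide_pos_pos)
  show "K_closed \<subseteq> {-a..a} \<times> {-(E + 1)..E + 1}"
  proof
    fix q assume "q \<in> K_closed"
    then obtain x y where q: "q = (x, y)" "\<bar>x\<bar> \<le> a" "V1 \<epsilon> x + V2 \<epsilon> y \<le> E" by (auto simp: K_closed_def)
    have "4 * y\<^sup>2 \<le> V2 \<epsilon> y" using eps by (simp add: V2_def)
    then have "4 * y\<^sup>2 \<le> E" using V1_bounds(1)[OF q(2)] q(3) by linarith
    moreover have "E \<le> 4 * (E + 1)\<^sup>2" using E0 by (simp add: power2_eq_square algebra_simps)
    ultimately have "y\<^sup>2 \<le> (E + 1)\<^sup>2" by linarith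
    then have "\<bar>y\<bar> \<le> \<bar>E + 1\<bar>" by (simp add: abs_le_square_iff)
    then show "q \<in> {-a..a} \<times> {-(E + 1)..E + 1}" using q(1,2) E0 by auto
  qed
qed

lemma not_inside_if_ray:
  assumes "\<And>t. 0 \<le> t \<Longrightarrow> (q :: real \<times> real) + t *\<^sub>R d \<notin> S" "d \<noteq> 0"
  shows "q \<notin> inside S"
proof
  assume "q \<in> inside S"
  then have b: "bounded (connected_component_set (- S) q)" by (simp add: inside_def)
  let ?r = "(\<lambda>t. q + t *\<^sub>R d) ` {0..}"
  have "connected ?r" by (intro connected_continuous_image continuous_intros) auto
  moreover have "?r \<subseteq> - S" using assms(1) by auto
  moreover have "q \<in> ?r" by (rule image_eqI[of _ _ 0]) auto
  ultimately have "?r \<subseteq> connected_component_set (- S) q" by (intro connected_component_maximal)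
  then have "bounded ?r" using b bounded_subset by blast
  then obtain B where B: "\<And>t. 0 \<le> t \<Longrightarrow> norm (q + t *\<^sub>R d) \<le> B" by (auto simp: bounded_iff)
  define t where "t = (\<bar>B\<bar> + norm q + 1) / norm d"
  have t: "0 \<le> t" "t * norm d = \<bar>B\<bar> + norm q + 1" using assms(2) by (auto simp: t_def add_nonneg_nonneg)
  have "norm (t *\<^sub>R d) \<le> norm (q + t *\<^sub>R d) + norm q"
    using norm_triangle_ineq4[of "q + t *\<^sub>R d" q] by simp
  then show False using B[OF t(1)] t by simp
qed

text \<open>A component of the complement of the curve that meets \<open>K_open\<close> stays in it, since \<open>K_open\<close> and the
  complement of \<open>K_closed\<close> are open.  From a point outside \<open>K_closed\<close> a horizontal or vertical ray avoids the
  curve.\<close>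

lemma inside_K_curve: "inside (K_curve \<epsilon> E) = K_open"
proof
  have sub: "K_open \<subseteq> K_closed" by (auto simp: K_open_def K_closed_def)
  show "K_open \<subseteq> inside (K_curve \<epsilon> E)"
  proof
    fix q assume q: "q \<in> K_open"
    let ?C = "connected_component_set (- K_curve \<epsilon> E) q"
    have nc: "q \<notin> K_curve \<epsilon> E" using q by (simp add: K_curve_eq)
    have "?C \<subseteq> - K_curve \<epsilon> E" by (rule connected_component_subset)
    then have C: "?C \<subseteq> K_open \<union> - K_closed" unfolding K_curve_eq by blast
    have "q \<in> ?C" using nc by simp
    then have "- K_closed \<inter> ?C = {}"
      using connectedD[OF connected_connected_component open_K_open open_Compl[OF closed_K_closed], of _ q] C q sub by blast
    then have "?C \<subseteq> K_closed" by blast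
    then show "q \<in> inside (K_curve \<epsilon> E)"
      using nc bounded_subset[OF bounded_K_closed] by (simp add: inside_def)
  qed
  show "inside (K_curve \<epsilon> E) \<subseteq> K_open"
  proof (rule ccontr)
    assume "\<not> inside (K_curve \<epsilon> E) \<subseteq> K_open"
    then obtain x y where i: "(x, y) \<in> inside (K_curve \<epsilon> E)" and "(x, y) \<notin> K_open" by auto
    then have o: "(x, y) \<notin> K_closed" using inside_no_overlap[of "K_curve \<epsilon> E"] unfolding K_curve_eq by blast
    show False
    proof (cases "\<bar>x\<bar> \<le> a")
      case False
      have "(x, y) + t *\<^sub>R (sgn x, 0) \<notin> K_curve \<epsilon> E" if "0 \<le> t" for t
        using False that by (auto simp: K_curve_eq K_closed_def sgn_if abs_if split: if_splits)
      moreover have "(sgn x, 0 :: real) \<noteq> 0" using False a_pos by (auto simp: zero_prod_def sgn_if)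
      ultimately show False using not_inside_if_ray i by blast
    next
      case True
      then have V: "E < V1 \<epsilon> x + V2 \<epsilon> y" using o by (auto simp: K_closed_def)
      have y: "y \<noteq> 0" using V V1_bounds(2)[OF True] energy by (auto simp: V2_def)
      have "(x, y) + t *\<^sub>R (0, sgn y) \<notin> K_curve \<epsilon> E" if "0 \<le> t" for t
      proof -
        have "\<bar>y\<bar> \<le> \<bar>y + t * sgn y\<bar>" using that by (auto simp: sgn_if abs_if)
        then have "V2 \<epsilon> y \<le> V2 \<epsilon> (y + t * sgn y)" by (rule V2_mono)
        then show ?thesis using V by (auto simp: K_curve_eq K_closed_def)
      qed
      moreover have "(0 :: real, sgn y) \<noteq> 0" using y by (auto simp: zero_prod_def sgn_if)
      ultimately show False using not_inside_if_ray i by blast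
    qed
  qed
qed

lemma K_set_eq: "K_set \<epsilon> E = K_closed"
proof -
  have "K_open \<subseteq> K_closed" by (auto simp: K_open_def K_closed_def)
  then show ?thesis unfolding K_set_def inside_K_curve unfolding K_curve_eq by blast
qed

lemma S_set_eq: "S_set \<epsilon> E = strip"
proof -
  have "V1 \<epsilon> (x1 p) + V2 \<epsilon> (x2 p) \<le> E" if "H p = E" for p
  proof -
    have "E = ((y1 p)\<^sup>2 + (y2 p)\<^sup>2) / 2 + V1 \<epsilon> (x1 p) + V2 \<epsilon> (x2 p)"
      using that by (auto simp: stark_H_def split: prod.splits)
    moreover have "0 \<le> ((y1 p)\<^sup>2 + (y2 p)\<^sup>2) / 2" by simp
    ultimately show ?thesis by linarith
  qed
  then show ?thesis
    unfolding S_set_def strip_def K_set_eq K_closed_def x_proj_def by (auto split: prod.splits)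
qed

section \<open>The boundary spheres and the spanning disc\<close>

definition sphere_over :: "real \<Rightarrow> R4 set" where
  "sphere_over x = {p. H p = E \<and> x1 p = x}"

lemma connected_sphere_over: "connected (sphere_over x)"
proof -
  have sph: "q \<in> sphere 0 1 \<longleftrightarrow> (cmod (fst q))\<^sup>2 + (snd q)\<^sup>2 = 1" for q :: "complex \<times> real"
    by (simp add: norm_prod_def)
  have "sphere_over x = (\<lambda>q. pt x (fst q) (snd q)) ` sphere 0 1"
  proof
    show "(\<lambda>q. pt x (fst q) (snd q)) ` sphere 0 1 \<subseteq> sphere_over x"
      using energy_pt sph by (auto simp: sphere_over_def)
    show "sphere_over x \<subseteq> (\<lambda>q. pt x (fst q) (snd q)) ` sphere 0 1"
    proof
      fix p assume p: "p \<in> sphere_over x"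
      then have H: "H p = E" and x: "x1 p = x" by (auto simp: sphere_over_def)
      obtain \<zeta> m where e: "p = pt (x1 p) \<zeta> m" "(cmod \<zeta>)\<^sup>2 + m\<^sup>2 = 1" using pt_surj[OF H] by metis
      then show "p \<in> (\<lambda>q. pt x (fst q) (snd q)) ` sphere 0 1"
        using sph[of "(\<zeta>, m)"] x by (intro image_eqI[of _ _ "(\<zeta>, m)"]) auto
    qed
  qed
  moreover have "connected ((\<lambda>q. pt x (fst q) (snd q)) ` sphere (0 :: complex \<times> real) 1)"
    by (intro connected_continuous_image continuous_intros connected_sphere) simp
  ultimately show ?thesis by simp
qed

text \<open>The energy surface continues over \<open>|x\<^sub>1| > a\<close>: with fixed coordinates in the fibre sphere, a point
  over the saddle can be moved out of \<open>S\<^sub>E\<close>.\<close>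

lemma sphere_over_frontier:
  assumes s: "s\<^sup>2 = 1"
  shows "sphere_over (s * a) \<subseteq> top_of_set (H -` {E}) frontier_of strip"
proof
  fix p assume p: "p \<in> sphere_over (s * a)"
  then have H: "H p = E" and x: "x1 p = s * a" by (auto simp: sphere_over_def)
  have "p \<in> strip" using H x sign_abs[OF s, of a] a_pos by (simp add: strip_def)
  then have "p \<in> top_of_set (H -` {E}) closure_of strip"
    using closure_of_subset[of strip "top_of_set (H -` {E})"] by (auto simp: strip_def)
  moreover have "p \<notin> top_of_set (H -` {E}) interior_of strip"
  proof
    assume "p \<in> top_of_set (H -` {E}) interior_of strip"
    then obtain B where B: "open B" "p \<in> B" "H -` {E} \<inter> B \<subseteq> strip"
      by (auto simp: interior_of_def openin_open)
    obtain \<zeta> m where e: "p = pt (x1 p) \<zeta> m" "(cmod \<zeta>)\<^sup>2 + m\<^sup>2 = 1" using pt_surj[OF H] by metis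
    let ?c = "\<lambda>t. pt (s * (a + t)) \<zeta> m"
    have "continuous_on UNIV ?c" by (intro continuous_intros)
    then have "(?c \<longlongrightarrow> ?c 0) (at 0)" unfolding continuous_on_def by blast
    then have "(?c \<longlongrightarrow> ?c 0) (at_right 0)" by (rule tendsto_within_subset) simp
    moreover have "?c 0 = p" using e(1) x by simp
    ultimately have "\<forall>\<^sub>F t in at_right 0. ?c t \<in> B" using B(1,2) topological_tendstoD by metis
    then have "\<forall>\<^sub>F t in at_right 0. ?c t \<in> B \<and> 0 < t"
      by (rule eventually_conj) (rule eventually_at_right_less)
    then obtain t where t: "0 < t" "?c t \<in> B"
      using eventually_happens'[OF trivial_limit_at_right_real] by blast
    then have "?c t \<in> strip" using B(3) energy_pt[OF e(2)] by auto
    then show False using t(1) sign_abs[OF s, of "a + t"] a_pos by (simp add: strip_def)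
  qed
  ultimately show "p \<in> top_of_set (H -` {E}) frontier_of strip" by (simp add: frontier_of_def)
qed

lemma leafU_in_boundary_sphere:
  assumes s: "s1\<^sup>2 = 1"
  shows "leafU s1 s2 \<subseteq> boundary_sphere H E strip (circle (s1 * a))"
proof -
  have sub: "leafU s1 s2 \<subseteq> sphere_over (s1 * a)" "circle (s1 * a) \<subseteq> sphere_over (s1 * a)"
    by (auto simp: leafU_def circle_def sphere_over_def)
  have "pt (s1 * a) 1 0 \<in> sphere_over (s1 * a)"
    using energy_pt[of 1 0] by (simp add: sphere_over_def)
  then have "top_of_set (H -` {E}) frontier_of strip \<noteq> {}"
    using sphere_over_frontier[OF s] by blast
  then obtain C where "C \<in> components (top_of_set (H -` {E}) frontier_of strip)" "sphere_over (s1 * a) \<subseteq> C"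
    using exists_component_superset[OF sphere_over_frontier[OF s] _ connected_sphere_over] by blast
  then show ?thesis unfolding boundary_sphere_def using sub by blast
qed

text \<open>The hemisphere \<open>y\<^sub>1 \<ge> 0\<close> over \<open>x\<^sub>1 = 0\<close> in stereographic coordinates, which are smooth up to
  the boundary circle.\<close>

definition spanning_disc :: "complex \<Rightarrow> R4" where
  "spanning_disc z = pt 0 ((2 / (1 + (cmod z)\<^sup>2)) *\<^sub>R z) ((1 - (cmod z)\<^sup>2) / (1 + (cmod z)\<^sup>2))"

lemma smooth_embedding_spanning_disc: "smooth_embedding UNIV spanning_disc"
proof (rule smooth_embeddingI[where g="\<lambda>p. (1 / (R (x1 p) + y1 p)) *\<^sub>R zeta p"])
  have n: "1 + (cmod z)\<^sup>2 \<noteq> 0" for z using one_plus_norm_pos(1)[of z] by simp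
  show "smooth_on UNIV spanning_disc"
    unfolding spanning_disc_def by (intro smooth_intros) (auto simp: n)
  have r: "R (x1 (spanning_disc z)) + y1 (spanning_disc z) = R 0 * (2 / (1 + (cmod z)\<^sup>2))" for z
    using n[of z] by (simp add: spanning_disc_def field_simps)
  show "(1 / (R (x1 (spanning_disc z)) + y1 (spanning_disc z))) *\<^sub>R zeta (spanning_disc z) = z" for z
    unfolding r using n[of z] R_pos[of 0] by (simp add: spanning_disc_def)
  show "(\<lambda>p. (1 / (R (x1 p) + y1 p)) *\<^sub>R zeta p) differentiable (at (spanning_disc z))" for z
  proof (rule smooth_on_imp_differentiable)
    let ?U = "{p :: R4. R (x1 p) + y1 p \<noteq> 0}"
    have o: "open ?U" by (intro open_Collect_neq continuous_intros)
    show "smooth_on ?U (\<lambda>p. (1 / (R (x1 p) + y1 p)) *\<^sub>R zeta p)" by (intro smooth_intros o) auto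
    have "0 < R 0 * (2 / (1 + (cmod z)\<^sup>2))" using R_pos[of 0] one_plus_norm_pos(1)[of z] by simp
    then show "spanning_disc z \<in> ?U" using r[of z] by auto
  qed
qed auto

lemma unknotted_circle_0: "unknotted_in strip (circle 0)"
  unfolding unknotted_in_def
proof (intro exI conjI ballI)
  note emb = smooth_embedding_spanning_disc[unfolded smooth_embedding_def]
  show "open (UNIV :: complex set)" "cball 0 1 \<subseteq> (UNIV :: complex set)" by auto
  show "smooth_on UNIV spanning_disc" using emb by blast
  show "inj (frechet_derivative spanning_disc (at z))" for z using emb by blast
  show "inj_on spanning_disc (cball 0 1)"
    using emb by (metis homeomorphism_apply1 inj_on_inverseI inj_on_subset subset_UNIV)
  have "H (spanning_disc z) = E" for z
  proof -
    have n: "1 + (cmod z)\<^sup>2 \<noteq> 0" using one_plus_norm_pos(1)[of z] by simp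
    have "(2 * cmod z)\<^sup>2 + (1 - (cmod z)\<^sup>2)\<^sup>2 = (1 + (cmod z)\<^sup>2)\<^sup>2"
      by (simp add: power2_eq_square algebra_simps)
    then show ?thesis
      unfolding spanning_disc_def using n
      by (intro energy_pt) (simp add: power_divide power_mult_distrib flip: add_divide_distrib)
  qed
  then show "spanning_disc ` cball 0 1 \<subseteq> strip" using a_pos by (auto simp: strip_def spanning_disc_def)
  have "spanning_disc ` sphere 0 1 = disc 1 (\<lambda>_. 0) ` sphere 0 1"
    by (rule image_cong) (auto simp: spanning_disc_def disc_def)
  then show "spanning_disc ` sphere 0 1 = circle 0" using disc_image_sphere[of 1 "\<lambda>_. 0"] by simp
qed

section \<open>The foliation\<close>

lemma saddle_orbit:
  assumes "b\<^sup>2 = a\<^sup>2"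
  obtains P where "periodic_orbit H P" "orbit_set P = circle b" "orbit_index H P = 2"
    "hyperbolic_orbit H P"
proof -
  have "W1 b = 0" unfolding W1_factor assms a_square using eps by simp
  from orbit_exists[OF this] obtain T \<phi> where o: "stark_orbit \<epsilon> E b T \<phi>" by blast
  show thesis
    by (rule that[OF stark_orbit.periodic_w[OF o] stark_orbit.orbit_set_w[OF o]
          stark_orbit.index_2[OF o assms] stark_orbit.hyperbolic[OF o assms]])
qed

lemma center_orbit:
  obtains P where "periodic_orbit H P" "orbit_set P = circle 0" "orbit_index H P = 3"
proof -
  have "W1 0 = 0" by (simp add: W1_def)
  from orbit_exists[OF this] obtain T \<phi> where o: "stark_orbit \<epsilon> E 0 T \<phi>" "sqrt 8 * T \<le> 2 * pi" by blast
  show thesis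
    by (rule that[OF stark_orbit.periodic_w[OF o(1)] stark_orbit.orbit_set_w[OF o(1)]
          stark_orbit.index_3[OF o(1) refl o(2)]])
qed

definition sg :: "nat \<Rightarrow> real" where "sg j = (if j = 1 then 1 else - 1)"

definition the_leaf :: "leaf_label \<Rightarrow> R4 set" where
  "the_leaf = leaf (\<lambda>j. leafU (sg j) (sg j)) (\<lambda>j. leafU (sg j) (- sg j)) (\<lambda>j. leafV (sg j))
     (\<lambda>j \<tau>. leafD (sg j) (C_of \<tau>))"

lemma sg_square [simp]: "(sg j)\<^sup>2 = 1" "(- sg j)\<^sup>2 = 1"
  by (simp_all add: sg_def)

lemma sg_surj: "s\<^sup>2 = 1 \<Longrightarrow> \<exists>j\<in>{1..2}. s = sg j"
  using sign_cases[of s] by (auto simp: sg_def intro: bexI[of _ 1] bexI[of _ 2])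

lemma the_leaf_cases:
  assumes "i \<in> leaf_labels 2"
  obtains j where "i = LU1 j" "j \<in> {1..2}" "the_leaf i = leafU (sg j) (sg j)"
  | j where "i = LU2 j" "j \<in> {1..2}" "the_leaf i = leafU (sg j) (- sg j)"
  | j where "i = LV j" "j \<in> {1..2}" "the_leaf i = leafV (sg j)"
  | j \<tau> where "i = LD j \<tau>" "j \<in> {1..2}" "\<tau> \<in> {0<..<1}" "the_leaf i = leafD (sg j) (C_of \<tau>)"
  using assms unfolding leaf_labels_def the_leaf_def by auto

lemma leavesI:
  "s1\<^sup>2 = 1 \<Longrightarrow> s2\<^sup>2 = 1 \<Longrightarrow> leafU s1 s2 \<in> leaves" "s1\<^sup>2 = 1 \<Longrightarrow> leafV s1 \<in> leaves"
  "s1\<^sup>2 = 1 \<Longrightarrow> leafD s1 C \<in> leaves"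
  unfolding leaves_def by blast+

lemma the_leaf_image: "the_leaf ` leaf_labels 2 = leaves"
proof
  show "the_leaf ` leaf_labels 2 \<subseteq> leaves"
  proof (rule image_subsetI)
    fix i assume "i \<in> leaf_labels 2"
    then show "the_leaf i \<in> leaves"
      by (cases rule: the_leaf_cases) (simp_all only: leavesI sg_square)
  qed
  show "leaves \<subseteq> the_leaf ` leaf_labels 2"
  proof
    fix L assume "L \<in> leaves"
    then consider (U) s1 s2 where "s1\<^sup>2 = 1" "s2\<^sup>2 = 1" "L = leafU s1 s2"
      | (V) s where "s\<^sup>2 = 1" "L = leafV s" | (D) s C where "s\<^sup>2 = 1" "L = leafD s C"
      unfolding leaves_def by blast
    then show "L \<in> the_leaf ` leaf_labels 2"
    proof cases
      case U
      obtain j where j: "j \<in> {1..2}" "s1 = sg j" using sg_surj[OF U(1)] by blast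
      have "s2 = sg j \<or> s2 = - sg j" using sign_cases[OF U(2)] by (auto simp: sg_def)
      then have "L = the_leaf (LU1 j) \<or> L = the_leaf (LU2 j)" using U(3) j(2) by (auto simp: the_leaf_def)
      moreover have "LU1 j \<in> leaf_labels 2" "LU2 j \<in> leaf_labels 2" using j by (auto simp: leaf_labels_def)
      ultimately show ?thesis by blast
    next
      case V
      obtain j where j: "j \<in> {1..2}" "s = sg j" using sg_surj[OF V(1)] by blast
      then have "L = the_leaf (LV j)" "LV j \<in> leaf_labels 2" using V(2) by (auto simp: the_leaf_def leaf_labels_def)
      then show ?thesis by blast
    next
      case D
      obtain j where j: "j \<in> {1..2}" "s = sg j" using sg_surj[OF D(1)] by blast
      then have "L = the_leaf (LD j (tau_of C))" using D(2) by (simp add: the_leaf_def C_of_tau_of)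
      moreover have "LD j (tau_of C) \<in> leaf_labels 2"
        using j tau_of_bounds[of C] by (auto simp: leaf_labels_def)
      ultimately show ?thesis by blast
    qed
  qed
qed

text \<open>The label of a leaf can be read off from the coordinates of any of its points; hence distinct leaves
  are disjoint.\<close>

definition label_at :: "R4 \<Rightarrow> leaf_label" where
  "label_at p = (let j = (\<lambda>x. if 0 < x then 1 else 2) in
     if \<bar>x1 p\<bar> = a then (if 0 < x1 p * y1 p then LU1 (j (x1 p)) else LU2 (j (x1 p)))
     else if y1 p = 0 then LV (j (x1 p))
     else LD (j (y1 p)) (tau_of (sgn (y1 p) * G (x1 p) / y1 p ^ 8)))"

lemma label_at_leaf:
  assumes "i \<in> leaf_labels 2" "p \<in> the_leaf i"
  shows "label_at p = i"
  using assms(1)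
proof (cases rule: the_leaf_cases)
  case (1 j)
  have "p \<in> leafU (sg j) (sg j)" using assms(2) 1 by simp
  then show ?thesis using 1 a_pos
    by (cases "j = 1") (auto simp: label_at_def leafU_def sg_def zero_less_mult_iff mult_less_0_iff)
next
  case (2 j)
  have "p \<in> leafU (sg j) (- sg j)" using assms(2) 2 by simp
  then show ?thesis using 2 a_pos
    by (cases "j = 1") (auto simp: label_at_def leafU_def sg_def zero_less_mult_iff mult_less_0_iff)
next
  case (3 j)
  have "p \<in> leafV (sg j)" using assms(2) 3 by simp
  then show ?thesis using 3 by (cases "j = 1") (auto simp: label_at_def leafV_def sg_def)
next
  case (4 j \<tau>)
  have p: "\<bar>x1 p\<bar> < a" "0 < sg j * y1 p" "sg j * G (x1 p) = C_of \<tau> * y1 p ^ 8"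
    using assms(2) 4 by (auto simp: leafD_def)
  have s: "sgn (y1 p) = sg j" "y1 p \<noteq> 0" "(if 0 < y1 p then 1 else 2) = j"
    using p(2) 4(2) by (auto simp: sg_def split: if_splits)
  have "tau_of (sgn (y1 p) * G (x1 p) / y1 p ^ 8) = \<tau>"
    using tau_of_C_of[OF 4(3)] s(2) by (simp add: s(1) p(3))
  then show ?thesis using p(1) s 4(1) by (simp add: label_at_def Let_def)
qed

lemma disjoint_leaves: "disjoint_family_on the_leaf (leaf_labels 2)"
  unfolding disjoint_family_on_def using label_at_leaf by blast

lemma leaf_subset_M: "L \<in> leaves \<Longrightarrow> L \<subseteq> M"
proof -
  have "leafU s1 s2 \<subseteq> M" if "s1\<^sup>2 = 1" "s2\<^sup>2 = 1" for s1 s2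
    using proper_plane_leafU[OF that] closedin_imp_subset unfolding proper_plane_def by blast
  moreover have "leafV s \<subseteq> M" if "s\<^sup>2 = 1" for s
    using proper_cylinder_leafV[OF that] closedin_imp_subset unfolding proper_cylinder_def by blast
  moreover have "leafD s C \<subseteq> M" if "s\<^sup>2 = 1" for s C
    using proper_plane_leafD[OF that] closedin_imp_subset unfolding proper_plane_def by blast
  ultimately show "L \<in> leaves \<Longrightarrow> L \<subseteq> M" unfolding leaves_def by blast
qed

lemma Union_leaves: "(\<Union>i\<in>leaf_labels 2. the_leaf i) = M"
proof -
  have "M \<subseteq> \<Union>leaves"
  proof
    fix p assume "p \<in> M"
    then show "p \<in> \<Union>leaves" by (cases rule: M_cases) (blast intro: leavesI)+
  qed
  then show ?thesis using leaf_subset_M by (fastforce simp flip: the_leaf_image)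
qed

lemma leaf_transverse:
  assumes "i \<in> leaf_labels 2" "p \<in> the_leaf i"
  shows "ham_vf H p \<notin> tangent_vectors (the_leaf i) p"
  using assms(1)
proof (cases rule: the_leaf_cases)
  case (1 j) then show ?thesis using leafU_transverse assms(2) by simp
next
  case (2 j) then show ?thesis using leafU_transverse assms(2) by simp
next
  case (3 j) then show ?thesis using leafV_transverse[OF sg_square(1)] assms(2) by simp
next
  case (4 j \<tau>) then show ?thesis using leafD_transverse[OF sg_square(1)] assms(2) by simp
qed

lemma leaf_gradient_line:
  assumes "i \<in> leaf_labels 2"
  shows "\<exists>\<gamma>. gradient_trajectory (H1 \<epsilon>) \<gamma> \<and> proj1 ` the_leaf i = range \<gamma> \<inter> proj1 ` strip"
  using assms
proof (cases rule: the_leaf_cases)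
  case (1 j) then show ?thesis using leafU_gradient_line[OF sg_square(1) sg_square(1)] by simp
next
  case (2 j) then show ?thesis using leafU_gradient_line[OF sg_square(1) sg_square(2)] by simp
next
  case (3 j) then show ?thesis using leafV_gradient_line[OF sg_square(1)] by simp
next
  case (4 j \<tau>) then show ?thesis using leafD_gradient_line[OF sg_square(1)] by simp
qed

lemma family_limit_0:
  "s\<^sup>2 = 1 \<Longrightarrow> hausdorff_converges (\<lambda>\<tau>. leafD s (C_of \<tau>)) (closure (leafU s s \<union> leafV s)) (at_right 0)"
  using hausdorff_converges_leafD[of s 1 "at_right 0"] C_of_at_0 by simp

lemma family_limit_1:
  "s\<^sup>2 = 1 \<Longrightarrow> hausdorff_converges (\<lambda>\<tau>. leafD s (C_of \<tau>)) (closure (leafU (- s) s \<union> leafV (- s))) (at_left 1)"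
  using hausdorff_converges_leafD[of s "-1" "at_left 1"] C_of_at_1 by simp

lemma sg_cyclic_next: "j \<in> {1..2} \<Longrightarrow> sg (cyclic_next 2 j) = - sg j"
  by (auto simp: sg_def cyclic_next_def)

lemma foliation:
  assumes P2: "\<And>j. j \<in> {1..2} \<Longrightarrow> periodic_orbit H (P2 j) \<and> orbit_index H (P2 j) = 2 \<and>
      hyperbolic_orbit H (P2 j) \<and> orbit_set (P2 j) = circle (sg j * a)"
    and P3: "periodic_orbit H P3" "orbit_index H P3 = 3" "orbit_set P3 = circle 0"
  shows "weakly_convex_foliation H E strip 2 P2 P3 (\<lambda>j. leafU (sg j) (sg j))
    (\<lambda>j. leafU (sg j) (- sg j)) (\<lambda>j. leafV (sg j)) (\<lambda>j \<tau>. leafD (sg j) (C_of \<tau>))"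
proof -
  have two: "{1..2::nat} = {1, 2}" by auto
  have B: "binding 2 P2 P3 = bind_orbits"
    unfolding binding_def two using P2[of 1] P2[of 2] P3(3)
    by (auto simp: circle_def bind_orbits_def sg_def)
  have disj: "circle x \<inter> circle y = {}" if "x \<noteq> y" for x y using that by (auto simp: circle_def)
  have dj: "disjoint_family_on (\<lambda>j. orbit_set (P2 j)) {1..2}"
    unfolding disjoint_family_on_def two using P2[of 1] P2[of 2] disj[of a "- a"] disj[of "- a" a] a_pos
    by (auto simp: sg_def)
  have sub: "bind_orbits \<subseteq> strip" using a_pos by (auto simp: bind_orbits_def strip_def)
  have strip: "strip \<subseteq> H -` {E}" by (auto simp: strip_def)
  have d3: "orbit_set (P2 j) \<inter> orbit_set P3 = {}" if "j \<in> {1..2}" for j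
    using P2[OF that] P3(3) disj[of "sg j * a" 0] a_pos by (simp add: sg_def)
  have M: "strip - bind_orbits = M" by (simp add: M_def)
  have planes: "proper_plane M U \<and> U \<subseteq> boundary_sphere H E strip (orbit_set (P2 j)) \<and>
      asymptotic_to U (orbit_set (P2 j))"
    if j: "j \<in> {1..2}" and U: "U \<in> {leafU (sg j) (sg j), leafU (sg j) (- sg j)}" for j U
  proof -
    obtain s2 where s2: "s2\<^sup>2 = 1" "U = leafU (sg j) s2" using U sg_square by blast
    show ?thesis
      using P2[OF j] proper_plane_leafU[OF sg_square(1) s2(1)]
        leafU_in_boundary_sphere[OF sg_square(1)] asymptotic_leafU[OF s2(1)]
      by (simp only: s2(2))
  qed
  have cylinders: "proper_cylinder M (leafV (sg j))" "asymptotic_to (leafV (sg j)) (orbit_set P3)"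
    "asymptotic_to (leafV (sg j)) (orbit_set (P2 j))" if "j \<in> {1..2}" for j
    using P2[OF that] P3(3) proper_cylinder_leafV[OF sg_square(1)] asymptotic_leafV[OF sg_square(1)] by auto
  have families: "smooth_plane_family (\<lambda>\<tau>. leafD (sg j) (C_of \<tau>))" "proper_plane M (leafD (sg j) C)"
    "asymptotic_to (leafD (sg j) C) (orbit_set P3)" for j C
    using P3(3) smooth_plane_family_leafD[OF sg_square(1)] proper_plane_leafD[OF sg_square(1)]
      asymptotic_leafD[OF sg_square(1)] by auto
  have limits: "hausdorff_converges (\<lambda>\<tau>. leafD (sg j) (C_of \<tau>)) (closure (leafU (sg j) (sg j) \<union> leafV (sg j))) (at_right 0)"
    "hausdorff_converges (\<lambda>\<tau>. leafD (sg j) (C_of \<tau>))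
      (closure (leafU (sg (cyclic_next 2 j)) (- sg (cyclic_next 2 j)) \<union> leafV (sg (cyclic_next 2 j)))) (at_left 1)"
    if "j \<in> {1..2}" for j
    using family_limit_0[OF sg_square(1)] family_limit_1[OF sg_square(1)] sg_cyclic_next[OF that] by auto
  have M': "strip - binding 2 P2 P3 = M" by (simp add: B M_def)
  have "binding 2 P2 P3 \<subseteq> strip" using sub B by simp
  moreover have "unknotted_in strip (orbit_set P3)" using unknotted_circle_0 P3(3) by simp
  ultimately show ?thesis
    unfolding weakly_convex_foliation_def Let_def M' the_leaf_def[symmetric] the_leaf_image
  proof (intro conjI ballI)
    show "strip \<subseteq> H -` {E}" by (rule strip)
    show "periodic_orbit H (P2 j)" "orbit_index H (P2 j) = 2"
      "hyperbolic_orbit H (P2 j)" if "j \<in> {1..2}" for j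
      using P2[OF that] by blast+
    show "orbit_set (P2 j) \<inter> orbit_set P3 = {}" if "j \<in> {1..2}" for j by (rule d3[OF that])
    show "foliated_at M leaves p" if "p \<in> M" for p by (rule foliated_at_M[OF that])
    show "proper_plane M U" "U \<subseteq> boundary_sphere H E strip (orbit_set (P2 j))"
      "asymptotic_to U (orbit_set (P2 j))"
      if "j \<in> {1..2}" "U \<in> {leafU (sg j) (sg j), leafU (sg j) (- sg j)}" for j U
      using planes[OF that] by blast+
    show "ham_vf H p \<notin> tangent_vectors (the_leaf i) p"
      if "i \<in> leaf_labels 2" "p \<in> the_leaf i" for i p
      by (rule leaf_transverse[OF that])
    show "proper_cylinder M (leafV (sg j))" "asymptotic_to (leafV (sg j)) (orbit_set P3)"
      "asymptotic_to (leafV (sg j)) (orbit_set (P2 j))" if "j \<in> {1..2}" for j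
      by (rule cylinders[OF that])+
    show "smooth_plane_family (\<lambda>\<tau>. leafD (sg j) (C_of \<tau>))" for j by (rule families)
    show "proper_plane M (leafD (sg j) (C_of \<tau>))" "asymptotic_to (leafD (sg j) (C_of \<tau>)) (orbit_set P3)"
      for j \<tau> by (rule families)+
    show "hausdorff_converges (\<lambda>\<tau>. leafD (sg j) (C_of \<tau>))
        (closure (leafU (sg j) (sg j) \<union> leafV (sg j))) (at_right 0)"
      "hausdorff_converges (\<lambda>\<tau>. leafD (sg j) (C_of \<tau>))
        (closure (leafU (sg (cyclic_next 2 j)) (- sg (cyclic_next 2 j)) \<union> leafV (sg (cyclic_next 2 j))))
        (at_left 1)" if "j \<in> {1..2}" for j
      by (rule limits[OF that])+
  qed (assumption | rule dj P3(1,2) disjoint_leaves Union_leaves[unfolded the_leaf_image])+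
qed

end

theorem proposition4p9:
  fixes \<epsilon> E :: real
  assumes "\<epsilon> > 0" and "E > e_star \<epsilon>"
  shows "\<exists>P2 P3 U1 U2 V D.
    weakly_convex_foliation (stark_H \<epsilon>) E (S_set \<epsilon> E) 2 P2 P3 U1 U2 V D \<and>
    orbit_set (P2 1) = lyapunov_set \<epsilon> E 1 \<and>
    orbit_set (P2 2) = lyapunov_set \<epsilon> E 2 \<and>
    x_proj ` orbit_set P3 \<subseteq> K_set \<epsilon> E \<and>
    (\<forall>i\<in>leaf_labels 2. \<exists>\<gamma>. gradient_trajectory (H1 \<epsilon>) \<gamma> \<and>
       proj1 ` leaf U1 U2 V D i = range \<gamma> \<inter> proj1 ` S_set \<epsilon> E)"
proof -
  interpret stark \<epsilon> E using assms by unfold_locales (auto simp: e_star_def)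
  obtain P21 where 1: "periodic_orbit (stark_H \<epsilon>) P21" "orbit_set P21 = circle a"
    "orbit_index (stark_H \<epsilon>) P21 = 2" "hyperbolic_orbit (stark_H \<epsilon>) P21"
    using saddle_orbit[of a] by blast
  obtain P22 where 2: "periodic_orbit (stark_H \<epsilon>) P22" "orbit_set P22 = circle (- a)"
    "orbit_index (stark_H \<epsilon>) P22 = 2" "hyperbolic_orbit (stark_H \<epsilon>) P22"
    using saddle_orbit[of "- a"] by auto
  obtain P3 where 3: "periodic_orbit (stark_H \<epsilon>) P3" "orbit_set P3 = circle 0" "orbit_index (stark_H \<epsilon>) P3 = 3"
    using center_orbit by blast
  define P2 where "P2 j = (if j = 1 then P21 else P22)" for j :: nat
  have "x_proj ` circle 0 \<subseteq> K_set \<epsilon> E"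
    unfolding x_proj_circle K_set_eq K_closed_def using a_pos by auto
  moreover have "weakly_convex_foliation (stark_H \<epsilon>) E strip 2 P2 P3 (\<lambda>j. leafU (sg j) (sg j))
    (\<lambda>j. leafU (sg j) (- sg j)) (\<lambda>j. leafV (sg j)) (\<lambda>j \<tau>. leafD (sg j) (C_of \<tau>))"
    by (rule foliation) (use 1 2 3 in \<open>auto simp: P2_def sg_def\<close>)
  moreover have "orbit_set (P2 1) = lyapunov_set \<epsilon> E 1" "orbit_set (P2 2) = lyapunov_set \<epsilon> E 2"
    using 1 2 by (simp_all add: P2_def lyapunov_eq_circle)
  ultimately show ?thesis
    unfolding S_set_eq
    by (intro exI[of _ P2] exI[of _ P3] exI[of _ "\<lambda>j. leafU (sg j) (sg j)"]
        exI[of _ "\<lambda>j. leafU (sg j) (- sg j)"] exI[of _ "\<lambda>j. leafV (sg j)"]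
        exI[of _ "\<lambda>j \<tau>. leafD (sg j) (C_of \<tau>)"])
      (simp add: 3(2) leaf_gradient_line flip: the_leaf_def)
qed

end
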